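(* Let $1<\alpha,p<\infty$. Suppose that the operator $\mathcal{H}:L^p(\mathbb{R}^+)\to L^p(\mathbb{R}^+)$ is compact. If $\alpha\le p$, then $\|\mathcal{H}\|_{\mathbf{S}_\alpha}\ll\mathcal{V}$, where $$\mathcal{V}^\alpha:=\int_0^\infty\biggl[\int_{b^{-1}(t)}^{a^{-1}(t)}w^p\biggr]^{\frac{\alpha}{p}}\biggl[\int_{a(\sigma^{-1}(t))}^{b(\sigma^{-1}(t))}v^{p'}\biggr]^{\frac{\alpha}{p'}-1}v^{p'}(t)\,\mathrm{d}t.$$ If $p\le\alpha$, then $\|\mathcal{H}\|_{\mathbf{S}_\alpha}\ll\mathcal{W}$, where $$\mathcal{W}^\alpha:=\int_0^\infty\biggl[\int_{b^{-1}(\sigma(t))}^{a^{-1}(\sigma(t))}w^p\biggr]^{\frac{\alpha}{p}-1}\biggl[\int_{a(t)}^{b(t)}v^{p'}\biggr]^{\frac{\alpha}{p'}}w^p(t)\,\mathrm{d}t.$$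
   Context: $A\ll B$ means $A\le cB$ with a constant $c$ which is absolute or depends only on $p$ or $\alpha$. $\mathbb{R}^+=[0,+\infty)$, $\mathbb{N}=\{1,2,\ldots\}$, $p'=p/(p-1)$. Products $0\cdot\infty$ are taken to be $0$. $v,w$ are non-negative weight functions on $\mathbb{R}^+$ with $v\in L^{p'}_{\rm loc}(0,\infty)$ and $w\in L^p_{\rm loc}(0,\infty)$. The boundary functions $a(x),b(x)$ satisfy: (i) $a,b$ are differentiable and strictly increasing on $(0,\infty)$; (ii) $a(0)=b(0)=0$, $a(x)<b(x)$ for $0<x<\infty$, $a(\infty)=b(\infty)=\infty$. The Hardy-Steklov operator is $$\mathcal{H}f(x)=w(x)\int_{a(x)}^{b(x)}f(y)v(y)\,\mathrm{d}y.$$ The approximation numbers of $T:X\to X$ are $a_n(T)=\inf_{K:\,\mathrm{rank}\,K<n}\|T-K\|_{X\to X}$, $n=1,2,\ldots$, and $\|T\|_{\mathbf{S}_\alpha}:=\bigl(\sum_{n\in\mathbb{N}}a_n^\alpha(T)\bigr)^{1/\alpha}$; here $X=L^p(\mathbb{R}^+)$. The fairway function $\sigma$ satisfies $a(t)<\sigma(t)<b(t)$ and $\int_{a(t)}^{\sigma(t)}v^{p'}(y)\,\mathrm{d}y=\int_{\sigma(t)}^{b(t)}v^{p'}(y)\,\mathrm{d}y$ for all $t>0$; it is taken to be invertible (a strictly increasing bijection of $(0,\infty)$), with inverse $\sigma^{-1}$. *)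

theory Defs
  imports "HOL-Analysis.Analysis" "HOL-Library.Extended_Nat"
begin

(* Real powers on [0,\<infinity>], with 0 ^ a = \<infinity> for a < 0 and x ^ 0 = 1.  Together with
   0 * \<infinity> = 0, which holds in ennreal, this is the convention needed for the
   weighted integrals below, where exponents may be negative. *)
definition epowr :: "ennreal \<Rightarrow> real \<Rightarrow> ennreal" where
  "epowr x a =
     (if a = 0 then 1
      else if x = 0 then (if a > 0 then 0 else \<infinity>)
      else if x = \<infinity> then (if a > 0 then \<infinity> else 0)
      else ennreal (enn2real x powr a))"

definition conj_exp :: "real \<Rightarrow> real" where
  "conj_exp p = p / (p - 1)"


(* Elements of L^p are represented by functions; all notions below respect equality
   almost everywhere. *)

definition Lp_norm :: "'a measure \<Rightarrow> real \<Rightarrow> ('a \<Rightarrow> real) \<Rightarrow> ennreal" where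
  "Lp_norm M p f = epowr (\<integral>\<^sup>+ x. ennreal (\<bar>f x\<bar> powr p) \<partial>M) (1 / p)"

definition Lp_space :: "'a measure \<Rightarrow> real \<Rightarrow> ('a \<Rightarrow> real) set" where
  "Lp_space M p = {f \<in> borel_measurable M. Lp_norm M p f < \<infinity>}"

definition Lp_loc :: "real set \<Rightarrow> real \<Rightarrow> (real \<Rightarrow> real) set" where
  "Lp_loc \<Omega> p =
     {f \<in> borel_measurable (lebesgue_on \<Omega>).
        \<forall>K. compact K \<and> K \<subseteq> \<Omega> \<longrightarrow> f \<in> Lp_space (lebesgue_on K) p}"

definition half_line :: "real measure" where
  "half_line = lebesgue_on {0..}"


(* A linear map from L^p to L^p, i.e. a map of representatives that is compatible with
   equality almost everywhere and linear modulo such equality. *)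
definition Lp_operator :: "'a measure \<Rightarrow> real \<Rightarrow> (('a \<Rightarrow> real) \<Rightarrow> 'a \<Rightarrow> real) \<Rightarrow> bool" where
  "Lp_operator M p T \<longleftrightarrow>
     (\<forall>f\<in>Lp_space M p. T f \<in> Lp_space M p) \<and>
     (\<forall>f\<in>Lp_space M p. \<forall>g\<in>Lp_space M p.
        (AE x in M. f x = g x) \<longrightarrow> (AE x in M. T f x = T g x)) \<and>
     (\<forall>f\<in>Lp_space M p. \<forall>g\<in>Lp_space M p. \<forall>c d.
        AE x in M. T (\<lambda>y. c * f y + d * g y) x = c * T f x + d * T g x)"

definition Lp_opnorm :: "'a measure \<Rightarrow> real \<Rightarrow> (('a \<Rightarrow> real) \<Rightarrow> 'a \<Rightarrow> real) \<Rightarrow> ennreal" where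
  "Lp_opnorm M p T = (SUP f \<in> {f \<in> Lp_space M p. Lp_norm M p f \<le> 1}. Lp_norm M p (T f))"

definition Lp_compact_operator ::
    "'a measure \<Rightarrow> real \<Rightarrow> (('a \<Rightarrow> real) \<Rightarrow> 'a \<Rightarrow> real) \<Rightarrow> bool" where
  "Lp_compact_operator M p T \<longleftrightarrow>
     Lp_operator M p T \<and>
     (\<forall>f :: nat \<Rightarrow> 'a \<Rightarrow> real.
        (\<forall>n. f n \<in> Lp_space M p) \<and> (\<exists>C::real. \<forall>n. Lp_norm M p (f n) \<le> ennreal C) \<longrightarrow>
        (\<exists>g\<in>Lp_space M p. \<exists>r :: nat \<Rightarrow> nat. strict_mono r \<and>
           (\<lambda>n. Lp_norm M p (\<lambda>x. T (f (r n)) x - g x)) \<longlonglongrightarrow> 0))"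

(* The dimension of the range of T as a subspace of L^p (functions modulo equality almost
   everywhere): the least number of elements of L^p whose linear span contains the range;
   it is \<infinity> if there is no finite such number. *)
definition Lp_rank :: "'a measure \<Rightarrow> real \<Rightarrow> (('a \<Rightarrow> real) \<Rightarrow> 'a \<Rightarrow> real) \<Rightarrow> enat" where
  "Lp_rank M p T =
     Inf {enat m | m. \<exists>g :: nat \<Rightarrow> 'a \<Rightarrow> real. (\<forall>i<m. g i \<in> Lp_space M p) \<and>
            (\<forall>f\<in>Lp_space M p. \<exists>c :: nat \<Rightarrow> real. AE x in M. T f x = (\<Sum>i<m. c i * g i x))}"

definition approx_number ::
    "'a measure \<Rightarrow> real \<Rightarrow> (('a \<Rightarrow> real) \<Rightarrow> 'a \<Rightarrow> real) \<Rightarrow> nat \<Rightarrow> ennreal" where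
  "approx_number M p T n =
     (INF K \<in> {K. Lp_operator M p K \<and> Lp_rank M p K < enat n}.
        Lp_opnorm M p (\<lambda>f x. T f x - K f x))"

(* The sum runs over n = 1, 2, ... *)
definition Schatten_norm ::
    "'a measure \<Rightarrow> real \<Rightarrow> real \<Rightarrow> (('a \<Rightarrow> real) \<Rightarrow> 'a \<Rightarrow> real) \<Rightarrow> ennreal" where
  "Schatten_norm M p \<alpha> T =
     epowr (\<Sum>n. epowr (approx_number M p T (Suc n)) \<alpha>) (1 / \<alpha>)"


definition Hardy_Steklov ::
    "(real \<Rightarrow> real) \<Rightarrow> (real \<Rightarrow> real) \<Rightarrow> (real \<Rightarrow> real) \<Rightarrow> (real \<Rightarrow> real) \<Rightarrow>
     (real \<Rightarrow> real) \<Rightarrow> real \<Rightarrow> real" where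
  "Hardy_Steklov a b v w f x = w x * (LINT y:{a x..b x}|lebesgue. f y * v y)"

(* The value a(0) = 0 is understood as a limit as well (just as a(\<infinity>) = \<infinity> is); this is
   what makes a and b bijections of (0,\<infinity>). *)
definition boundary_functions :: "(real \<Rightarrow> real) \<Rightarrow> (real \<Rightarrow> real) \<Rightarrow> bool" where
  "boundary_functions a b \<longleftrightarrow>
     a differentiable_on {0<..} \<and> b differentiable_on {0<..} \<and>
     strict_mono_on {0<..} a \<and> strict_mono_on {0<..} b \<and>
     a 0 = 0 \<and> (a \<longlongrightarrow> 0) (at_right 0) \<and> b 0 = 0 \<and> (b \<longlongrightarrow> 0) (at_right 0) \<and>
     (\<forall>x>0. a x < b x) \<and>
     filterlim a at_top at_top \<and> filterlim b at_top at_top"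

definition pos_inv :: "(real \<Rightarrow> real) \<Rightarrow> real \<Rightarrow> real" where
  "pos_inv f = inv_into {0<..} f"

definition weight_integral :: "(real \<Rightarrow> real) \<Rightarrow> real \<Rightarrow> real \<Rightarrow> real \<Rightarrow> ennreal" where
  "weight_integral u q c d = (\<integral>\<^sup>+ y\<in>{c..d}. ennreal (u y powr q) \<partial>lebesgue)"

definition fairway ::
    "real \<Rightarrow> (real \<Rightarrow> real) \<Rightarrow> (real \<Rightarrow> real) \<Rightarrow> (real \<Rightarrow> real) \<Rightarrow> (real \<Rightarrow> real) \<Rightarrow> bool" where
  "fairway p a b v \<sigma> \<longleftrightarrow>
     (\<forall>t>0. a t < \<sigma> t \<and> \<sigma> t < b t \<and>
        weight_integral v (conj_exp p) (a t) (\<sigma> t) = weight_integral v (conj_exp p) (\<sigma> t) (b t)) \<and>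
     strict_mono_on {0<..} \<sigma> \<and> bij_betw \<sigma> {0<..} {0<..}"

definition V_functional ::
    "real \<Rightarrow> real \<Rightarrow> (real \<Rightarrow> real) \<Rightarrow> (real \<Rightarrow> real) \<Rightarrow> (real \<Rightarrow> real) \<Rightarrow> (real \<Rightarrow> real) \<Rightarrow>
     (real \<Rightarrow> real) \<Rightarrow> ennreal" where
  "V_functional p \<alpha> a b \<sigma> v w =
     epowr
       (\<integral>\<^sup>+ t\<in>{0<..}.
          epowr (weight_integral w p (pos_inv b t) (pos_inv a t)) (\<alpha> / p) *
          epowr (weight_integral v (conj_exp p) (a (pos_inv \<sigma> t)) (b (pos_inv \<sigma> t)))
            (\<alpha> / conj_exp p - 1) *
          ennreal (v t powr conj_exp p) \<partial>lebesgue)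
       (1 / \<alpha>)"

definition W_functional ::
    "real \<Rightarrow> real \<Rightarrow> (real \<Rightarrow> real) \<Rightarrow> (real \<Rightarrow> real) \<Rightarrow> (real \<Rightarrow> real) \<Rightarrow> (real \<Rightarrow> real) \<Rightarrow>
     (real \<Rightarrow> real) \<Rightarrow> ennreal" where
  "W_functional p \<alpha> a b \<sigma> v w =
     epowr
       (\<integral>\<^sup>+ t\<in>{0<..}.
          epowr (weight_integral w p (pos_inv b (\<sigma> t)) (pos_inv a (\<sigma> t))) (\<alpha> / p - 1) *
          epowr (weight_integral v (conj_exp p) (a t) (b t)) (\<alpha> / conj_exp p) *
          ennreal (w t powr p) \<partial>lebesgue)
       (1 / \<alpha>)"

end

theory Submission
  imports Defs
begin

text \<open>Write \<open>q\<close> for the conjugate exponent of \<open>p\<close>, and let \<open>\<mu>\<close> and \<open>\<nu>\<close> be the measures with densities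
  \<open>v powr q\<close> and \<open>w powr p\<close>. The kernel of the operator is \<open>w x * v y\<close> on the region \<open>a x < y < b x\<close>. A
  rectangle \<open>I \<times> J\<close> inside the region is a rank-one operator of norm \<open>\<nu>(I) powr (1/p) * \<mu>(J) powr (1/q)\<close>. The
  proof cuts the region into countably many rectangles and bounds the approximation numbers by the
  norms of the corresponding blocks.

  The passage from blocks to approximation numbers is a Schur test. If block \<open>k\<close> has a weight \<open>r k\<close> such
  that the weights of the blocks meeting any given row or column add up to at most \<open>R\<close>, then
  omitting all blocks of norm at most \<open>\<epsilon> * r k\<close> is an error of norm at most \<open>R * \<epsilon>\<close>. Hence
  the approximation numbers are dominated by the decreasing rearrangement of the relative norms \<open>t k\<close>,
  the norms divided by \<open>r k\<close>, and the sum of their powers \<open>\<alpha>\<close> by the sum of all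
  \<open>t k powr \<alpha>\<close> (\<open>rank_one_blocks.sum_approx_numbers_le\<close>).

  A triangle \<open>d x < c y\<close>, where \<open>c\<close> measures \<open>\<mu>\<close>-mass, is split into dyadic squares. At depth \<open>j\<close> the sum of the
  powers of the norms decays geometrically in \<open>j\<close> because \<open>1 < \<alpha>\<close>. Part of this decay pays for
  weights \<open>r\<close> that are geometric in \<open>j\<close>. These tolerate many overlapping triangles, as long as
  a point occurs only deep inside most of them (\<open>triangle_family.sum_approx_numbers_triangles\<close>).

  The triangles come from walking along the curve \<open>(x, \<sigma> x)\<close>: each step from \<open>\<eta> k\<close> ends where
  the curve leaves the vertical section of the region at \<open>\<eta> k\<close> or the horizontal section at height \<open>\<sigma> (\<eta> k)\<close>. As
  the curve halves the \<open>\<mu>\<close>-mass of each vertical section, this mass is comparable to the mass \<open>u k\<close> of the step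
  throughout the cell from \<open>\<eta> k\<close> to \<open>\<eta> (k + 1)\<close> (\<open>cell_mass\<close>), and masses double along any chain of steps seen by a
  single section (\<open>lower_decay\<close>, \<open>upper_decay\<close>). The doubling is the overlap condition for the two triangles over
  each cell, below and above the height \<open>\<sigma> (\<eta> (k + 1))\<close>. The comparability bounds the resulting
  sum of \<open>\<nu>(cell) powr (\<alpha>/p) * u k powr (\<alpha>/q)\<close> by each of the two integral functionals
  (\<open>discrete_le_V\<close>, \<open>discrete_le_W\<close>).\<close>

section \<open>Powers on the extended half-line\<close>

lemma epowr_0: "0 < a \<Longrightarrow> epowr 0 a = 0"
  by (simp add: epowr_def)

lemma epowr_top: "0 < a \<Longrightarrow> epowr top a = top"
  by (simp add: epowr_def)

lemma epowr_ennreal: "0 \<le> x \<Longrightarrow> 0 < a \<Longrightarrow> epowr (ennreal x) a = ennreal (x powr a)"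
  by (auto simp: epowr_def)

lemma epowr_ennreal_pos: "0 < x \<Longrightarrow> epowr (ennreal x) a = ennreal (x powr a)"
  by (auto simp: epowr_def)

lemma epowr_one [simp]: "epowr 1 a = 1"
  by (simp add: epowr_def)

lemma epowr_mono:
  assumes "x \<le> y" "0 \<le> a"
  shows "epowr x a \<le> epowr y a"
proof (cases "a = 0 \<or> y = top")
  case True
  then show ?thesis using assms by (auto simp: epowr_def)
next
  case False
  then obtain s where s: "y = ennreal s" "0 \<le> s"
    by (cases y) auto
  then obtain r where r: "x = ennreal r" "0 \<le> r"
    using assms(1) by (cases x) (auto simp: top_unique)
  have "r \<le> s" using s r assms by simp
  then show ?thesis
    using False assms s r by (simp add: epowr_ennreal powr_mono2)
qed

lemma epowr_mult:
  assumes "0 < a"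
  shows "epowr (x * y) a = epowr x a * epowr y a"
proof (cases "x = 0 \<or> y = 0")
  case True
  then show ?thesis using assms by (auto simp: epowr_0)
next
  case False
  show ?thesis
  proof (cases x; cases y)
    fix r s assume "x = ennreal r" "0 \<le> r" "y = ennreal s" "0 \<le> s"
    then show ?thesis
      using assms by (simp add: epowr_ennreal powr_mult flip: ennreal_mult)
  qed (use False assms in \<open>auto simp: epowr_def ennreal_mult_eq_top_iff ennreal_mult_top ennreal_top_mult\<close>)
qed

lemma epowr_epowr:
  assumes "0 < a" "0 < b"
  shows "epowr (epowr x a) b = epowr x (a * b)"
proof (cases x)
  case (real r)
  then show ?thesis using assms by (simp add: epowr_ennreal powr_powr)
qed (use assms in \<open>simp add: epowr_top\<close>)

lemma epowr_1: "epowr x 1 = x"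
  by (cases x) (auto simp: epowr_top epowr_ennreal)

lemma epowr_inverse: "0 < a \<Longrightarrow> epowr (epowr x a) (1 / a) = x"
  by (simp add: epowr_epowr epowr_1)

lemma epowr_eq_0_iff: "0 < a \<Longrightarrow> epowr x a = 0 \<longleftrightarrow> x = 0"
  by (metis epowr_0 epowr_inverse divide_pos_pos zero_less_one)

lemma epowr_eq_top_iff: "0 < a \<Longrightarrow> epowr x a = top \<longleftrightarrow> x = top"
  by (metis epowr_top epowr_inverse divide_pos_pos zero_less_one)

lemma epowr_less_top_iff: "0 < a \<Longrightarrow> epowr x a < top \<longleftrightarrow> x < top"
  unfolding less_top[symmetric] by (simp add: epowr_eq_top_iff)

lemma borel_measurable_epowr [measurable]:
  assumes [measurable]: "f \<in> borel_measurable M"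
  shows "(\<lambda>x. epowr (f x) a) \<in> borel_measurable M"
  unfolding epowr_def by measurable

section \<open>Hoelder's inequality\<close>

lemma conj_exp_gt_0: "1 < p \<Longrightarrow> 0 < conj_exp p"
  by (simp add: conj_exp_def)

lemma conj_exp_gt_1: "1 < p \<Longrightarrow> 1 < conj_exp p"
  by (simp add: conj_exp_def field_simps)

lemma inverse_conj_exp: "1 < p \<Longrightarrow> 1 / conj_exp p = 1 - 1 / p"
  by (simp add: conj_exp_def field_simps)

lemma p_div_conj_exp: "1 < p \<Longrightarrow> p / conj_exp p = p - 1"
  by (simp add: conj_exp_def)

lemma Young_ennreal:
  assumes "1 < p"
  shows "x * y \<le> ennreal (1 / p) * epowr x p + ennreal (1 / conj_exp p) * epowr y (conj_exp p)"
proof (cases "x = top \<or> y = top")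
  case True
  then show ?thesis
    using assms conj_exp_gt_0[of p] by (auto simp: epowr_top ennreal_mult_top)
next
  case False
  then obtain r s where rs: "x = ennreal r" "0 \<le> r" "y = ennreal s" "0 \<le> s"
    by (cases x; cases y) auto
  have "r * s \<le> r powr p / p + s powr conj_exp p / conj_exp p"
    using rs assms conj_exp_gt_1[of p] inverse_conj_exp[of p] by (intro Youngs_inequality) auto
  then show ?thesis
    using rs assms conj_exp_gt_0[of p]
    by (simp add: epowr_ennreal flip: ennreal_mult ennreal_plus)
qed

lemma Hoelder_nn_integral:
  assumes p: "1 < p" and [measurable]: "f \<in> borel_measurable M" "g \<in> borel_measurable M"
  shows "(\<integral>\<^sup>+x. f x * g x \<partial>M)
    \<le> epowr (\<integral>\<^sup>+x. epowr (f x) p \<partial>M) (1 / p) *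
       epowr (\<integral>\<^sup>+x. epowr (g x) (conj_exp p) \<partial>M) (1 / conj_exp p)"
proof -
  define q where "q = conj_exp p"
  define A where "A = (\<integral>\<^sup>+x. epowr (f x) p \<partial>M)"
  define B where "B = (\<integral>\<^sup>+x. epowr (g x) q \<partial>M)"
  have q: "1 < q" using p by (simp add: q_def conj_exp_gt_1)
  have pq: "1 / p + 1 / q = 1" using p by (simp add: q_def inverse_conj_exp)
  consider "A = 0" | "B = 0" | "A \<noteq> 0" "B \<noteq> 0" "A = top \<or> B = top"
    | "A \<noteq> 0" "B \<noteq> 0" "A \<noteq> top" "B \<noteq> top" by auto
  then have "(\<integral>\<^sup>+x. f x * g x \<partial>M) \<le> epowr A (1 / p) * epowr B (1 / q)"
  proof cases
    case 1
    then have "AE x in M. f x = 0"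
      using p by (simp add: A_def nn_integral_0_iff_AE epowr_eq_0_iff)
    then have "(\<integral>\<^sup>+x. f x * g x \<partial>M) = (\<integral>\<^sup>+x. 0 \<partial>M)"
      by (intro nn_integral_cong_AE) auto
    then show ?thesis by simp
  next
    case 2
    then have "AE x in M. g x = 0"
      using q by (simp add: B_def nn_integral_0_iff_AE epowr_eq_0_iff)
    then have "(\<integral>\<^sup>+x. f x * g x \<partial>M) = (\<integral>\<^sup>+x. 0 \<partial>M)"
      by (intro nn_integral_cong_AE) auto
    then show ?thesis by simp
  next
    case 3
    then have "epowr A (1 / p) * epowr B (1 / q) = top"
      using p q by (auto simp: epowr_top ennreal_mult_eq_top_iff epowr_eq_0_iff)
    then show ?thesis by simp
  next
    case 4
    obtain \<alpha> where \<alpha>: "A = ennreal \<alpha>" "0 < \<alpha>"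
      using 4 by (cases A) auto
    obtain \<beta> where \<beta>: "B = ennreal \<beta>" "0 < \<beta>"
      using 4 by (cases B) auto
    \<comment> \<open>Both factors are normalised to have integral one before Young's inequality is applied.\<close>
    define c d where "c = \<alpha> powr (1 / p)" and "d = \<beta> powr (1 / q)"
    have cd: "0 < c" "0 < d" using \<alpha> \<beta> by (auto simp: c_def d_def)
    have cp: "(1 / c) powr p = 1 / \<alpha>" "(1 / d) powr q = 1 / \<beta>"
      using p q \<alpha> \<beta> by (simp_all add: c_def d_def powr_divide powr_powr)
    have pt: "f x * g x \<le> ennreal (c * d) *
       (ennreal (1 / p) * (ennreal (1 / \<alpha>) * epowr (f x) p) +
        ennreal (1 / q) * (ennreal (1 / \<beta>) * epowr (g x) q))" for x
    proof -
      have "f x * g x = ennreal (c * d) * ((ennreal (1 / c) * f x) * (ennreal (1 / d) * g x))"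
      proof -
        have "ennreal (c * d) * (ennreal (1 / c) * ennreal (1 / d)) = 1"
          using cd by (simp flip: ennreal_mult)
        then show ?thesis
          by (metis (no_types, opaque_lifting) mult.assoc mult.commute mult.left_neutral)
      qed
      also have "\<dots> \<le> ennreal (c * d) * (ennreal (1 / p) * epowr (ennreal (1 / c) * f x) p +
          ennreal (1 / q) * epowr (ennreal (1 / d) * g x) q)"
        unfolding q_def by (intro mult_left_mono Young_ennreal p) auto
      finally show ?thesis
        using p q cd by (simp add: epowr_mult epowr_ennreal cp)
    qed
    have "(\<integral>\<^sup>+x. f x * g x \<partial>M) \<le> (\<integral>\<^sup>+x. ennreal (c * d) *
       (ennreal (1 / p) * (ennreal (1 / \<alpha>) * epowr (f x) p) +
        ennreal (1 / q) * (ennreal (1 / \<beta>) * epowr (g x) q)) \<partial>M)"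
      by (intro nn_integral_mono pt)
    also have "\<dots> = ennreal (c * d) * (ennreal (1 / p) * (ennreal (1 / \<alpha>) * A) +
        ennreal (1 / q) * (ennreal (1 / \<beta>) * B))"
      by (simp add: nn_integral_cmult nn_integral_add A_def B_def)
    also have "\<dots> = ennreal (c * d)"
      using \<alpha> \<beta> p q pq by (simp flip: ennreal_mult ennreal_plus)
    also have "\<dots> = epowr A (1 / p) * epowr B (1 / q)"
      using \<alpha> \<beta> p q by (simp add: epowr_ennreal c_def d_def ennreal_mult)
    finally show ?thesis .
  qed
  then show ?thesis by (simp add: A_def B_def q_def)
qed

text \<open>Raised to the power \<open>p\<close>, the inequality of Hoelder yields both estimates needed for Schur's test:
  for Lebesgue integrals over a block, and for the sum over all blocks.\<close>

lemma Hoelder_power: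
  assumes p: "1 < p" and [measurable]: "f \<in> borel_measurable M" "g \<in> borel_measurable M"
  shows "epowr (\<integral>\<^sup>+x. f x * g x \<partial>M) p
    \<le> (\<integral>\<^sup>+x. epowr (f x) p \<partial>M) * epowr (\<integral>\<^sup>+x. epowr (g x) (conj_exp p) \<partial>M) (p - 1)"
proof -
  have "epowr (\<integral>\<^sup>+x. f x * g x \<partial>M) p
      \<le> epowr (epowr (\<integral>\<^sup>+x. epowr (f x) p \<partial>M) (1 / p) *
       epowr (\<integral>\<^sup>+x. epowr (g x) (conj_exp p) \<partial>M) (1 / conj_exp p)) p"
    using p by (intro epowr_mono Hoelder_nn_integral) auto
  then show ?thesis
    using p conj_exp_gt_0[OF p] p_div_conj_exp[OF p]
    by (simp add: epowr_mult epowr_epowr epowr_1)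
qed

section \<open>The spaces \<open>L\<^sup>p\<close>\<close>

lemma Lp_space_iff:
  assumes "0 < p"
  shows "f \<in> Lp_space M p \<longleftrightarrow> f \<in> borel_measurable M \<and> (\<integral>\<^sup>+x. ennreal (\<bar>f x\<bar> powr p) \<partial>M) < top"
  using assms by (simp add: Lp_space_def Lp_norm_def epowr_less_top_iff)

lemma Lp_space_cmult:
  assumes "0 < p" "f \<in> Lp_space M p"
  shows "(\<lambda>x. c * f x) \<in> Lp_space M p"
proof -
  have [measurable]: "f \<in> borel_measurable M" using assms by (simp add: Lp_space_iff)
  have "(\<integral>\<^sup>+x. ennreal (\<bar>c * f x\<bar> powr p) \<partial>M) =
      (\<integral>\<^sup>+x. ennreal (\<bar>c\<bar> powr p) * ennreal (\<bar>f x\<bar> powr p) \<partial>M)"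
    by (simp add: abs_mult powr_mult ennreal_mult)
  also have "\<dots> = ennreal (\<bar>c\<bar> powr p) * (\<integral>\<^sup>+x. ennreal (\<bar>f x\<bar> powr p) \<partial>M)"
    by (intro nn_integral_cmult) measurable
  also have "\<dots> < top"
    using assms by (simp add: Lp_space_iff ennreal_mult_less_top)
  finally show ?thesis using assms by (simp add: Lp_space_iff)
qed

lemma Lp_space_add:
  assumes "0 < p" "f \<in> Lp_space M p" "g \<in> Lp_space M p"
  shows "(\<lambda>x. f x + g x) \<in> Lp_space M p"
proof -
  have [measurable]: "f \<in> borel_measurable M" "g \<in> borel_measurable M"
    using assms by (simp_all add: Lp_space_iff)
  have pt: "\<bar>s + t\<bar> powr p \<le> 2 powr p * (\<bar>s\<bar> powr p + \<bar>t\<bar> powr p)" for s t :: real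
  proof -
    have "\<bar>s + t\<bar> powr p \<le> (2 * max \<bar>s\<bar> \<bar>t\<bar>) powr p"
      using assms by (intro powr_mono2) auto
    also have "\<dots> = 2 powr p * max \<bar>s\<bar> \<bar>t\<bar> powr p" by (simp add: powr_mult)
    also have "\<dots> \<le> 2 powr p * (\<bar>s\<bar> powr p + \<bar>t\<bar> powr p)"
      by (intro mult_left_mono) (auto simp: max_def)
    finally show ?thesis .
  qed
  have "(\<integral>\<^sup>+x. ennreal (\<bar>f x + g x\<bar> powr p) \<partial>M) \<le>
      (\<integral>\<^sup>+x. ennreal (2 powr p) * (ennreal (\<bar>f x\<bar> powr p) + ennreal (\<bar>g x\<bar> powr p)) \<partial>M)"
    by (intro nn_integral_mono) (simp add: pt flip: ennreal_plus ennreal_mult)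
  also have "\<dots> = ennreal (2 powr p) * ((\<integral>\<^sup>+x. ennreal (\<bar>f x\<bar> powr p) \<partial>M) +
      (\<integral>\<^sup>+x. ennreal (\<bar>g x\<bar> powr p) \<partial>M))"
    by (simp add: nn_integral_cmult nn_integral_add)
  also have "\<dots> < top"
    using assms by (simp add: Lp_space_iff ennreal_mult_less_top)
  finally show ?thesis using assms by (simp add: Lp_space_iff)
qed

lemma Lp_space_sum:
  assumes "0 < p" "\<And>i. i \<in> F \<Longrightarrow> f i \<in> Lp_space M p"
  shows "(\<lambda>x. \<Sum>i\<in>F. f i x) \<in> Lp_space M p"
  using assms(2)
proof (induction F rule: infinite_finite_induct)
  case (insert i F)
  then show ?case using Lp_space_add[of p "f i" M] assms(1) by simp
qed (use assms(1) in \<open>auto simp: Lp_space_iff\<close>)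

lemma integrable_mult_Lp:
  fixes f g :: "'a \<Rightarrow> real"
  assumes p: "1 < p" and f: "f \<in> Lp_space M p" and [measurable]: "g \<in> borel_measurable M"
    and g: "(\<integral>\<^sup>+x. ennreal (\<bar>g x\<bar> powr conj_exp p) \<partial>M) < top"
  shows "integrable M (\<lambda>x. f x * g x)"
proof (rule integrableI_bounded)
  have [measurable]: "f \<in> borel_measurable M" using f p by (simp add: Lp_space_iff)
  show "(\<lambda>x. f x * g x) \<in> borel_measurable M" by measurable
  have "(\<integral>\<^sup>+x. ennreal (norm (f x * g x)) \<partial>M) = (\<integral>\<^sup>+x. ennreal \<bar>f x\<bar> * ennreal \<bar>g x\<bar> \<partial>M)"
    by (simp add: abs_mult ennreal_mult)
  also have "\<dots> \<le> epowr (\<integral>\<^sup>+x. epowr (ennreal \<bar>f x\<bar>) p \<partial>M) (1 / p) *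
       epowr (\<integral>\<^sup>+x. epowr (ennreal \<bar>g x\<bar>) (conj_exp p) \<partial>M) (1 / conj_exp p)"
    by (rule Hoelder_nn_integral[OF p]) measurable
  also have "\<dots> < top"
    using p f g conj_exp_gt_0[OF p]
    by (simp add: epowr_ennreal ennreal_mult_less_top epowr_less_top_iff Lp_space_iff)
  finally show "(\<integral>\<^sup>+x. ennreal (norm (f x * g x)) \<partial>M) < \<infinity>" by simp
qed

section \<open>Approximation numbers of an operator cut into rank-one blocks\<close>

text \<open>The blocks \<open>I k \<times> J k\<close> carry the rank-one operators
  \<open>f \<mapsto> 1\<^bsub>I k\<^esub> w \<integral>\<^bsub>J k\<^esub> f v\<close>, whose norm is at most \<open>r k * t k\<close>. The blocks may share rows and
  columns; the auxiliary weights \<open>r k\<close> measure how much overlap is tolerated, and \<open>t k\<close> is the norm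
  of a block relative to its weight.\<close>

locale rank_one_blocks =
  fixes M :: "'a measure" and p R :: real and w v :: "'a \<Rightarrow> real"
    and I J :: "'k::countable \<Rightarrow> 'a set" and r t :: "'k \<Rightarrow> real"
  assumes p: "1 < p"
    and w [measurable]: "w \<in> borel_measurable M"
    and v [measurable]: "v \<in> borel_measurable M"
    and I [measurable]: "\<And>k. I k \<in> sets M"
    and J [measurable]: "\<And>k. J k \<in> sets M"
    and R: "0 < R"
    and r: "\<And>k. 0 < r k" and t: "\<And>k. 0 \<le> t k"
    and overlap_I: "\<And>x. (\<integral>\<^sup>+k. ennreal (r k) * indicator (I k) x \<partial>count_space UNIV) \<le> ennreal R"
    and overlap_J: "\<And>y. (\<integral>\<^sup>+k. ennreal (r k) * indicator (J k) y \<partial>count_space UNIV) \<le> ennreal R"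
    and w_finite: "\<And>k. (\<integral>\<^sup>+x. indicator (I k) x * ennreal (\<bar>w x\<bar> powr p) \<partial>M) < top"
    and v_finite: "\<And>k. (\<integral>\<^sup>+y. indicator (J k) y * ennreal (\<bar>v y\<bar> powr conj_exp p) \<partial>M) < top"
    and block_norm: "\<And>k. (\<integral>\<^sup>+x. indicator (I k) x * ennreal (\<bar>w x\<bar> powr p) \<partial>M) *
        epowr (\<integral>\<^sup>+y. indicator (J k) y * ennreal (\<bar>v y\<bar> powr conj_exp p) \<partial>M) (p - 1)
        \<le> ennreal ((r k * t k) powr p)"
begin

definition partial_sum :: "'k set \<Rightarrow> ('a \<Rightarrow> real) \<Rightarrow> 'a \<Rightarrow> real" where
  "partial_sum F f x = (\<Sum>k\<in>F. (\<integral>y. f y * (indicator (J k) y * v y) \<partial>M) * (indicator (I k) x * w x))"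

lemma R_nonneg: "0 \<le> R"
  using R by simp

text \<open>Schur's test. Hoelder's inequality over the blocks, with the weights \<open>r k\<close> split between the two
  factors, uses the overlap bound in the variable \<open>x\<close>; Hoelder's inequality in each block and a
  change of summation and integration then use it in the variable \<open>y\<close>. Discarding the
  blocks outside \<open>F\<close> therefore costs only \<open>R\<close> times the largest relative norm among them.\<close>

lemma tail_bound:
  assumes [measurable]: "f \<in> borel_measurable M" and "0 \<le> \<epsilon>" and small: "\<And>k. k \<notin> F \<Longrightarrow> t k \<le> \<epsilon>"
  shows "(\<integral>\<^sup>+x. epowr (\<integral>\<^sup>+k. indicator (- F) k * (indicator (I k) x * ennreal \<bar>w x\<bar> *
        (\<integral>\<^sup>+y. indicator (J k) y * ennreal \<bar>f y * v y\<bar> \<partial>M)) \<partial>count_space UNIV) p \<partial>M)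
      \<le> ennreal ((R * \<epsilon>) powr p) * (\<integral>\<^sup>+y. ennreal (\<bar>f y\<bar> powr p) \<partial>M)"
proof -
  define q where "q = conj_exp p"
  have q: "1 < q" "p / q = p - 1" using p by (simp_all add: q_def conj_exp_gt_1 p_div_conj_exp)
  define A where "A k = (\<integral>\<^sup>+y. indicator (J k) y * ennreal \<bar>f y * v y\<bar> \<partial>M)" for k
  define N where "N k = (\<integral>\<^sup>+x. indicator (I k) x * ennreal (\<bar>w x\<bar> powr p) \<partial>M)" for k
  define B where "B k = (\<integral>\<^sup>+y. indicator (J k) y * ennreal (\<bar>f y\<bar> powr p) \<partial>M)" for k
  have rp: "ennreal (r k powr - (1 / q)) * ennreal (r k powr (1 / q)) = 1" for k
    using r[of k] by (simp flip: ennreal_mult powr_add)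
  have pointwise: "epowr (\<integral>\<^sup>+k. indicator (- F) k * (indicator (I k) x * ennreal \<bar>w x\<bar> * A k) \<partial>count_space UNIV) p
      \<le> (\<integral>\<^sup>+k. ennreal (R powr (p - 1)) * (indicator (- F) k * ennreal (r k powr (1 - p)) * epowr (A k) p *
          (indicator (I k) x * ennreal (\<bar>w x\<bar> powr p))) \<partial>count_space UNIV)" for x
  proof -
    let ?g = "\<lambda>k. indicator (- F) k * indicator (I k) x * ennreal (r k powr - (1 / q)) * ennreal \<bar>w x\<bar> * A k"
    let ?h = "\<lambda>k. indicator (I k) x * ennreal (r k powr (1 / q))"
    have gh: "indicator (- F) k * (indicator (I k) x * ennreal \<bar>w x\<bar> * A k) = ?g k * ?h k" for k
      using rp[of k] by (auto split: split_indicator) (metis (no_types, opaque_lifting) mult.assoc mult.commute mult.left_neutral)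
    have g: "epowr (?g k) p = indicator (- F) k * ennreal (r k powr (1 - p)) * epowr (A k) p *
          (indicator (I k) x * ennreal (\<bar>w x\<bar> powr p))" for k
      using p q by (auto split: split_indicator simp: epowr_0 epowr_mult epowr_ennreal powr_powr ac_simps)
    have h: "epowr (?h k) q = ennreal (r k) * indicator (I k) x" for k
      using q r[of k] by (auto split: split_indicator simp: epowr_0 epowr_ennreal powr_powr)
    have "epowr (\<integral>\<^sup>+k. ?g k * ?h k \<partial>count_space UNIV) p
       \<le> (\<integral>\<^sup>+k. epowr (?g k) p \<partial>count_space UNIV) *
         epowr (\<integral>\<^sup>+k. epowr (?h k) q \<partial>count_space UNIV) (p - 1)"
      unfolding q_def by (rule Hoelder_power[OF p]) auto
    also have "\<dots> \<le> (\<integral>\<^sup>+k. epowr (?g k) p \<partial>count_space UNIV) * ennreal (R powr (p - 1))"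
    proof (intro mult_left_mono)
      have "epowr (\<integral>\<^sup>+k. epowr (?h k) q \<partial>count_space UNIV) (p - 1) \<le> epowr (ennreal R) (p - 1)"
        unfolding h using p overlap_I by (intro epowr_mono) auto
      then show "epowr (\<integral>\<^sup>+k. epowr (?h k) q \<partial>count_space UNIV) (p - 1) \<le> ennreal (R powr (p - 1))"
        using p R_nonneg by (simp add: epowr_ennreal)
    qed simp
    finally show ?thesis
      unfolding gh g by (subst nn_integral_cmult) (auto simp: mult.commute)
  qed
  have Ap: "epowr (A k) p \<le> B k * epowr (\<integral>\<^sup>+y. indicator (J k) y * ennreal (\<bar>v y\<bar> powr q) \<partial>M) (p - 1)" for k
  proof -
    have "A k = (\<integral>\<^sup>+y. (indicator (J k) y * ennreal \<bar>f y\<bar>) * (indicator (J k) y * ennreal \<bar>v y\<bar>) \<partial>M)"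
      unfolding A_def by (intro nn_integral_cong) (auto split: split_indicator simp: abs_mult ennreal_mult)
    also have "epowr \<dots> p \<le> (\<integral>\<^sup>+y. epowr (indicator (J k) y * ennreal \<bar>f y\<bar>) p \<partial>M) *
        epowr (\<integral>\<^sup>+y. epowr (indicator (J k) y * ennreal \<bar>v y\<bar>) q \<partial>M) (p - 1)"
      unfolding q_def by (rule Hoelder_power[OF p]) measurable
    also have "(\<integral>\<^sup>+y. epowr (indicator (J k) y * ennreal \<bar>f y\<bar>) p \<partial>M) = B k"
      unfolding B_def using p
      by (intro nn_integral_cong) (auto split: split_indicator simp: epowr_0 epowr_ennreal)
    also have "(\<integral>\<^sup>+y. epowr (indicator (J k) y * ennreal \<bar>v y\<bar>) q \<partial>M) =
        (\<integral>\<^sup>+y. indicator (J k) y * ennreal (\<bar>v y\<bar> powr q) \<partial>M)"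
      using q by (intro nn_integral_cong) (auto split: split_indicator simp: epowr_0 epowr_ennreal)
    finally show ?thesis .
  qed
  have term_bound: "indicator (- F) k * ennreal (r k powr (1 - p)) * epowr (A k) p * N k
      \<le> ennreal (\<epsilon> powr p) * (ennreal (r k) * B k)" for k
  proof (cases "k \<in> F")
    case False
    have "N k * epowr (A k) p \<le> B k * (N k * epowr (\<integral>\<^sup>+y. indicator (J k) y * ennreal (\<bar>v y\<bar> powr q) \<partial>M) (p - 1))"
      using mult_left_mono[OF Ap[of k], of "N k"] by (simp add: ac_simps)
    also have "\<dots> \<le> B k * ennreal ((r k * t k) powr p)"
      unfolding N_def q_def by (intro mult_left_mono block_norm) auto
    also have "\<dots> \<le> B k * ennreal ((r k * \<epsilon>) powr p)"
      using p r[of k] t[of k] small[OF False] by (intro mult_left_mono ennreal_leI powr_mono2 mult_left_mono) auto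
    finally have "ennreal (r k powr (1 - p)) * (N k * epowr (A k) p)
        \<le> ennreal (r k powr (1 - p)) * (B k * ennreal ((r k * \<epsilon>) powr p))"
      by (intro mult_left_mono) auto
    also have "\<dots> = (ennreal (r k powr (1 - p)) * ennreal ((r k * \<epsilon>) powr p)) * B k"
      by (simp add: ac_simps)
    also have "ennreal (r k powr (1 - p)) * ennreal ((r k * \<epsilon>) powr p) = ennreal (\<epsilon> powr p) * ennreal (r k)"
    proof -
      have "r k powr (1 - p) * r k powr p = r k" using r[of k] by (simp flip: powr_add)
      then have "r k powr (1 - p) * (r k * \<epsilon>) powr p = \<epsilon> powr p * r k"
        using r[of k] \<open>0 \<le> \<epsilon>\<close> by (simp add: powr_mult)
      then show ?thesis using r[of k] by (simp flip: ennreal_mult)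
    qed
    finally show ?thesis using False by (simp add: ac_simps)
  qed simp
  have "(\<integral>\<^sup>+x. epowr (\<integral>\<^sup>+k. indicator (- F) k * (indicator (I k) x * ennreal \<bar>w x\<bar> * A k) \<partial>count_space UNIV) p \<partial>M)
      \<le> (\<integral>\<^sup>+x. \<integral>\<^sup>+k. ennreal (R powr (p - 1)) * (indicator (- F) k * ennreal (r k powr (1 - p)) * epowr (A k) p *
          (indicator (I k) x * ennreal (\<bar>w x\<bar> powr p))) \<partial>count_space UNIV \<partial>M)"
    by (intro nn_integral_mono pointwise)
  also have "\<dots> = (\<integral>\<^sup>+k. \<integral>\<^sup>+x. ennreal (R powr (p - 1)) * (indicator (- F) k * ennreal (r k powr (1 - p)) * epowr (A k) p *
          (indicator (I k) x * ennreal (\<bar>w x\<bar> powr p))) \<partial>M \<partial>count_space UNIV)"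
    by (intro nn_integral_count_space_nn_integral) auto
  also have "\<dots> = (\<integral>\<^sup>+k. ennreal (R powr (p - 1)) * (indicator (- F) k * ennreal (r k powr (1 - p)) * epowr (A k) p * N k)
      \<partial>count_space UNIV)"
    unfolding N_def by (simp add: nn_integral_cmult)
  also have "\<dots> \<le> (\<integral>\<^sup>+k. ennreal (R powr (p - 1)) * (ennreal (\<epsilon> powr p) * (ennreal (r k) * B k)) \<partial>count_space UNIV)"
    by (intro nn_integral_mono mult_left_mono term_bound) auto
  also have "\<dots> = ennreal (R powr (p - 1)) * (ennreal (\<epsilon> powr p) * (\<integral>\<^sup>+k. ennreal (r k) * B k \<partial>count_space UNIV))"
    by (simp add: nn_integral_cmult)
  finally have le: "(\<integral>\<^sup>+x. epowr (\<integral>\<^sup>+k. indicator (- F) k * (indicator (I k) x * ennreal \<bar>w x\<bar> * A k) \<partial>count_space UNIV) p \<partial>M)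
      \<le> ennreal (R powr (p - 1)) * (ennreal (\<epsilon> powr p) * (\<integral>\<^sup>+k. ennreal (r k) * B k \<partial>count_space UNIV))" .
  have "(\<integral>\<^sup>+k. ennreal (r k) * B k \<partial>count_space UNIV) =
      (\<integral>\<^sup>+k. \<integral>\<^sup>+y. ennreal (r k) * indicator (J k) y * ennreal (\<bar>f y\<bar> powr p) \<partial>M \<partial>count_space UNIV)"
    unfolding B_def by (simp add: nn_integral_cmult mult.assoc)
  also have "\<dots> = (\<integral>\<^sup>+y. \<integral>\<^sup>+k. ennreal (r k) * indicator (J k) y * ennreal (\<bar>f y\<bar> powr p) \<partial>count_space UNIV \<partial>M)"
    by (intro nn_integral_count_space_nn_integral[symmetric]) auto
  also have "\<dots> \<le> (\<integral>\<^sup>+y. ennreal R * ennreal (\<bar>f y\<bar> powr p) \<partial>M)"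
    by (intro nn_integral_mono) (simp add: nn_integral_multc mult_right_mono overlap_J)
  also have "\<dots> = ennreal R * (\<integral>\<^sup>+y. ennreal (\<bar>f y\<bar> powr p) \<partial>M)"
    by (simp add: nn_integral_cmult)
  finally have "(\<integral>\<^sup>+k. ennreal (r k) * B k \<partial>count_space UNIV) \<le> ennreal R * (\<integral>\<^sup>+y. ennreal (\<bar>f y\<bar> powr p) \<partial>M)" .
  then have "(\<integral>\<^sup>+x. epowr (\<integral>\<^sup>+k. indicator (- F) k * (indicator (I k) x * ennreal \<bar>w x\<bar> * A k) \<partial>count_space UNIV) p \<partial>M)
     \<le> ennreal (R powr (p - 1)) * (ennreal (\<epsilon> powr p) * (ennreal R * (\<integral>\<^sup>+y. ennreal (\<bar>f y\<bar> powr p) \<partial>M)))"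
    by (intro order_trans[OF le] mult_left_mono) auto
  also have "\<dots> = ennreal (R powr (p - 1) * \<epsilon> powr p * R) * (\<integral>\<^sup>+y. ennreal (\<bar>f y\<bar> powr p) \<partial>M)"
    using R_nonneg by (simp add: ennreal_mult ac_simps)
  also have "R powr (p - 1) * \<epsilon> powr p * R = (R * \<epsilon>) powr p"
  proof (cases "R = 0")
    case False
    then have "R powr (p - 1) * R = R powr p" using R_nonneg by (simp add: powr_diff)
    then show ?thesis using R_nonneg \<open>0 \<le> \<epsilon>\<close> by (simp add: powr_mult ac_simps)
  qed (use p in auto)
  finally show ?thesis by (simp add: A_def)
qed

lemma block_weights_Lp:
  "(\<lambda>x. indicator (I k) x * w x) \<in> Lp_space M p"
proof -
  have "(\<integral>\<^sup>+x. ennreal (\<bar>indicator (I k) x * w x\<bar> powr p) \<partial>M) =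
      (\<integral>\<^sup>+x. indicator (I k) x * ennreal (\<bar>w x\<bar> powr p) \<partial>M)"
    by (intro nn_integral_cong) (auto split: split_indicator)
  then show ?thesis using p w_finite by (simp add: Lp_space_iff)
qed

lemma integrable_block:
  assumes "f \<in> Lp_space M p"
  shows "integrable M (\<lambda>y. f y * (indicator (J k) y * v y))"
proof (rule integrable_mult_Lp[OF p assms])
  have "(\<integral>\<^sup>+x. ennreal (\<bar>indicator (J k) x * v x\<bar> powr conj_exp p) \<partial>M) =
      (\<integral>\<^sup>+x. indicator (J k) x * ennreal (\<bar>v x\<bar> powr conj_exp p) \<partial>M)"
    using conj_exp_gt_0[OF p] by (intro nn_integral_cong) (auto split: split_indicator)
  then show "(\<integral>\<^sup>+x. ennreal (\<bar>indicator (J k) x * v x\<bar> powr conj_exp p) \<partial>M) < top"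
    using v_finite by simp
qed measurable

lemma Lp_operator_partial_sum: "Lp_operator M p (partial_sum F)"
  unfolding Lp_operator_def
proof (intro conjI ballI allI impI)
  fix f assume "f \<in> Lp_space M p"
  show "partial_sum F f \<in> Lp_space M p"
    unfolding partial_sum_def using p by (intro Lp_space_sum Lp_space_cmult block_weights_Lp) auto
next
  fix f g assume fg: "f \<in> Lp_space M p" "g \<in> Lp_space M p" "AE x in M. f x = g x"
  have [measurable]: "f \<in> borel_measurable M" "g \<in> borel_measurable M"
    using fg p by (simp_all add: Lp_space_iff)
  have "(\<integral>y. f y * (indicator (J k) y * v y) \<partial>M) = (\<integral>y. g y * (indicator (J k) y * v y) \<partial>M)" for k
    using fg(3) by (intro integral_cong_AE) auto
  then show "AE x in M. partial_sum F f x = partial_sum F g x"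
    by (simp add: partial_sum_def)
next
  fix f g and c d :: real assume fg: "f \<in> Lp_space M p" "g \<in> Lp_space M p"
  have "(\<integral>y. (c * f y + d * g y) * (indicator (J k) y * v y) \<partial>M) =
      c * (\<integral>y. f y * (indicator (J k) y * v y) \<partial>M) + d * (\<integral>y. g y * (indicator (J k) y * v y) \<partial>M)" for k
    using integrable_block[OF fg(1), of k] integrable_block[OF fg(2), of k]
    by (simp add: distrib_right mult.assoc)
  then show "AE x in M. partial_sum F (\<lambda>y. c * f y + d * g y) x = c * partial_sum F f x + d * partial_sum F g x"
    by (simp add: partial_sum_def distrib_right sum.distrib sum_distrib_left mult.assoc)
qed

lemma Lp_rank_partial_sum:
  assumes "finite F"
  shows "Lp_rank M p (partial_sum F) \<le> enat (card F)"
proof -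
  obtain e where e: "bij_betw e {0..<card F} F"
    using ex_bij_betw_nat_finite[OF assms] by blast
  show ?thesis
    unfolding Lp_rank_def
  proof (intro Inf_lower CollectI exI conjI)
    show "enat (card F) = enat (card F)" ..
    show "\<forall>i<card F. (\<lambda>x. indicator (I (e i)) x * w x) \<in> Lp_space M p"
      by (simp add: block_weights_Lp)
    show "\<forall>f\<in>Lp_space M p. \<exists>c. AE x in M. partial_sum F f x =
        (\<Sum>i<card F. c i * (indicator (I (e i)) x * w x))"
    proof (intro ballI exI AE_I2)
      fix f x
      show "partial_sum F f x = (\<Sum>i<card F. (\<integral>y. f y * (indicator (J (e i)) y * v y) \<partial>M) *
          (indicator (I (e i)) x * w x))"
        unfolding partial_sum_def
        by (subst sum.reindex_bij_betw[OF e, symmetric]) (simp add: atLeast0LessThan)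
    qed
  qed
qed

end

lemma sum_le_nn_integral_count_space:
  fixes f :: "'k \<Rightarrow> ennreal"
  assumes "finite F"
  shows "(\<Sum>k\<in>F. f k) \<le> (\<integral>\<^sup>+k. f k \<partial>count_space UNIV)"
proof -
  have "(\<Sum>k\<in>F. f k) = (\<integral>\<^sup>+k. f k * indicator F k \<partial>count_space UNIV)"
    using assms by (simp add: nn_integral_count_space_finite flip: nn_integral_count_space_indicator)
  also have "\<dots> \<le> (\<integral>\<^sup>+k. f k \<partial>count_space UNIV)"
    by (intro nn_integral_mono) (auto split: split_indicator)
  finally show ?thesis .
qed

text \<open>The numbers \<open>a n\<close> are matched one after the other with different indices: if every index outside
  the set \<open>F\<close> of the first \<open>n\<close> matches had \<open>2 * R * t k < a n\<close>, then the hypothesis with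
  \<open>\<epsilon> = a n / (2 * R)\<close> would give \<open>a n \<le> a n / 2\<close>.\<close>

lemma sum_powr_le_by_greedy_matching:
  fixes a :: "nat \<Rightarrow> ennreal" and t :: "'k \<Rightarrow> real"
  assumes \<alpha>: "0 < \<alpha>" and R: "0 < R" and inf: "infinite (UNIV :: 'k set)" and t: "\<And>k. 0 \<le> t k"
    and a: "\<And>F \<epsilon>. finite F \<Longrightarrow> 0 \<le> \<epsilon> \<Longrightarrow> (\<And>k. k \<notin> F \<Longrightarrow> t k \<le> \<epsilon>) \<Longrightarrow> a (card F) \<le> ennreal (R * \<epsilon>)"
  shows "(\<Sum>n. epowr (a n) \<alpha>) \<le> ennreal ((2 * R) powr \<alpha>) * (\<integral>\<^sup>+k. ennreal (t k powr \<alpha>) \<partial>count_space UNIV)"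
proof (cases "(\<integral>\<^sup>+k. ennreal (t k powr \<alpha>) \<partial>count_space UNIV) = top")
  case True
  then show ?thesis using R by (simp add: ennreal_mult_top)
next
  case False
  then obtain S where S: "(\<integral>\<^sup>+k. ennreal (t k powr \<alpha>) \<partial>count_space UNIV) = ennreal S" "0 \<le> S"
    by (cases "(\<integral>\<^sup>+k. ennreal (t k powr \<alpha>) \<partial>count_space UNIV)") auto
  have bounded: "t k \<le> S powr (1 / \<alpha>)" for k
  proof -
    have "ennreal (t k powr \<alpha>) \<le> ennreal S"
      using sum_le_nn_integral_count_space[of "{k}" "\<lambda>k. ennreal (t k powr \<alpha>)"] S by simp
    then have "(t k powr \<alpha>) powr (1 / \<alpha>) \<le> S powr (1 / \<alpha>)"
      using S \<alpha> by (intro powr_mono2) auto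
    then show ?thesis using \<alpha> t[of k] by (simp add: powr_powr)
  qed
  have fresh: "\<exists>k. k \<notin> F \<and> a (card F) \<le> ennreal (2 * R * t k)" if F: "finite F" for F
  proof (rule ccontr)
    assume "\<not> ?thesis"
    then have less: "ennreal (2 * R * t k) < a (card F)" if "k \<notin> F" for k
      using that by (auto simp: not_le)
    have "a (card F) \<le> ennreal (R * S powr (1 / \<alpha>))"
      using bounded F by (intro a) auto
    then have "a (card F) \<noteq> top" by (auto simp: top_unique)
    then obtain b where b: "a (card F) = ennreal b" "0 \<le> b"
      by (cases "a (card F)") auto
    obtain k0 where k0: "k0 \<notin> F" using ex_new_if_finite[OF inf F] by blast
    have "0 < b"
      using less[OF k0] b R t[of k0] by (cases "b = 0") auto
    have "t k \<le> b / (2 * R)" if "k \<notin> F" for k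
      using less[OF that] b R t[of k] by (simp add: ennreal_less_iff field_simps)
    then have "a (card F) \<le> ennreal (R * (b / (2 * R)))"
      using b R F by (intro a) auto
    then show False using b R \<open>0 < b\<close> by simp
  qed
  have matched: "\<exists>F. finite F \<and> card F = N \<and>
      (\<Sum>n<N. epowr (a n) \<alpha>) \<le> (\<Sum>k\<in>F. ennreal ((2 * R) powr \<alpha>) * ennreal (t k powr \<alpha>))" for N
  proof (induction N)
    case 0
    show ?case by (intro exI[of _ "{}"]) simp
  next
    case (Suc N)
    then obtain F where F: "finite F" "card F = N"
      "(\<Sum>n<N. epowr (a n) \<alpha>) \<le> (\<Sum>k\<in>F. ennreal ((2 * R) powr \<alpha>) * ennreal (t k powr \<alpha>))" by blast
    obtain k where k: "k \<notin> F" "a (card F) \<le> ennreal (2 * R * t k)" using fresh[OF F(1)] by blast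
    have "epowr (a N) \<alpha> \<le> epowr (ennreal (2 * R * t k)) \<alpha>"
      using k F \<alpha> by (intro epowr_mono) auto
    also have "\<dots> = ennreal ((2 * R) powr \<alpha>) * ennreal (t k powr \<alpha>)"
      using R t[of k] \<alpha> by (simp add: epowr_ennreal powr_mult flip: ennreal_mult)
    finally show ?case
      using F k by (intro exI[of _ "insert k F"]) (auto intro: add_mono simp: add.commute)
  qed
  have "(\<Sum>n<N. epowr (a n) \<alpha>) \<le> ennreal ((2 * R) powr \<alpha>) * (\<integral>\<^sup>+k. ennreal (t k powr \<alpha>) \<partial>count_space UNIV)" for N
  proof -
    from matched[of N] obtain F where F: "finite F"
      "(\<Sum>n<N. epowr (a n) \<alpha>) \<le> (\<Sum>k\<in>F. ennreal ((2 * R) powr \<alpha>) * ennreal (t k powr \<alpha>))" by blast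
    note F(2)
    also have "(\<Sum>k\<in>F. ennreal ((2 * R) powr \<alpha>) * ennreal (t k powr \<alpha>)) =
        ennreal ((2 * R) powr \<alpha>) * (\<Sum>k\<in>F. ennreal (t k powr \<alpha>))"
      by (rule sum_distrib_left[symmetric])
    also have "\<dots> \<le> ennreal ((2 * R) powr \<alpha>) * (\<integral>\<^sup>+k. ennreal (t k powr \<alpha>) \<partial>count_space UNIV)"
      by (intro mult_left_mono sum_le_nn_integral_count_space F(1)) simp
    finally show ?thesis .
  qed
  then show ?thesis by (simp add: suminf_eq_SUP SUP_least)
qed

context rank_one_blocks
begin

text \<open>Off a null set, the kernel of \<open>T\<close> is the disjoint union of the blocks, so what remains after
  subtracting finitely many of them is dominated by the sum of the others, and the tail bound applies.\<close>

lemma opnorm_diff_partial_sum: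
  assumes F: "finite F" and \<epsilon>: "0 \<le> \<epsilon>" "\<And>k. k \<notin> F \<Longrightarrow> t k \<le> \<epsilon>"
    and \<Omega> [measurable]: "\<And>x. \<Omega> x \<in> sets M"
    and \<Omega>_finite: "AE x in M. (\<integral>\<^sup>+y. indicator (\<Omega> x) y * ennreal (\<bar>v y\<bar> powr conj_exp p) \<partial>M) < top"
    and disjoint: "\<And>k l x y. x \<in> I k \<Longrightarrow> y \<in> J k \<Longrightarrow> x \<in> I l \<Longrightarrow> y \<in> J l \<Longrightarrow> k = l"
    and cover: "AE x in M. AE y in M. v y \<noteq> 0 \<longrightarrow> y \<in> \<Omega> x \<longleftrightarrow> (\<exists>k. x \<in> I k \<and> y \<in> J k)"
    and T: "\<And>f. f \<in> Lp_space M p \<Longrightarrow> AE x in M. T f x = w x * (\<integral>y. f y * (indicator (\<Omega> x) y * v y) \<partial>M)"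
  shows "Lp_opnorm M p (\<lambda>f x. T f x - partial_sum F f x) \<le> ennreal (R * \<epsilon>)"
  unfolding Lp_opnorm_def
proof (rule SUP_least)
  fix f assume "f \<in> {f \<in> Lp_space M p. Lp_norm M p f \<le> 1}"
  then have f: "f \<in> Lp_space M p" and f1: "Lp_norm M p f \<le> 1" by auto
  have [measurable]: "f \<in> borel_measurable M" using f p by (simp add: Lp_space_iff)
  have pointwise: "AE x in M. ennreal \<bar>T f x - partial_sum F f x\<bar> \<le>
      (\<integral>\<^sup>+k. indicator (- F) k * (indicator (I k) x * ennreal \<bar>w x\<bar> *
        (\<integral>\<^sup>+y. indicator (J k) y * ennreal \<bar>f y * v y\<bar> \<partial>M)) \<partial>count_space UNIV)"
    using T[OF f] \<Omega>_finite cover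
  proof eventually_elim
    case (elim x)
    let ?u = "\<lambda>y. f y * (indicator (\<Omega> x) y * v y) - (\<Sum>k\<in>F. indicator (I k) x * (f y * (indicator (J k) y * v y)))"
    have int: "integrable M (\<lambda>y. f y * (indicator (\<Omega> x) y * v y))"
    proof (rule integrable_mult_Lp[OF p f])
      have "(\<integral>\<^sup>+y. ennreal (\<bar>indicator (\<Omega> x) y * v y\<bar> powr conj_exp p) \<partial>M) =
          (\<integral>\<^sup>+y. indicator (\<Omega> x) y * ennreal (\<bar>v y\<bar> powr conj_exp p) \<partial>M)"
        using conj_exp_gt_0[OF p] by (intro nn_integral_cong) (auto split: split_indicator)
      then show "(\<integral>\<^sup>+y. ennreal (\<bar>indicator (\<Omega> x) y * v y\<bar> powr conj_exp p) \<partial>M) < top"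
        using elim(2) by simp
    qed measurable
    have "(\<integral>y. ?u y \<partial>M) = (\<integral>y. f y * (indicator (\<Omega> x) y * v y) \<partial>M) -
       (\<Sum>k\<in>F. indicator (I k) x * (\<integral>y. f y * (indicator (J k) y * v y) \<partial>M))"
      using int integrable_block[OF f]
      by (subst Bochner_Integration.integral_diff) (auto intro!: Bochner_Integration.integrable_sum)
    then have eq: "T f x - partial_sum F f x = w x * (\<integral>y. ?u y \<partial>M)"
      unfolding elim(1) partial_sum_def by (simp add: right_diff_distrib sum_distrib_left ac_simps)
    have u: "AE y in M. ennreal \<bar>?u y\<bar> \<le>
        (\<integral>\<^sup>+k. indicator (- F) k * (indicator (I k) x * (indicator (J k) y * ennreal \<bar>f y * v y\<bar>)) \<partial>count_space UNIV)"
      using elim(3)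
    proof eventually_elim
      case (elim y)
      consider "v y = 0" | "v y \<noteq> 0" "\<And>k. \<not> (x \<in> I k \<and> y \<in> J k)" "y \<notin> \<Omega> x"
        | k where "v y \<noteq> 0" "x \<in> I k" "y \<in> J k" "y \<in> \<Omega> x" using elim by blast
      then show ?case
      proof cases
        case 1
        then show ?thesis by simp
      next
        case 2
        then have "?u y = 0" by (auto intro!: sum.neutral split: split_indicator)
        then show ?thesis by simp
      next
        case (3 k)
        have other: "indicator (I l) x * indicator (J l) y = (0::real)" if "l \<noteq> k" for l
          using disjoint[OF 3(2,3)] that by (auto split: split_indicator)
        have "(\<Sum>l\<in>F. indicator (I l) x * (f y * (indicator (J l) y * v y))) =
            (\<Sum>l\<in>F. if l = k then f y * v y else 0)"
        proof (intro sum.cong refl)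
          fix l
          have "indicator (I l) x * (f y * (indicator (J l) y * v y)) =
             (indicator (I l) x * indicator (J l) y) * (f y * v y)" by simp
          then show "indicator (I l) x * (f y * (indicator (J l) y * v y)) = (if l = k then f y * v y else 0)"
            using 3 other[of l] by (cases "l = k") auto
        qed
        also have "\<dots> = (if k \<in> F then f y * v y else 0)"
          using F by simp
        finally have uy: "?u y = (if k \<in> F then 0 else f y * v y)"
          using 3 by simp
        show ?thesis
        proof (cases "k \<in> F")
          case False
          then have "ennreal \<bar>?u y\<bar> = (\<Sum>k\<in>{k}. indicator (- F) k * (indicator (I k) x * (indicator (J k) y * ennreal \<bar>f y * v y\<bar>)))"
            unfolding uy using 3 by simp
          also have "\<dots> \<le> (\<integral>\<^sup>+k. indicator (- F) k * (indicator (I k) x * (indicator (J k) y * ennreal \<bar>f y * v y\<bar>)) \<partial>count_space UNIV)"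
            by (rule sum_le_nn_integral_count_space) simp
          finally show ?thesis .
        qed (simp add: uy)
      qed
    qed
    have "ennreal \<bar>T f x - partial_sum F f x\<bar> = ennreal \<bar>w x\<bar> * ennreal (norm (\<integral>y. ?u y \<partial>M))"
      unfolding eq by (simp add: abs_mult ennreal_mult)
    also have "\<dots> \<le> ennreal \<bar>w x\<bar> * (\<integral>\<^sup>+y. ennreal (norm (?u y)) \<partial>M)"
      by (intro mult_left_mono integral_norm_bound_ennreal Bochner_Integration.integrable_diff int
          Bochner_Integration.integrable_sum integrable_mult_right integrable_block f) auto
    also have "\<dots> \<le> ennreal \<bar>w x\<bar> * (\<integral>\<^sup>+y. (\<integral>\<^sup>+k. indicator (- F) k * (indicator (I k) x *
        (indicator (J k) y * ennreal \<bar>f y * v y\<bar>)) \<partial>count_space UNIV) \<partial>M)"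
      using u by (intro mult_left_mono nn_integral_mono_AE) auto
    also have "\<dots> = ennreal \<bar>w x\<bar> * (\<integral>\<^sup>+k. (\<integral>\<^sup>+y. indicator (- F) k * (indicator (I k) x *
        (indicator (J k) y * ennreal \<bar>f y * v y\<bar>)) \<partial>M) \<partial>count_space UNIV)"
      by (subst nn_integral_count_space_nn_integral) auto
    also have "\<dots> = (\<integral>\<^sup>+k. indicator (- F) k * (indicator (I k) x * ennreal \<bar>w x\<bar> *
        (\<integral>\<^sup>+y. indicator (J k) y * ennreal \<bar>f y * v y\<bar> \<partial>M)) \<partial>count_space UNIV)"
      by (simp add: nn_integral_cmult ac_simps flip: nn_integral_cmult)
    finally show ?case .
  qed
  have "(\<integral>\<^sup>+x. ennreal (\<bar>T f x - partial_sum F f x\<bar> powr p) \<partial>M) \<le>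
      (\<integral>\<^sup>+x. epowr (\<integral>\<^sup>+k. indicator (- F) k * (indicator (I k) x * ennreal \<bar>w x\<bar> *
        (\<integral>\<^sup>+y. indicator (J k) y * ennreal \<bar>f y * v y\<bar> \<partial>M)) \<partial>count_space UNIV) p \<partial>M)"
  proof (intro nn_integral_mono_AE, use pointwise in eventually_elim)
    case (elim x)
    show ?case
      using p epowr_mono[OF elim, of p] by (simp add: epowr_ennreal)
  qed
  also have "\<dots> \<le> ennreal ((R * \<epsilon>) powr p) * (\<integral>\<^sup>+y. ennreal (\<bar>f y\<bar> powr p) \<partial>M)"
    using \<epsilon> by (intro tail_bound) auto
  finally have "Lp_norm M p (\<lambda>x. T f x - partial_sum F f x) \<le>
      epowr (ennreal ((R * \<epsilon>) powr p) * (\<integral>\<^sup>+y. ennreal (\<bar>f y\<bar> powr p) \<partial>M)) (1 / p)"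
    unfolding Lp_norm_def using p by (intro epowr_mono) auto
  also have "\<dots> = ennreal (R * \<epsilon>) * Lp_norm M p f"
    using p R \<epsilon> by (simp add: epowr_mult epowr_ennreal powr_powr Lp_norm_def)
  also have "\<dots> \<le> ennreal (R * \<epsilon>)"
    using mult_left_mono[OF f1, of "ennreal (R * \<epsilon>)"] by simp
  finally show "Lp_norm M p (\<lambda>x. T f x - partial_sum F f x) \<le> ennreal (R * \<epsilon>)" .
qed

theorem sum_approx_numbers_le:
  assumes \<alpha>: "0 < \<alpha>" and inf: "infinite (UNIV :: 'k set)"
    and \<Omega>: "\<And>x. \<Omega> x \<in> sets M"
    and \<Omega>_finite: "AE x in M. (\<integral>\<^sup>+y. indicator (\<Omega> x) y * ennreal (\<bar>v y\<bar> powr conj_exp p) \<partial>M) < top"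
    and disjoint: "\<And>k l x y. x \<in> I k \<Longrightarrow> y \<in> J k \<Longrightarrow> x \<in> I l \<Longrightarrow> y \<in> J l \<Longrightarrow> k = l"
    and cover: "AE x in M. AE y in M. v y \<noteq> 0 \<longrightarrow> y \<in> \<Omega> x \<longleftrightarrow> (\<exists>k. x \<in> I k \<and> y \<in> J k)"
    and T: "\<And>f. f \<in> Lp_space M p \<Longrightarrow> AE x in M. T f x = w x * (\<integral>y. f y * (indicator (\<Omega> x) y * v y) \<partial>M)"
  shows "(\<Sum>n. epowr (approx_number M p T (Suc n)) \<alpha>)
    \<le> ennreal ((2 * R) powr \<alpha>) * (\<integral>\<^sup>+k. ennreal (t k powr \<alpha>) \<partial>count_space UNIV)"
proof (rule sum_powr_le_by_greedy_matching[OF \<alpha> R inf t])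
  fix F \<epsilon> assume F: "finite F" "0 \<le> (\<epsilon>::real)" "\<And>k. k \<notin> F \<Longrightarrow> t k \<le> \<epsilon>"
  have "Lp_rank M p (partial_sum F) < enat (Suc (card F))"
    using Lp_rank_partial_sum[OF F(1)] by (rule order_le_less_trans) simp
  then have "approx_number M p T (Suc (card F)) \<le> Lp_opnorm M p (\<lambda>f x. T f x - partial_sum F f x)"
    unfolding approx_number_def by (intro INF_lower) (simp add: Lp_operator_partial_sum)
  also have "\<dots> \<le> ennreal (R * \<epsilon>)"
    using F by (intro opnorm_diff_partial_sum[OF _ _ _ \<Omega> \<Omega>_finite disjoint cover T]) auto
  finally show "approx_number M p T (Suc (card F)) \<le> ennreal (R * \<epsilon>)" .
qed

end

section \<open>Dyadic blocks of a triangle\<close>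

lemma floor_power2_div: "\<lfloor>2 ^ j * s\<rfloor> = \<lfloor>2 ^ (j + m) * s\<rfloor> div 2 ^ m" for s :: real
proof -
  have "2 ^ j * s = (2 ^ (j + m) * s) / real_of_int (2 ^ m)"
    by (simp add: power_add)
  also have "\<lfloor>\<dots>\<rfloor> = \<lfloor>2 ^ (j + m) * s\<rfloor> div 2 ^ m"
    by (intro floor_divide_real_eq_div) simp
  finally show ?thesis .
qed

text \<open>The coarsest dyadic scale on which \<open>s\<close> and \<open>t\<close> lie in different intervals puts them into the
  left and the right half of a common interval of the next coarser scale. This splits the triangle \<open>s < t\<close> into
  disjoint dyadic squares. The point \<open>t = 1\<close> is separated from the others already at scale \<open>j = 0\<close>.\<close>

lemma dyadic_separation_ex:
  fixes s t :: real
  assumes "0 \<le> s" "s < t" "t \<le> 1"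
  shows "\<exists>j i. \<lfloor>2 ^ j * s\<rfloor> = int (2 * i) \<and> \<lfloor>2 ^ j * t\<rfloor> = int (2 * i + 1)"
proof -
  let ?P = "\<lambda>j. \<lfloor>2 ^ j * s\<rfloor> < \<lfloor>2 ^ j * t\<rfloor>"
  obtain n where n: "1 / (t - s) < 2 ^ n"
    using real_arch_pow[of 2 "1 / (t - s)"] by auto
  then have "2 ^ n * s + 1 \<le> 2 ^ n * t"
    using assms by (simp add: field_simps)
  then have "?P n" by linarith
  define j where "j = (LEAST j. ?P j)"
  have Pj: "?P j" unfolding j_def by (rule LeastI) fact
  show ?thesis
  proof (cases j)
    case 0
    have "\<lfloor>s\<rfloor> = 0" using assms by linarith
    moreover have "\<lfloor>t\<rfloor> = 1" using assms Pj 0 \<open>\<lfloor>s\<rfloor> = 0\<close> by simp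
    ultimately have "\<lfloor>s\<rfloor> = 0 \<and> \<lfloor>t\<rfloor> = 1" ..
    then show ?thesis by (intro exI[of _ "0::nat"]) simp
  next
    case (Suc m)
    then have "\<not> ?P m" unfolding j_def by (intro not_less_Least) simp
    moreover have "\<lfloor>2 ^ m * s\<rfloor> \<le> \<lfloor>2 ^ m * t\<rfloor>" using assms by (intro floor_mono) simp
    ultimately have eq: "\<lfloor>2 ^ m * s\<rfloor> = \<lfloor>2 ^ m * t\<rfloor>" by simp
    have "\<lfloor>2 ^ m * s\<rfloor> = \<lfloor>2 ^ j * s\<rfloor> div 2" "\<lfloor>2 ^ m * t\<rfloor> = \<lfloor>2 ^ j * t\<rfloor> div 2"
      using floor_power2_div[of m _ 1] Suc by simp_all
    then have "\<lfloor>2 ^ j * s\<rfloor> = 2 * \<lfloor>2 ^ m * s\<rfloor>" "\<lfloor>2 ^ j * t\<rfloor> = 2 * \<lfloor>2 ^ m * s\<rfloor> + 1"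
      using Pj eq by linarith+
    moreover have "\<lfloor>2 ^ m * s\<rfloor> = int (nat \<lfloor>2 ^ m * s\<rfloor>)" using assms by simp
    ultimately show ?thesis by (intro exI[of _ j] exI[of _ "nat \<lfloor>2 ^ m * s\<rfloor>"]) simp
  qed
qed

lemma dyadic_separation_less:
  fixes s t :: real
  assumes "\<lfloor>2 ^ j * s\<rfloor> = int (2 * i)" "\<lfloor>2 ^ j * t\<rfloor> = int (2 * i + 1)"
  shows "s < t"
proof -
  have "\<lfloor>2 ^ j * s\<rfloor> < \<lfloor>2 ^ j * t\<rfloor>" using assms by simp
  then have "2 ^ j * s < 2 ^ j * t" using floor_mono[of "2 ^ j * t" "2 ^ j * s"] by linarith
  then show ?thesis by simp
qed

lemma dyadic_separation_unique:
  fixes s t :: real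
  assumes "\<lfloor>2 ^ j * s\<rfloor> = int (2 * i)" "\<lfloor>2 ^ j * t\<rfloor> = int (2 * i + 1)"
    and "\<lfloor>2 ^ k * s\<rfloor> = int (2 * l)" "\<lfloor>2 ^ k * t\<rfloor> = int (2 * l + 1)"
  shows "j = k \<and> i = l"
proof -
  \<comment> \<open>At the level just above the separating one the two points share their interval,
    hence they share it at all coarser levels.\<close>
  have *: False if "j < k" "\<lfloor>2 ^ j * s\<rfloor> = int (2 * i)" "\<lfloor>2 ^ j * t\<rfloor> = int (2 * i + 1)"
    "\<lfloor>2 ^ k * s\<rfloor> = int (2 * l)" "\<lfloor>2 ^ k * t\<rfloor> = int (2 * l + 1)" for j k i l
  proof -
    obtain m where m: "k = Suc (j + m)" using less_imp_Suc_add[OF \<open>j < k\<close>] by auto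
    have up: "\<lfloor>2 ^ j * z\<rfloor> = \<lfloor>2 ^ k * z\<rfloor> div 2 div 2 ^ m" for z :: real
      using floor_power2_div[of j z m] floor_power2_div[of "j + m" z 1] m by simp
    have "int (2 * l) div 2 = int (2 * l + 1) div 2" by simp
    then have "\<lfloor>2 ^ j * s\<rfloor> = \<lfloor>2 ^ j * t\<rfloor>" unfolding up that(4,5) by simp
    then show False using that(2,3) by simp
  qed
  have "j = k" using *[of j k i l] *[of k j l i] assms by (meson nat_neq_iff)
  then show ?thesis using assms by simp
qed

text \<open>For \<open>\<gamma> \<ge> 1\<close> the power function is superadditive; for \<open>\<gamma> < 1\<close> the factor comes from
  comparing every term with the mean by the weighted arithmetic-geometric inequality.\<close>

lemma sum_powr_le:
  fixes x :: "nat \<Rightarrow> real"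
  assumes x: "\<And>i. 0 \<le> x i" and \<gamma>: "0 < \<gamma>" and n: "0 < n"
  shows "(\<Sum>i<n. x i powr \<gamma>) \<le> real n powr max 0 (1 - \<gamma>) * (\<Sum>i<n. x i) powr \<gamma>"
proof -
  define S where "S = (\<Sum>i<n. x i)"
  have S: "0 \<le> S" unfolding S_def using x by (intro sum_nonneg) auto
  have xS: "x i \<le> S" if "i < n" for i
    unfolding S_def using that x by (intro member_le_sum) auto
  show ?thesis
  proof (cases "S = 0")
    case True
    then have "x i = 0" if "i < n" for i using xS[OF that] x[of i] by simp
    then show ?thesis by (simp add: \<gamma>)
  next
    case False
    then have S: "0 < S" using S by simp
    show ?thesis
    proof (cases "1 \<le> \<gamma>")
      case True
      have "x i powr \<gamma> \<le> x i * S powr (\<gamma> - 1)" if "i < n" for i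
      proof (cases "x i = 0")
        case False
        then have "x i powr \<gamma> = x i * x i powr (\<gamma> - 1)"
          using x[of i] by (simp add: powr_diff)
        also have "\<dots> \<le> x i * S powr (\<gamma> - 1)"
          using x[of i] xS[OF that] True by (intro mult_left_mono powr_mono2) auto
        finally show ?thesis .
      qed (use \<gamma> in simp)
      then have "(\<Sum>i<n. x i powr \<gamma>) \<le> (\<Sum>i<n. x i * S powr (\<gamma> - 1))"
        by (intro sum_mono) auto
      also have "\<dots> = S * S powr (\<gamma> - 1)" by (simp add: S_def sum_distrib_right)
      also have "\<dots> = S powr \<gamma>" using S by (simp add: powr_diff)
      finally show ?thesis using True n by (simp add: S_def)
    next
      case False
      have "x i powr \<gamma> * (S / n) powr (1 - \<gamma>) \<le> \<gamma> * x i + (1 - \<gamma>) * (S / n)" for i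
      proof (cases "x i = 0")
        case False
        then show ?thesis
          using x[of i] S n \<gamma> \<open>\<not> 1 \<le> \<gamma>\<close> by (intro Youngs_inequality_0) auto
      qed (use \<gamma> False S in simp)
      then have "(\<Sum>i<n. x i powr \<gamma> * (S / n) powr (1 - \<gamma>)) \<le> (\<Sum>i<n. \<gamma> * x i + (1 - \<gamma>) * (S / n))"
        by (intro sum_mono) auto
      also have "\<dots> = S"
      proof -
        have "(\<Sum>i<n. \<gamma> * x i + (1 - \<gamma>) * (S / n)) = \<gamma> * S + (1 - \<gamma>) * S"
          using n by (simp add: S_def sum.distrib flip: sum_distrib_left)
        then show ?thesis by (simp add: algebra_simps)
      qed
      finally have "(\<Sum>i<n. x i powr \<gamma>) * (S / n) powr (1 - \<gamma>) \<le> S"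
        by (simp add: sum_distrib_right)
      then have "(\<Sum>i<n. x i powr \<gamma>) \<le> S / (S / n) powr (1 - \<gamma>)"
        using S n by (simp add: field_simps)
      also have "\<dots> = real n powr (1 - \<gamma>) * S powr \<gamma>"
        using S n by (simp add: powr_divide powr_diff field_simps)
      finally show ?thesis using False by (simp add: S_def)
    qed
  qed
qed

text \<open>The rate \<open>\<delta>\<close> at which the blocks of depth \<open>j\<close> of a triangle contribute, namely a multiple of
  \<open>2 powr (- \<delta> * j)\<close>, to the sum of the powers of block norms: the row masses decay like
  \<open>2 powr (- j)\<close>, and splitting the column mass into \<open>2 ^ j\<close> parts costs at most a
  factor \<open>2 powr (j * max 0 (1 - \<alpha> / p))\<close>.
  Since \<open>\<alpha> / p + \<alpha> / conj_exp p = \<alpha>\<close>, it is the smaller of \<open>\<alpha> / conj_exp p\<close> and \<open>\<alpha> - 1\<close>.\<close>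

definition dyadic_decay :: "real \<Rightarrow> real \<Rightarrow> real" where
  "dyadic_decay p \<alpha> = \<alpha> / conj_exp p - max 0 (1 - \<alpha> / p)"

text \<open>The weight of a block of depth \<open>j\<close> in Schur's test is the \<open>j\<close>th power of this number. Its exponent
  spends half of the available decay.\<close>

definition level_weight :: "real \<Rightarrow> real \<Rightarrow> real" where
  "level_weight p \<alpha> = 2 powr (- (dyadic_decay p \<alpha> / (2 * \<alpha>)))"

lemma dyadic_decay_pos:
  assumes "1 < p" "1 < \<alpha>"
  shows "0 < dyadic_decay p \<alpha>"
proof -
  have "\<alpha> / conj_exp p = \<alpha> - \<alpha> / p"
    using inverse_conj_exp[OF assms(1)] by (metis (no_types) mult.right_neutral right_diff_distrib times_divide_eq_right)
  moreover have "0 < \<alpha> / conj_exp p" using assms conj_exp_gt_0 by simp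
  ultimately show ?thesis using assms by (auto simp: dyadic_decay_def max_def)
qed

lemma level_weight:
  assumes "1 < p" "1 < \<alpha>"
  shows "0 < level_weight p \<alpha>" "level_weight p \<alpha> < 1"
    "level_weight p \<alpha> powr \<alpha> = 2 powr (- (dyadic_decay p \<alpha> / 2))"
proof -
  show "0 < level_weight p \<alpha>" by (simp add: level_weight_def)
  have "2 powr (- (dyadic_decay p \<alpha> / (2 * \<alpha>))) < 2 powr (0::real)"
    using dyadic_decay_pos[OF assms] assms by (intro powr_less_mono) auto
  then show "level_weight p \<alpha> < 1" by (simp add: level_weight_def)
  show "level_weight p \<alpha> powr \<alpha> = 2 powr (- (dyadic_decay p \<alpha> / 2))"
    using assms by (simp add: level_weight_def powr_powr)
qed

text \<open>The sum of \<open>2 * (j + 1) * level_weight p \<alpha> ^ j\<close> over all depths \<open>j\<close>.\<close>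

definition overlap_const :: "real \<Rightarrow> real \<Rightarrow> real" where
  "overlap_const p \<alpha> = 2 / (1 - level_weight p \<alpha>)\<^sup>2"

definition dyadic_const :: "real \<Rightarrow> real \<Rightarrow> real" where
  "dyadic_const p \<alpha> = (2 * overlap_const p \<alpha>) powr \<alpha> / (1 - 2 powr (- (dyadic_decay p \<alpha> / 2)))"

lemma dyadic_const_pos:
  assumes "1 < p" "1 < \<alpha>"
  shows "0 < overlap_const p \<alpha>" "0 < dyadic_const p \<alpha>"
proof -
  show 1: "0 < overlap_const p \<alpha>"
    using level_weight[OF assms] by (simp add: overlap_const_def)
  have "2 powr (- (dyadic_decay p \<alpha> / 2)) < 2 powr (0::real)"
    using dyadic_decay_pos[OF assms] by (intro powr_less_mono) auto
  then show "0 < dyadic_const p \<alpha>" using 1 by (simp add: dyadic_const_def)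
qed

lemma nn_integral_level_weights:
  assumes "1 < p" "1 < \<alpha>"
  shows "(\<integral>\<^sup>+j. ennreal (level_weight p \<alpha> ^ j) * ennreal (2 * real (Suc j)) \<partial>count_space UNIV)
    = ennreal (overlap_const p \<alpha>)"
proof -
  have "(\<lambda>j. of_nat (Suc j) * level_weight p \<alpha> ^ j) sums (1 / (1 - level_weight p \<alpha>)\<^sup>2)"
    using level_weight[OF assms] by (intro geometric_deriv_sums) auto
  then have "(\<lambda>j. 2 * (of_nat (Suc j) * level_weight p \<alpha> ^ j)) sums (2 * (1 / (1 - level_weight p \<alpha>)\<^sup>2))"
    by (rule sums_mult)
  then have "(\<Sum>j. ennreal (2 * (of_nat (Suc j) * level_weight p \<alpha> ^ j))) = ennreal (2 * (1 / (1 - level_weight p \<alpha>)\<^sup>2))"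
    using level_weight[OF assms] by (intro suminf_ennreal_eq) (auto simp del: of_nat_Suc)
  then show ?thesis
    using level_weight[OF assms]
    by (simp add: nn_integral_count_space_nat overlap_const_def ac_simps del: of_nat_Suc flip: ennreal_mult)
qed

lemma nn_integral_count_space_indicator_le_1:
  assumes "\<And>i l. P i \<Longrightarrow> P l \<Longrightarrow> i = l"
  shows "(\<integral>\<^sup>+i. indicator {i. P i} i \<partial>count_space (UNIV :: 'k set)) \<le> 1"
proof -
  have "{i. P i} = {} \<or> (\<exists>a. {i. P i} = {a})" using assms by blast
  then consider "{i. P i} = {}" | a where "{i. P i} = {a}" by blast
  then show ?thesis by cases simp_all
qed

lemma nn_integral_count_space_indicator_card:
  assumes "finite {i. P i}" "card {i. P i} \<le> n"
  shows "(\<integral>\<^sup>+i. indicator {i. P i} i \<partial>count_space (UNIV :: 'k set)) \<le> ennreal (real n)"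
  using assms by (simp add: emeasure_count_space_finite ennreal_of_nat_eq_real_of_nat)

text \<open>A countable family of triangles \<open>{(x, y). x \<in> X \<kappa> \<and> y \<in> Z \<kappa> \<and> d \<kappa> x < c \<kappa> y}\<close>, where \<open>c \<kappa>\<close>
  distributes the mass of \<open>\<bar>v\<bar> powr conj_exp p\<close> on \<open>Z \<kappa>\<close> with density at most \<open>H \<kappa>\<close>. Unboundedly many of the sets \<open>Z \<kappa>\<close> may contain
  a point \<open>y\<close>, but only linearly many in \<open>j\<close> place it above height \<open>1 / 2 ^ j\<close>. A dyadic block of depth \<open>j\<close> lies above
  this height, so that geometric weights in \<open>j\<close> still satisfy the overlap condition.\<close>

locale triangle_family =
  fixes M :: "'a measure" and p \<alpha> :: real and w v :: "'a \<Rightarrow> real"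
    and X Z :: "'c::countable \<Rightarrow> 'a set" and c d :: "'c \<Rightarrow> 'a \<Rightarrow> real" and H :: "'c \<Rightarrow> real"
  assumes p: "1 < p" and \<alpha>: "1 < \<alpha>"
    and w [measurable]: "w \<in> borel_measurable M"
    and v [measurable]: "v \<in> borel_measurable M"
    and X [measurable]: "\<And>\<kappa>. X \<kappa> \<in> sets M"
    and Z [measurable]: "\<And>\<kappa>. Z \<kappa> \<in> sets M"
    and c [measurable]: "\<And>\<kappa>. c \<kappa> \<in> borel_measurable M"
    and d [measurable]: "\<And>\<kappa>. d \<kappa> \<in> borel_measurable M"
    and c_le_1: "\<And>\<kappa> y. y \<in> Z \<kappa> \<Longrightarrow> c \<kappa> y \<le> 1"
    and d_nonneg: "\<And>\<kappa> x. x \<in> X \<kappa> \<Longrightarrow> 0 \<le> d \<kappa> x"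
    and H: "\<And>\<kappa>. 0 \<le> H \<kappa>"
    and w_finite: "\<And>\<kappa>. (\<integral>\<^sup>+x. indicator (X \<kappa>) x * ennreal (\<bar>w x\<bar> powr p) \<partial>M) < top"
    and mass: "\<And>\<kappa> s t. 0 < s \<Longrightarrow> s \<le> t \<Longrightarrow>
        (\<integral>\<^sup>+y. indicator {y \<in> Z \<kappa>. s \<le> c \<kappa> y \<and> c \<kappa> y \<le> t} y * ennreal (\<bar>v y\<bar> powr conj_exp p) \<partial>M)
        \<le> ennreal ((t - s) * H \<kappa>)"
    and overlap_X: "\<And>x. finite {\<kappa>. x \<in> X \<kappa>}" "\<And>x. card {\<kappa>. x \<in> X \<kappa>} \<le> 2"
    and overlap_Z: "\<And>y j. finite {\<kappa>. y \<in> Z \<kappa> \<and> 1 / 2 ^ j \<le> c \<kappa> y}"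
      "\<And>y j. card {\<kappa>. y \<in> Z \<kappa> \<and> 1 / 2 ^ j \<le> c \<kappa> y} \<le> 2 * Suc j"
begin

abbreviation \<rho> :: real where "\<rho> \<equiv> level_weight p \<alpha>"

text \<open>In an index \<open>(j, \<kappa>, i)\<close> the triangle is \<open>\<kappa>\<close>, the depth is \<open>j\<close>, and \<open>i\<close> numbers the dyadic
  intervals of length \<open>2 / 2 ^ j\<close>: the columns occupy the left half and the rows the right half.\<close>

definition colset :: "nat \<times> 'c \<times> nat \<Rightarrow> 'a set" where
  "colset = (\<lambda>(j, \<kappa>, i). {x \<in> X \<kappa>. \<lfloor>2 ^ j * d \<kappa> x\<rfloor> = int (2 * i)})"

definition rowset :: "nat \<times> 'c \<times> nat \<Rightarrow> 'a set" where
  "rowset = (\<lambda>(j, \<kappa>, i). {y \<in> Z \<kappa>. \<lfloor>2 ^ j * c \<kappa> y\<rfloor> = int (2 * i + 1)})"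

definition wmass :: "'a set \<Rightarrow> real" where
  "wmass S = enn2real (\<integral>\<^sup>+x. indicator S x * ennreal (\<bar>w x\<bar> powr p) \<partial>M)"

text \<open>For \<open>i \<ge> 2 ^ j\<close> the block has no rows since \<open>c \<kappa>\<close> does not exceed 1.\<close>

definition tval :: "nat \<times> 'c \<times> nat \<Rightarrow> real" where
  "tval = (\<lambda>(j, \<kappa>, i). if i < 2 ^ j
     then wmass (colset (j, \<kappa>, i)) powr (1 / p) * (H \<kappa> / 2 ^ j) powr (1 / conj_exp p) / \<rho> ^ j else 0)"

lemma rho: "0 < \<rho>" "\<rho> < 1"
  using level_weight[OF p \<alpha>] by auto

lemma colset_measurable [measurable]: "colset k \<in> sets M"
proof -
  have "colset (j, \<kappa>, i) = X \<kappa> \<inter> {x \<in> space M. \<lfloor>2 ^ j * d \<kappa> x\<rfloor> = int (2 * i)}" for j \<kappa> i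
    using sets.sets_into_space[OF X] by (auto simp: colset_def)
  moreover have "X \<kappa> \<inter> {x \<in> space M. \<lfloor>2 ^ j * d \<kappa> x\<rfloor> = int (2 * i)} \<in> sets M" for j \<kappa> i
    by measurable
  ultimately show ?thesis by (cases k) simp
qed

lemma rowset_measurable [measurable]: "rowset k \<in> sets M"
proof -
  have "rowset (j, \<kappa>, i) = Z \<kappa> \<inter> {x \<in> space M. \<lfloor>2 ^ j * c \<kappa> x\<rfloor> = int (2 * i + 1)}" for j \<kappa> i
    using sets.sets_into_space[OF Z] by (auto simp: rowset_def)
  moreover have "Z \<kappa> \<inter> {x \<in> space M. \<lfloor>2 ^ j * c \<kappa> x\<rfloor> = int (2 * i + 1)} \<in> sets M" for j \<kappa> i
    by measurable
  ultimately show ?thesis by (cases k) simp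
qed

lemma rowset_bounds:
  assumes "y \<in> rowset (j, \<kappa>, i)"
  shows "y \<in> Z \<kappa>" "real (2 * i + 1) / 2 ^ j \<le> c \<kappa> y" "c \<kappa> y \<le> real (2 * i + 2) / 2 ^ j"
    "1 / 2 ^ j \<le> c \<kappa> y" "i < 2 ^ j"
proof -
  have y: "y \<in> Z \<kappa>" "\<lfloor>2 ^ j * c \<kappa> y\<rfloor> = int (2 * i + 1)" using assms by (auto simp: rowset_def)
  show "y \<in> Z \<kappa>" by fact
  have 1: "real (2 * i + 1) \<le> 2 ^ j * c \<kappa> y" "2 ^ j * c \<kappa> y \<le> real (2 * i + 2)" using y(2) by linarith+
  then show "real (2 * i + 1) / 2 ^ j \<le> c \<kappa> y" "c \<kappa> y \<le> real (2 * i + 2) / 2 ^ j"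
    by (simp_all add: field_simps)
  have "1 / 2 ^ j \<le> real (2 * i + 1) / 2 ^ j" by (intro divide_right_mono) auto
  also have "\<dots> \<le> c \<kappa> y" by fact
  finally show "1 / 2 ^ j \<le> c \<kappa> y" .
  have "2 ^ j * c \<kappa> y \<le> 2 ^ j * 1" using c_le_1[OF y(1)] by (intro mult_left_mono) auto
  then have "real (2 * i + 1) \<le> 2 ^ j" using 1(1) by linarith
  then have "real (2 * i + 1) \<le> real (2 ^ j)" by simp
  then have "2 * i + 1 \<le> 2 ^ j" by (simp only: of_nat_le_iff)
  then show "i < 2 ^ j" by simp
qed

lemma row_mass:
  "(\<integral>\<^sup>+y. indicator (rowset (j, \<kappa>, i)) y * ennreal (\<bar>v y\<bar> powr conj_exp p) \<partial>M) \<le> ennreal (H \<kappa> / 2 ^ j)"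
proof -
  have "(\<integral>\<^sup>+y. indicator (rowset (j, \<kappa>, i)) y * ennreal (\<bar>v y\<bar> powr conj_exp p) \<partial>M) \<le>
      (\<integral>\<^sup>+y. indicator {y \<in> Z \<kappa>. real (2 * i + 1) / 2 ^ j \<le> c \<kappa> y \<and> c \<kappa> y \<le> real (2 * i + 2) / 2 ^ j} y *
         ennreal (\<bar>v y\<bar> powr conj_exp p) \<partial>M)"
    using rowset_bounds[of _ j \<kappa> i] by (intro nn_integral_mono) (auto split: split_indicator)
  also have "\<dots> \<le> ennreal ((real (2 * i + 2) / 2 ^ j - real (2 * i + 1) / 2 ^ j) * H \<kappa>)"
    by (intro mass) (auto simp: divide_right_mono)
  also have "(real (2 * i + 2) / 2 ^ j - real (2 * i + 1) / 2 ^ j) * H \<kappa> = H \<kappa> / 2 ^ j"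
    by (simp flip: diff_divide_distrib)
  finally show ?thesis .
qed

lemma col_mass:
  "(\<integral>\<^sup>+x. indicator (colset (j, \<kappa>, i)) x * ennreal (\<bar>w x\<bar> powr p) \<partial>M) = ennreal (wmass (colset (j, \<kappa>, i)))"
proof -
  have "(\<integral>\<^sup>+x. indicator (colset (j, \<kappa>, i)) x * ennreal (\<bar>w x\<bar> powr p) \<partial>M)
      \<le> (\<integral>\<^sup>+x. indicator (X \<kappa>) x * ennreal (\<bar>w x\<bar> powr p) \<partial>M)"
    by (intro nn_integral_mono) (auto split: split_indicator simp: colset_def)
  also have "\<dots> < top" by (rule w_finite)
  finally show ?thesis by (simp add: wmass_def)
qed

lemma wmass_nonneg: "0 \<le> wmass S"
  by (simp add: wmass_def)

lemma sum_triple: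
  fixes f :: "nat \<times> 'c \<times> nat \<Rightarrow> ennreal"
  shows "(\<integral>\<^sup>+k. f k \<partial>count_space UNIV) =
    (\<integral>\<^sup>+j. \<integral>\<^sup>+\<kappa>. \<integral>\<^sup>+i. f (j, \<kappa>, i) \<partial>count_space UNIV \<partial>count_space UNIV \<partial>count_space UNIV)"
  by (simp add: nn_integral_fst_count_space[symmetric, of f]
      nn_integral_fst_count_space[symmetric, of "\<lambda>x. f (_, x)"])

text \<open>At each depth a point lies in at most one block of every triangle, so the number of triangles
  that matter at this depth controls the overlap.\<close>

lemma overlap_bound:
  fixes S :: "nat \<times> 'c \<times> nat \<Rightarrow> 'b set"
  assumes one: "\<And>j \<kappa> i l. y \<in> S (j, \<kappa>, i) \<Longrightarrow> y \<in> S (j, \<kappa>, l) \<Longrightarrow> i = l"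
    and sub: "\<And>j \<kappa> i. y \<in> S (j, \<kappa>, i) \<Longrightarrow> Q j \<kappa>"
    and Q: "\<And>j. finite {\<kappa>. Q j \<kappa>}" "\<And>j. card {\<kappa>. Q j \<kappa>} \<le> 2 * Suc j"
  shows "(\<integral>\<^sup>+k. ennreal (\<rho> ^ fst k) * indicator (S k) y \<partial>count_space UNIV) \<le> ennreal (overlap_const p \<alpha>)"
proof -
  have inner: "(\<integral>\<^sup>+i. indicator (S (j, \<kappa>, i)) y \<partial>count_space UNIV) \<le> indicator {\<kappa>. Q j \<kappa>} \<kappa>" for j \<kappa>
  proof (cases "Q j \<kappa>")
    case True
    have "(\<integral>\<^sup>+i. indicator (S (j, \<kappa>, i)) y \<partial>count_space UNIV) =
        (\<integral>\<^sup>+i. indicator {i. y \<in> S (j, \<kappa>, i)} i \<partial>count_space UNIV)"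
      by (intro nn_integral_cong) (auto split: split_indicator)
    also have "\<dots> \<le> 1" by (intro nn_integral_count_space_indicator_le_1) (rule one)
    finally show ?thesis using True by simp
  next
    case False
    then have "indicator (S (j, \<kappa>, i)) y = (0::ennreal)" for i
      using sub[of j \<kappa> i] by (auto split: split_indicator)
    then show ?thesis by simp
  qed
  have "(\<integral>\<^sup>+k. ennreal (\<rho> ^ fst k) * indicator (S k) y \<partial>count_space UNIV) =
    (\<integral>\<^sup>+j. ennreal (\<rho> ^ j) * (\<integral>\<^sup>+\<kappa>. \<integral>\<^sup>+i. indicator (S (j, \<kappa>, i)) y \<partial>count_space UNIV \<partial>count_space UNIV) \<partial>count_space UNIV)"
    by (simp add: sum_triple nn_integral_cmult)
  also have "\<dots> \<le> (\<integral>\<^sup>+j. ennreal (\<rho> ^ j) * ennreal (2 * real (Suc j)) \<partial>count_space UNIV)"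
  proof (intro nn_integral_mono mult_left_mono)
    fix j
    have "(\<integral>\<^sup>+\<kappa>. \<integral>\<^sup>+i. indicator (S (j, \<kappa>, i)) y \<partial>count_space UNIV \<partial>count_space UNIV)
      \<le> (\<integral>\<^sup>+\<kappa>. indicator {\<kappa>. Q j \<kappa>} \<kappa> \<partial>count_space UNIV)"
      by (intro nn_integral_mono inner)
    also have "\<dots> \<le> ennreal (real (2 * Suc j))"
      by (intro nn_integral_count_space_indicator_card Q)
    finally show "(\<integral>\<^sup>+\<kappa>. \<integral>\<^sup>+i. indicator (S (j, \<kappa>, i)) y \<partial>count_space UNIV \<partial>count_space UNIV) \<le> ennreal (2 * real (Suc j))"
      by simp
  qed simp
  also have "\<dots> = ennreal (overlap_const p \<alpha>)" by (rule nn_integral_level_weights[OF p \<alpha>])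
  finally show ?thesis .
qed

sublocale blocks: rank_one_blocks M p "overlap_const p \<alpha>" w v colset rowset "\<lambda>k. \<rho> ^ fst k" tval
proof (unfold_locales; (rule p w v colset_measurable rowset_measurable)?)
  show "0 < overlap_const p \<alpha>" using dyadic_const_pos[OF p \<alpha>] by simp
  fix k :: "nat \<times> 'c \<times> nat"
  obtain j \<kappa> i where k: "k = (j, \<kappa>, i)" by (cases k)
  show "0 < \<rho> ^ fst k" using rho by simp
  show "0 \<le> tval k" using rho by (auto simp: tval_def k)
  show "(\<integral>\<^sup>+x. indicator (colset k) x * ennreal (\<bar>w x\<bar> powr p) \<partial>M) < top"
    unfolding k col_mass by simp
  have "(\<integral>\<^sup>+y. indicator (rowset k) y * ennreal (\<bar>v y\<bar> powr conj_exp p) \<partial>M) \<le> ennreal (H \<kappa> / 2 ^ j)"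
    unfolding k by (rule row_mass)
  also have "\<dots> < top" by simp
  finally show "(\<integral>\<^sup>+y. indicator (rowset k) y * ennreal (\<bar>v y\<bar> powr conj_exp p) \<partial>M) < top" .
  show "(\<integral>\<^sup>+x. indicator (colset k) x * ennreal (\<bar>w x\<bar> powr p) \<partial>M) *
        epowr (\<integral>\<^sup>+y. indicator (rowset k) y * ennreal (\<bar>v y\<bar> powr conj_exp p) \<partial>M) (p - 1)
        \<le> ennreal ((\<rho> ^ fst k * tval k) powr p)"
  proof (cases "i < 2 ^ j")
    case True
    have "\<rho> ^ j * tval k = wmass (colset k) powr (1 / p) * (H \<kappa> / 2 ^ j) powr (1 / conj_exp p)"
      using True rho by (simp add: tval_def k)
    then have rt: "(\<rho> ^ fst k * tval k) powr p = wmass (colset k) * (H \<kappa> / 2 ^ j) powr (p - 1)"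
      using p H[of \<kappa>] wmass_nonneg[of "colset k"] p_div_conj_exp[OF p]
      by (simp add: k powr_mult powr_powr)
    have "epowr (\<integral>\<^sup>+y. indicator (rowset k) y * ennreal (\<bar>v y\<bar> powr conj_exp p) \<partial>M) (p - 1)
        \<le> epowr (ennreal (H \<kappa> / 2 ^ j)) (p - 1)"
      unfolding k using p by (intro epowr_mono row_mass) auto
    also have "\<dots> = ennreal ((H \<kappa> / 2 ^ j) powr (p - 1))"
      using p H[of \<kappa>] by (simp add: epowr_ennreal)
    finally have "ennreal (wmass (colset k)) * epowr (\<integral>\<^sup>+y. indicator (rowset k) y * ennreal (\<bar>v y\<bar> powr conj_exp p) \<partial>M) (p - 1)
        \<le> ennreal (wmass (colset k)) * ennreal ((H \<kappa> / 2 ^ j) powr (p - 1))"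
      by (intro mult_left_mono) auto
    also have "\<dots> = ennreal ((\<rho> ^ fst k * tval k) powr p)"
      unfolding rt using wmass_nonneg[of "colset k"] by (simp add: ennreal_mult)
    finally show ?thesis using col_mass[of j \<kappa> i] k by simp
  next
    case False
    then have "rowset k = {}" using rowset_bounds(5)[of _ j \<kappa> i] by (auto simp: k)
    then show ?thesis using p by (simp add: epowr_0)
  qed
next
  fix x
  show "(\<integral>\<^sup>+k. ennreal (\<rho> ^ fst k) * indicator (colset k) x \<partial>count_space UNIV) \<le> ennreal (overlap_const p \<alpha>)"
  proof (rule overlap_bound[where Q = "\<lambda>j \<kappa>. x \<in> X \<kappa>"])
    show "card {\<kappa>. x \<in> X \<kappa>} \<le> 2 * Suc j" for j using overlap_X(2)[of x] by simp
  qed (auto simp: colset_def overlap_X)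
  show "(\<integral>\<^sup>+k. ennreal (\<rho> ^ fst k) * indicator (rowset k) x \<partial>count_space UNIV) \<le> ennreal (overlap_const p \<alpha>)"
  proof (rule overlap_bound[where Q = "\<lambda>j \<kappa>. x \<in> Z \<kappa> \<and> 1 / 2 ^ j \<le> c \<kappa> x"])
    show "x \<in> rowset (j, \<kappa>, i) \<Longrightarrow> x \<in> Z \<kappa> \<and> 1 / 2 ^ j \<le> c \<kappa> x" for j \<kappa> i
      using rowset_bounds by blast
  qed (use overlap_Z in \<open>auto simp: rowset_def\<close>)
qed

lemma sum_col_mass: "(\<Sum>i<2 ^ j. wmass (colset (j, \<kappa>, i))) \<le> wmass (X \<kappa>)"
proof -
  have "ennreal (\<Sum>i<2 ^ j. wmass (colset (j, \<kappa>, i))) =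
      (\<Sum>i<2 ^ j. \<integral>\<^sup>+x. indicator (colset (j, \<kappa>, i)) x * ennreal (\<bar>w x\<bar> powr p) \<partial>M)"
    unfolding col_mass by (simp add: wmass_nonneg)
  also have "\<dots> = (\<integral>\<^sup>+x. (\<Sum>i<2 ^ j. indicator (colset (j, \<kappa>, i)) x * ennreal (\<bar>w x\<bar> powr p)) \<partial>M)"
    by (intro nn_integral_sum[symmetric]) measurable
  also have "\<dots> \<le> (\<integral>\<^sup>+x. indicator (X \<kappa>) x * ennreal (\<bar>w x\<bar> powr p) \<partial>M)"
  proof (intro nn_integral_mono)
    fix x
    have "(\<Sum>i<2 ^ j. indicator (colset (j, \<kappa>, i)) x :: ennreal) \<le>
        (\<integral>\<^sup>+i. indicator {i. x \<in> colset (j, \<kappa>, i)} i \<partial>count_space UNIV)"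
      by (rule order_trans[OF _ sum_le_nn_integral_count_space[of "{..<2 ^ j}"]])
        (auto intro!: sum_mono split: split_indicator)
    also have "\<dots> \<le> indicator (X \<kappa>) x"
    proof (cases "x \<in> X \<kappa>")
      case True
      have "(\<integral>\<^sup>+i. indicator {i. x \<in> colset (j, \<kappa>, i)} i \<partial>count_space UNIV) \<le> 1"
        by (intro nn_integral_count_space_indicator_le_1) (auto simp: colset_def)
      then show ?thesis using True by simp
    qed (auto simp: colset_def)
    finally show "(\<Sum>i<2 ^ j. indicator (colset (j, \<kappa>, i)) x * ennreal (\<bar>w x\<bar> powr p))
        \<le> indicator (X \<kappa>) x * ennreal (\<bar>w x\<bar> powr p)"
      by (simp add: mult_right_mono flip: sum_distrib_right)
  qed
  also have "\<dots> = ennreal (wmass (X \<kappa>))" using w_finite[of \<kappa>] by (simp add: wmass_def)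
  finally show ?thesis by (simp add: wmass_nonneg)
qed

text \<open>Summed over the blocks of one depth in one triangle, the powers of the norms decay at the rate
  \<open>dyadic_decay\<close>; dividing by the weights leaves half of it.\<close>

lemma sum_level:
  "(\<integral>\<^sup>+i. ennreal (tval (j, \<kappa>, i) powr \<alpha>) \<partial>count_space UNIV)
    \<le> ennreal ((2 powr (- (dyadic_decay p \<alpha> / 2))) ^ j) * ennreal (wmass (X \<kappa>) powr (\<alpha> / p) * H \<kappa> powr (\<alpha> / conj_exp p))"
proof -
  define q where "q = conj_exp p"
  have q: "0 < q" using p by (simp add: q_def conj_exp_gt_0)
  define \<gamma> where "\<gamma> = \<alpha> / p"
  have \<gamma>: "0 < \<gamma>" using p \<alpha> by (simp add: \<gamma>_def)
  define D where "D = (H \<kappa> / 2 ^ j) powr (\<alpha> / q) / (\<rho> ^ j) powr \<alpha>"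
  have D: "0 \<le> D" by (simp add: D_def)
  have "(\<integral>\<^sup>+i. ennreal (tval (j, \<kappa>, i) powr \<alpha>) \<partial>count_space UNIV) =
      (\<Sum>i<2 ^ j. ennreal (tval (j, \<kappa>, i) powr \<alpha>))"
    using \<alpha> by (intro nn_integral_count_space') (auto simp: tval_def)
  also have "\<dots> = ennreal (\<Sum>i<2 ^ j. tval (j, \<kappa>, i) powr \<alpha>)" by simp
  also have "(\<Sum>i<2 ^ j. tval (j, \<kappa>, i) powr \<alpha>) = (\<Sum>i<2 ^ j. wmass (colset (j, \<kappa>, i)) powr \<gamma>) * D"
    unfolding sum_distrib_right
  proof (intro sum.cong refl)
    fix i :: nat assume "i \<in> {..<2 ^ j}"
    then show "tval (j, \<kappa>, i) powr \<alpha> = wmass (colset (j, \<kappa>, i)) powr \<gamma> * D"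
      using rho H[of \<kappa>] by (simp add: tval_def D_def \<gamma>_def q_def powr_mult powr_divide powr_powr)
  qed
  also have "ennreal \<dots> \<le> ennreal ((real (2 ^ j) powr max 0 (1 - \<gamma>) * wmass (X \<kappa>) powr \<gamma>) * D)"
  proof (intro ennreal_leI mult_right_mono D)
    have "(\<Sum>i<2 ^ j. wmass (colset (j, \<kappa>, i)) powr \<gamma>)
        \<le> real (2 ^ j) powr max 0 (1 - \<gamma>) * (\<Sum>i<2 ^ j. wmass (colset (j, \<kappa>, i))) powr \<gamma>"
      by (intro sum_powr_le wmass_nonneg \<gamma>) auto
    also have "\<dots> \<le> real (2 ^ j) powr max 0 (1 - \<gamma>) * wmass (X \<kappa>) powr \<gamma>"
      using sum_col_mass \<gamma> by (intro mult_left_mono powr_mono2 sum_nonneg wmass_nonneg) auto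
    finally show "(\<Sum>i<2 ^ j. wmass (colset (j, \<kappa>, i)) powr \<gamma>) \<le> \<dots>" .
  qed
  also have "(real (2 ^ j) powr max 0 (1 - \<gamma>) * wmass (X \<kappa>) powr \<gamma>) * D =
      (real (2 ^ j) powr max 0 (1 - \<gamma>) / (2 ^ j) powr (\<alpha> / q) / (\<rho> ^ j) powr \<alpha>) * (wmass (X \<kappa>) powr \<gamma> * H \<kappa> powr (\<alpha> / q))"
    using H[of \<kappa>] by (simp add: D_def powr_divide)
  also have "real (2 ^ j) powr max 0 (1 - \<gamma>) / (2 ^ j) powr (\<alpha> / q) / (\<rho> ^ j) powr \<alpha> =
      (2 powr (- (dyadic_decay p \<alpha> / 2))) ^ j"
  proof -
    have "(\<rho> ^ j) powr \<alpha> = (\<rho> powr \<alpha>) ^ j"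
      using rho by (simp add: powr_powr mult.commute flip: powr_realpow)
    also have "\<dots> = 2 powr (- (dyadic_decay p \<alpha> / 2) * j)"
      unfolding level_weight(3)[OF p \<alpha>] by (simp add: powr_powr flip: powr_realpow)
    finally have 1: "(\<rho> ^ j) powr \<alpha> = 2 powr (- (dyadic_decay p \<alpha> / 2) * j)" .
    have 2: "(2 ^ j :: real) powr s = 2 powr (s * j)" for s
      by (simp add: powr_powr mult.commute flip: powr_realpow)
    have "max 0 (1 - \<gamma>) = \<alpha> / q - dyadic_decay p \<alpha>"
      by (simp add: dyadic_decay_def q_def \<gamma>_def)
    then have 3: "real (2 ^ j) powr max 0 (1 - \<gamma>) = 2 powr ((\<alpha> / q - dyadic_decay p \<alpha>) * j)"
      using 2 by simp
    have "2 powr x / 2 powr y / 2 powr z = (2 powr (x - y - z) :: real)" for x y z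
      by (simp add: powr_diff)
    then have "real (2 ^ j) powr max 0 (1 - \<gamma>) / (2 ^ j) powr (\<alpha> / q) / (\<rho> ^ j) powr \<alpha> =
        2 powr ((\<alpha> / q - dyadic_decay p \<alpha>) * j - \<alpha> / q * j - (- (dyadic_decay p \<alpha> / 2) * j))"
      unfolding 1 3 2 by simp
    also have "(\<alpha> / q - dyadic_decay p \<alpha>) * j - \<alpha> / q * j - (- (dyadic_decay p \<alpha> / 2) * j) =
        - (dyadic_decay p \<alpha> / 2) * j" by (simp add: algebra_simps)
    also have "2 powr (- (dyadic_decay p \<alpha> / 2) * j) = (2 powr (- (dyadic_decay p \<alpha> / 2))) ^ j"
      by (simp add: powr_powr flip: powr_realpow)
    finally show ?thesis .
  qed
  finally show ?thesis
    by (simp add: \<gamma>_def q_def ennreal_mult)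
qed

lemma sum_tval:
  "(\<integral>\<^sup>+k. ennreal (tval k powr \<alpha>) \<partial>count_space UNIV) \<le>
    ennreal (1 / (1 - 2 powr (- (dyadic_decay p \<alpha> / 2)))) *
    (\<integral>\<^sup>+\<kappa>. ennreal (wmass (X \<kappa>) powr (\<alpha> / p) * H \<kappa> powr (\<alpha> / conj_exp p)) \<partial>count_space UNIV)"
    (is "_ \<le> _ * ?S")
proof -
  define z where "z = 2 powr (- (dyadic_decay p \<alpha> / 2))"
  have "z < 2 powr (0::real)"
    unfolding z_def using dyadic_decay_pos[OF p \<alpha>] by (intro powr_less_mono) auto
  then have z: "0 \<le> z" "z < 1" by (simp_all add: z_def)
  have "(\<integral>\<^sup>+k. ennreal (tval k powr \<alpha>) \<partial>count_space UNIV) =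
      (\<integral>\<^sup>+j. \<integral>\<^sup>+\<kappa>. \<integral>\<^sup>+i. ennreal (tval (j, \<kappa>, i) powr \<alpha>) \<partial>count_space UNIV \<partial>count_space UNIV \<partial>count_space UNIV)"
    by (rule sum_triple)
  also have "\<dots> \<le> (\<integral>\<^sup>+j. \<integral>\<^sup>+\<kappa>. ennreal (z ^ j) * ennreal (wmass (X \<kappa>) powr (\<alpha> / p) * H \<kappa> powr (\<alpha> / conj_exp p))
      \<partial>count_space UNIV \<partial>count_space UNIV)"
    unfolding z_def by (intro nn_integral_mono sum_level)
  also have "\<dots> = (\<integral>\<^sup>+j. ennreal (z ^ j) \<partial>count_space UNIV) * ?S"
    by (simp add: nn_integral_cmult nn_integral_multc)
  also have "(\<integral>\<^sup>+j. ennreal (z ^ j) \<partial>count_space UNIV) = ennreal (1 / (1 - z))"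
    unfolding nn_integral_count_space_nat using z geometric_sums[of z]
    by (intro suminf_ennreal_eq) auto
  finally show ?thesis by (simp add: z_def)
qed

theorem sum_approx_numbers_triangles:
  assumes \<Omega>: "\<And>x. \<Omega> x \<in> sets M"
    and \<Omega>_finite: "AE x in M. (\<integral>\<^sup>+y. indicator (\<Omega> x) y * ennreal (\<bar>v y\<bar> powr conj_exp p) \<partial>M) < top"
    and disjoint: "\<And>\<kappa> \<mu> x y. x \<in> X \<kappa> \<Longrightarrow> y \<in> Z \<kappa> \<Longrightarrow> d \<kappa> x < c \<kappa> y \<Longrightarrow> x \<in> X \<mu> \<Longrightarrow> y \<in> Z \<mu> \<Longrightarrow> d \<mu> x < c \<mu> y \<Longrightarrow> \<kappa> = \<mu>"
    and cover: "AE x in M. AE y in M. v y \<noteq> 0 \<longrightarrow> y \<in> \<Omega> x \<longleftrightarrow> (\<exists>\<kappa>. x \<in> X \<kappa> \<and> y \<in> Z \<kappa> \<and> d \<kappa> x < c \<kappa> y)"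
    and T: "\<And>f. f \<in> Lp_space M p \<Longrightarrow> AE x in M. T f x = w x * (\<integral>y. f y * (indicator (\<Omega> x) y * v y) \<partial>M)"
  shows "(\<Sum>n. epowr (approx_number M p T (Suc n)) \<alpha>) \<le> ennreal (dyadic_const p \<alpha>) *
    (\<integral>\<^sup>+\<kappa>. ennreal (wmass (X \<kappa>) powr (\<alpha> / p) * H \<kappa> powr (\<alpha> / conj_exp p)) \<partial>count_space UNIV)"
proof -
  have inf: "infinite (UNIV :: (nat \<times> 'c \<times> nat) set)"
    using finite_prod infinite_UNIV_nat by metis
  have triangle: "(\<exists>k. x \<in> colset k \<and> y \<in> rowset k) \<longleftrightarrow> (\<exists>\<kappa>. x \<in> X \<kappa> \<and> y \<in> Z \<kappa> \<and> d \<kappa> x < c \<kappa> y)" for x y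
  proof
    assume "\<exists>\<kappa>. x \<in> X \<kappa> \<and> y \<in> Z \<kappa> \<and> d \<kappa> x < c \<kappa> y"
    then obtain \<kappa> where \<kappa>: "x \<in> X \<kappa>" "y \<in> Z \<kappa>" "d \<kappa> x < c \<kappa> y" by blast
    then obtain j i where "\<lfloor>2 ^ j * d \<kappa> x\<rfloor> = int (2 * i)" "\<lfloor>2 ^ j * c \<kappa> y\<rfloor> = int (2 * i + 1)"
      using dyadic_separation_ex[of "d \<kappa> x" "c \<kappa> y"] d_nonneg c_le_1 by blast
    then show "\<exists>k. x \<in> colset k \<and> y \<in> rowset k"
      using \<kappa> by (intro exI[of _ "(j, \<kappa>, i)"]) (simp add: colset_def rowset_def)
  qed (force simp: colset_def rowset_def intro: dyadic_separation_less)
  have "(\<Sum>n. epowr (approx_number M p T (Suc n)) \<alpha>)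
    \<le> ennreal ((2 * overlap_const p \<alpha>) powr \<alpha>) * (\<integral>\<^sup>+k. ennreal (tval k powr \<alpha>) \<partial>count_space UNIV)"
  proof (rule blocks.sum_approx_numbers_le[OF _ inf \<Omega> \<Omega>_finite _ _ T])
    show "0 < \<alpha>" using \<alpha> by simp
    show "AE x in M. AE y in M. v y \<noteq> 0 \<longrightarrow> y \<in> \<Omega> x \<longleftrightarrow> (\<exists>k. x \<in> colset k \<and> y \<in> rowset k)"
      unfolding triangle by (rule cover)
  next
    fix k l x y assume *: "x \<in> colset k" "y \<in> rowset k" "x \<in> colset l" "y \<in> rowset l"
    obtain j \<kappa> i where k: "k = (j, \<kappa>, i)" by (cases k)
    obtain j' \<mu> i' where l: "l = (j', \<mu>, i')" by (cases l)
    have ki: "x \<in> X \<kappa>" "y \<in> Z \<kappa>" "\<lfloor>2 ^ j * d \<kappa> x\<rfloor> = int (2 * i)" "\<lfloor>2 ^ j * c \<kappa> y\<rfloor> = int (2 * i + 1)"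
      and li: "x \<in> X \<mu>" "y \<in> Z \<mu>" "\<lfloor>2 ^ j' * d \<mu> x\<rfloor> = int (2 * i')" "\<lfloor>2 ^ j' * c \<mu> y\<rfloor> = int (2 * i' + 1)"
      using * by (simp_all add: k l colset_def rowset_def)
    have "\<kappa> = \<mu>" by (rule disjoint[OF ki(1,2) dyadic_separation_less[OF ki(3,4)] li(1,2) dyadic_separation_less[OF li(3,4)]])
    moreover have "j = j' \<and> i = i'"
      by (rule dyadic_separation_unique[OF ki(3,4)]) (use li \<open>\<kappa> = \<mu>\<close> in auto)
    ultimately show "k = l" by (simp add: k l)
  qed
  also have "\<dots> \<le> ennreal ((2 * overlap_const p \<alpha>) powr \<alpha>) *
     (ennreal (1 / (1 - 2 powr (- (dyadic_decay p \<alpha> / 2)))) *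
      (\<integral>\<^sup>+\<kappa>. ennreal (wmass (X \<kappa>) powr (\<alpha> / p) * H \<kappa> powr (\<alpha> / conj_exp p)) \<partial>count_space UNIV))"
    by (intro mult_left_mono sum_tval) simp
  also have "\<dots> = ennreal (dyadic_const p \<alpha>) *
    (\<integral>\<^sup>+\<kappa>. ennreal (wmass (X \<kappa>) powr (\<alpha> / p) * H \<kappa> powr (\<alpha> / conj_exp p)) \<partial>count_space UNIV)"
  proof -
    have "2 powr (- (dyadic_decay p \<alpha> / 2)) < 2 powr (0::real)"
      using dyadic_decay_pos[OF p \<alpha>] by (intro powr_less_mono) auto
    then show ?thesis by (simp add: dyadic_const_def flip: mult.assoc ennreal_mult)
  qed
  finally show ?thesis .
qed

end

section \<open>Weights as differences of an antiderivative\<close>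

text \<open>All masses become differences of values of one continuous increasing function, so that inequalities
  between masses of adjacent intervals turn into linear arithmetic.\<close>

lemma ex_weight_antiderivative:
  fixes u :: "real \<Rightarrow> real"
  assumes q: "0 < q" and u: "\<And>x. 0 \<le> x \<Longrightarrow> 0 \<le> u x" "u \<in> Lp_loc {0<..} q"
  obtains F where "continuous_on {0<..} F"
    "\<And>c d. 0 < c \<Longrightarrow> c \<le> d \<Longrightarrow> F c \<le> F d"
    "\<And>c d. 0 < c \<Longrightarrow> c \<le> d \<Longrightarrow> weight_integral u q c d = ennreal (F d - F c)"
proof -
  define g where "g y = u y powr q" for y
  have g0: "0 \<le> g y" for y by (simp add: g_def)
  have int: "integrable (lebesgue_on {c..d}) g" if "0 < c" for c d
  proof (rule integrableI_bounded)
    have "u \<in> Lp_space (lebesgue_on {c..d}) q"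
    proof -
      have "compact {c..d}" "{c..d} \<subseteq> {0<..}" using that by auto
      then show ?thesis using u(2) unfolding Lp_loc_def by blast
    qed
    then have 1: "u \<in> borel_measurable (lebesgue_on {c..d})"
      "(\<integral>\<^sup>+x. ennreal (\<bar>u x\<bar> powr q) \<partial>lebesgue_on {c..d}) < top"
      using q by (auto simp: Lp_space_iff)
    show "g \<in> borel_measurable (lebesgue_on {c..d})"
      unfolding g_def using 1(1) by measurable
    have "(\<integral>\<^sup>+x. ennreal (norm (g x)) \<partial>lebesgue_on {c..d}) = (\<integral>\<^sup>+x. ennreal (\<bar>u x\<bar> powr q) \<partial>lebesgue_on {c..d})"
      using u(1) that by (intro nn_integral_cong) (auto simp: g_def)
    then show "(\<integral>\<^sup>+x. ennreal (norm (g x)) \<partial>lebesgue_on {c..d}) < \<infinity>" using 1 by simp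
  qed
  have HK: "g integrable_on {c..d}" if "0 < c" for c d
    using int[OF that, of d] by (intro integrable_on_lebesgue_on) auto
  have wi: "weight_integral u q c d = ennreal (integral {c..d} g)" if "0 < c" for c d
  proof -
    have "weight_integral u q c d = (\<integral>\<^sup>+y. ennreal (g y) \<partial>lebesgue_on {c..d})"
      unfolding weight_integral_def g_def by (subst nn_integral_restrict_space) auto
    also have "\<dots> = ennreal (LINT y|lebesgue_on {c..d}. g y)"
      using int[OF that] g0 by (intro nn_integral_eq_integral) auto
    also have "(LINT y|lebesgue_on {c..d}. g y) = integral {c..d} g"
      using int[OF that] by (intro lebesgue_integral_eq_integral) auto
    finally show ?thesis .
  qed
  define F where "F y = (if 1 \<le> y then integral {1..y} g else - integral {y..1} g)" for y
  have diff: "F d - F c = integral {c..d} g" if cd: "0 < c" "c \<le> d" for c d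
  proof -
    have comb: "integral {x..y} g + integral {y..z} g = integral {x..z} g" if "0 < x" "x \<le> y" "y \<le> z" for x y z
      using that HK by (intro Henstock_Kurzweil_Integration.integral_combine) auto
    consider "1 \<le> c" | "c < 1" "1 \<le> d" | "d < 1" by linarith
    then show ?thesis
    proof cases
      case 1 then show ?thesis using cd comb[of 1 c d] by (simp add: F_def)
    next
      case 2 then show ?thesis using cd comb[of c 1 d] by (simp add: F_def)
    next
      case 3 then show ?thesis using cd comb[of c d 1] by (simp add: F_def)
    qed
  qed
  show ?thesis
  proof (rule that[of F])
    show "weight_integral u q c d = ennreal (F d - F c)" if "0 < c" "c \<le> d" for c d
      using wi diff that by simp
    show "F c \<le> F d" if "0 < c" "c \<le> d" for c d
      using diff[OF that] Henstock_Kurzweil_Integration.integral_nonneg[OF HK[OF that(1)], of d] g0 by simp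
    show "continuous_on {0<..} F"
      unfolding continuous_on_eq_continuous_at[OF open_greaterThan]
    proof
      fix y :: real assume "y \<in> {0<..}"
      then have y: "0 < y" by simp
      have "continuous_on {y/2..2*y} (\<lambda>x. F (y/2) + integral {y/2..x} g)"
        using HK[of "y/2" "2*y"] y by (intro continuous_intros indefinite_integral_continuous_1) auto
      moreover have "F (y/2) + integral {y/2..x} g = F x" if "x \<in> {y/2..2*y}" for x
        using diff[of "y/2" x] y that by simp
      ultimately have "continuous_on {y/2..2*y} F"
        by (rule continuous_on_eq)
      then show "isCont F y"
        using y by (intro continuous_on_interior) auto
    qed
  qed
qed

lemma increasing_onto_half_line:
  fixes f :: "real \<Rightarrow> real"
  assumes "continuous_on {0<..} f" "strict_mono_on {0<..} f" "(f \<longlongrightarrow> 0) (at_right 0)"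
    and "filterlim f at_top at_top"
  shows "0 < x \<Longrightarrow> 0 < f x" and "0 < t \<Longrightarrow> \<exists>x>0. f x = t"
proof -
  have pos: "0 \<le> f x" if "0 < x" for x
  proof (rule tendsto_upperbound[OF assms(3)])
    have "f z \<le> f x" if "0 < z" "z < x" for z
      using assms(2) that \<open>0 < x\<close> by (auto simp: strict_mono_on_def intro: less_imp_le)
    then show "\<forall>\<^sub>F z in at_right 0. f z \<le> f x"
      using that by (auto simp: eventually_at_right_field)
  qed simp
  show "0 < f x" if "0 < x"
  proof -
    have "f (x / 2) < f x" using assms(2) that by (auto simp: strict_mono_on_def)
    then show ?thesis using pos[of "x / 2"] that by simp
  qed
  show "\<exists>x>0. f x = t" if t: "0 < t"
  proof -
    have "\<forall>\<^sub>F z in at_right 0. f z < t" using order_tendstoD(2)[OF assms(3) t] .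
    then obtain x1 where x1: "0 < x1" "f x1 < t"
      by (auto simp: eventually_at_right_field dest: dense)
    have "\<forall>\<^sub>F z in at_top. t \<le> f z \<and> x1 \<le> z"
      using assms(4) by (intro eventually_conj) (auto simp: filterlim_at_top eventually_ge_at_top)
    then obtain x2 where x2: "t \<le> f x2" "x1 \<le> x2"
      using eventually_happens'[OF trivial_limit_at_top_linorder] by blast
    have "\<exists>x\<ge>x1. x \<le> x2 \<and> f x = t"
      using x1 x2 assms(1) by (intro IVT') (auto intro: continuous_on_subset)
    then show ?thesis using x1 by (auto intro: less_le_trans)
  qed
qed

section \<open>A partition adapted to the fairway\<close>

locale fairway_data =
  fixes p \<alpha> :: real and a b v w \<sigma> :: "real \<Rightarrow> real"
  assumes p: "1 < p" and \<alpha>: "1 < \<alpha>"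
    and boundary: "boundary_functions a b"
    and v_nonneg: "\<And>x. 0 \<le> x \<Longrightarrow> 0 \<le> v x" and w_nonneg: "\<And>x. 0 \<le> x \<Longrightarrow> 0 \<le> w x"
    and v_loc: "v \<in> Lp_loc {0<..} (conj_exp p)" and w_loc: "w \<in> Lp_loc {0<..} p"
    and fairway: "fairway p a b v \<sigma>"
begin

lemma a_continuous: "continuous_on {0<..} a" and b_continuous: "continuous_on {0<..} b"
  using boundary by (auto simp: boundary_functions_def differentiable_imp_continuous_on)

lemma a_strict_mono: "strict_mono_on {0<..} a" and b_strict_mono: "strict_mono_on {0<..} b"
  and \<sigma>_strict_mono: "strict_mono_on {0<..} \<sigma>"
  using boundary fairway unfolding boundary_functions_def fairway_def by blast+

lemma a_less: "0 < x \<Longrightarrow> x < y \<Longrightarrow> a x < a y"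
  by (rule strict_mono_onD[OF a_strict_mono]) auto

lemma b_less: "0 < x \<Longrightarrow> x < y \<Longrightarrow> b x < b y"
  by (rule strict_mono_onD[OF b_strict_mono]) auto

lemma \<sigma>_less: "0 < x \<Longrightarrow> x < y \<Longrightarrow> \<sigma> x < \<sigma> y"
  by (rule strict_mono_onD[OF \<sigma>_strict_mono]) auto

lemma a_le: "0 < x \<Longrightarrow> x \<le> y \<Longrightarrow> a x \<le> a y"
  using a_less[of x y] by (cases "x = y") auto

lemma b_le: "0 < x \<Longrightarrow> x \<le> y \<Longrightarrow> b x \<le> b y"
  using b_less[of x y] by (cases "x = y") auto

lemma \<sigma>_le: "0 < x \<Longrightarrow> x \<le> y \<Longrightarrow> \<sigma> x \<le> \<sigma> y"
  using \<sigma>_less[of x y] by (cases "x = y") auto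

lemma boundary_limits:
  "(a \<longlongrightarrow> 0) (at_right 0)" "filterlim a at_top at_top"
  "(b \<longlongrightarrow> 0) (at_right 0)" "filterlim b at_top at_top"
  using boundary unfolding boundary_functions_def by blast+

lemmas a_pos = increasing_onto_half_line(1)[OF a_continuous a_strict_mono boundary_limits(1,2)]
lemmas a_onto = increasing_onto_half_line(2)[OF a_continuous a_strict_mono boundary_limits(1,2)]
lemmas b_pos = increasing_onto_half_line(1)[OF b_continuous b_strict_mono boundary_limits(3,4)]
lemmas b_onto = increasing_onto_half_line(2)[OF b_continuous b_strict_mono boundary_limits(3,4)]

lemma \<sigma>_between: "0 < x \<Longrightarrow> a x < \<sigma> x" "0 < x \<Longrightarrow> \<sigma> x < b x"
  using fairway unfolding fairway_def by blast+

lemma \<sigma>_pos: "0 < x \<Longrightarrow> 0 < \<sigma> x"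
  using \<sigma>_between[of x] a_pos[of x] by simp

lemma \<sigma>_bij: "bij_betw \<sigma> {0<..} {0<..}"
  using fairway unfolding fairway_def by blast

lemma \<sigma>_onto: "0 < t \<Longrightarrow> \<exists>x>0. \<sigma> x = t"
  using bij_betw_imp_surj_on[OF \<sigma>_bij] by (metis greaterThan_iff imageE)

lemma pos_inv:
  assumes "\<exists>x>0. f x = (t::real)"
  shows "0 < pos_inv f t" "f (pos_inv f t) = t"
proof -
  have t: "t \<in> f ` {0<..}" using assms by auto
  show "f (pos_inv f t) = t" unfolding pos_inv_def by (rule f_inv_into_f[OF t])
  show "0 < pos_inv f t" using inv_into_into[OF t] by (simp add: pos_inv_def)
qed

lemmas a_pos_inv = pos_inv[OF a_onto] and b_pos_inv = pos_inv[OF b_onto]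

lemma \<sigma>_pos_inv: "0 < x \<Longrightarrow> pos_inv \<sigma> (\<sigma> x) = x"
  using bij_betw_imp_inj_on[OF \<sigma>_bij] by (simp add: pos_inv_def)

text \<open>From \<open>x\<close> one moves along the fairway curve to the nearest point \<open>y\<close> where the curve leaves either the
  vertical section \<open>(a x, b x)\<close> at its upper end, \<open>\<sigma> y = b x\<close>, or the horizontal section at height \<open>\<sigma> x\<close> at its
  right end, \<open>a y = \<sigma> x\<close>. The rectangle with opposite corners \<open>(x, \<sigma> x)\<close> and \<open>(y, \<sigma> y)\<close> then
  lies in the closed region between \<open>a\<close> and \<open>b\<close>.\<close>

definition step :: "real \<Rightarrow> real \<Rightarrow> bool" where
  "step x y \<longleftrightarrow> 0 < x \<and> x < y \<and> \<sigma> y \<le> b x \<and> a y \<le> \<sigma> x \<and> (\<sigma> y = b x \<or> a y = \<sigma> x)"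

lemma step_forward:
  assumes x: "0 < x" shows "\<exists>y. step x y"
proof -
  obtain y where y: "0 < y" "\<sigma> y = b x" using \<sigma>_onto[OF b_pos[OF x]] by blast
  obtain z where z: "0 < z" "a z = \<sigma> x" using a_onto[OF \<sigma>_pos[OF x]] by blast
  have xy: "x < y" using \<sigma>_le[of y x] \<sigma>_between[OF x] y by (cases "y \<le> x") auto
  have xz: "x < z" using a_le[of z x] \<sigma>_between[OF x] z by (cases "z \<le> x") auto
  show ?thesis
  proof (cases "y \<le> z")
    case True
    then have "step x y" using x y z xy a_le[of y z] by (auto simp: step_def)
    then show ?thesis ..
  next
    case False
    then have "step x z" using x y z xz \<sigma>_le[of z y] by (auto simp: step_def)
    then show ?thesis ..
  qed
qed

lemma step_backward:
  assumes x: "0 < x" shows "\<exists>y. step y x"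
proof -
  obtain y where y: "0 < y" "b y = \<sigma> x" using b_onto[OF \<sigma>_pos[OF x]] by blast
  obtain z where z: "0 < z" "\<sigma> z = a x" using \<sigma>_onto[OF a_pos[OF x]] by blast
  have xy: "y < x" using b_le[of x y] \<sigma>_between[OF x] x y by (cases "x \<le> y") auto
  have xz: "z < x" using \<sigma>_le[of x z] \<sigma>_between[OF x] x z by (cases "x \<le> z") auto
  show ?thesis
  proof (cases "z \<le> y")
    case True
    then have "step y x" using x y z xy \<sigma>_le[of z y] by (auto simp: step_def)
    then show ?thesis ..
  next
    case False
    then have "step z x" using x y z xz b_le[of y z] by (auto simp: step_def)
    then show ?thesis ..
  qed
qed

lemma ex_steps: "\<exists>\<eta> :: int \<Rightarrow> real. \<forall>k. step (\<eta> k) (\<eta> (k + 1))"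
proof -
  obtain f where f: "\<And>x. 0 < x \<Longrightarrow> step x (f x)" using step_forward by metis
  obtain g where g: "\<And>x. 0 < x \<Longrightarrow> step (g x) x" using step_backward by metis
  have fp: "0 < (f ^^ n) 1" for n
  proof (induction n)
    case (Suc n) then show ?case using f[of "(f ^^ n) 1"] by (simp add: step_def)
  qed simp
  have gp: "0 < (g ^^ n) 1" for n
  proof (induction n)
    case (Suc n) then show ?case using g[of "(g ^^ n) 1"] by (simp add: step_def)
  qed simp
  define \<eta> where "\<eta> k = (if 0 \<le> k then (f ^^ nat k) 1 else (g ^^ nat (- k)) 1)" for k :: int
  have "step (\<eta> k) (\<eta> (k + 1))" for k
  proof (cases "0 \<le> k")
    case True
    then have "nat (k + 1) = Suc (nat k)" by simp
    then show ?thesis using True f[OF fp[of "nat k"]] by (simp add: \<eta>_def)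
  next
    case False
    then have k: "nat (- k) = Suc (nat (- (k + 1)))" by simp
    have "\<eta> (k + 1) = (g ^^ nat (- (k + 1))) 1"
      using False by (cases "k = -1") (auto simp: \<eta>_def)
    then show ?thesis using False g[OF gp[of "nat (- (k + 1))"]] k by (simp add: \<eta>_def)
  qed
  then show ?thesis by blast
qed

text \<open>A sequence of consecutive steps, infinite in both directions; it partitions the half-line.\<close>

definition \<eta> :: "int \<Rightarrow> real" where
  "\<eta> = (SOME \<eta>. \<forall>k. step (\<eta> k) (\<eta> (k + 1)))"

lemma \<eta>_step: "step (\<eta> k) (\<eta> (k + 1))"
  using someI_ex[OF ex_steps] unfolding \<eta>_def by blast

lemma \<eta>_pos: "0 < \<eta> k"
  using \<eta>_step[of k] by (simp add: step_def)

lemma \<eta>_less: "k < l \<Longrightarrow> \<eta> k < \<eta> l"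
proof (induction l rule: int_gr_induct)
  case base
  then show ?case using \<eta>_step[of k] by (simp add: step_def)
next
  case (step l)
  then show ?case using \<eta>_step[of l] by (simp add: step_def)
qed

lemma \<eta>_le: "k \<le> l \<Longrightarrow> \<eta> k \<le> \<eta> l"
  using \<eta>_less[of k l] by (cases "k = l") auto

lemma \<eta>_unbounded: "\<exists>k. L < \<eta> k"
proof (rule ccontr)
  assume "\<not> ?thesis"
  then have bdd: "bdd_above (range \<eta>)" by (auto simp: bdd_above_def not_less)
  define S where "S = Sup (range \<eta>)"
  have le: "\<eta> k \<le> S" for k unfolding S_def using bdd by (intro cSup_upper) auto
  have S: "0 < S" using \<eta>_pos[of 0] le[of 0] by simp
  \<comment> \<open>Close to a finite limit S either kind of step would overshoot S.\<close>
  have "\<sigma> S < b S" using \<sigma>_between S by simp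
  moreover have "isCont b S"
    using b_continuous S by (simp add: continuous_on_eq_continuous_at)
  ultimately have "\<forall>\<^sub>F x in at S. \<sigma> S < b x" by (intro order_tendstoD(1)) (auto simp: isCont_def)
  then obtain \<delta> where \<delta>: "0 < \<delta>" "\<And>x. x \<noteq> S \<Longrightarrow> dist x S < \<delta> \<Longrightarrow> \<sigma> S < b x"
    by (auto simp: eventually_at)
  obtain t where t: "max 0 (a S) < t" "t < \<sigma> S"
    using dense[of "max 0 (a S)" "\<sigma> S"] \<sigma>_between(1)[OF S] \<sigma>_pos[OF S] by auto
  then obtain z where z: "0 < z" "\<sigma> z = t" using \<sigma>_onto[of t] by auto
  have "z < S" using \<sigma>_le[OF S, of z] t z by (cases "S \<le> z") auto
  then have "max z (S - \<delta>) < S" using \<delta> by simp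
  then obtain k where k: "max z (S - \<delta>) < \<eta> k"
    unfolding S_def using bdd by (subst (asm) less_cSup_iff) auto
  have kS: "\<eta> k < S" using \<eta>_less[of k "k + 1"] le[of "k + 1"] by simp
  have "\<sigma> S < b (\<eta> k)" using k kS by (intro \<delta>) (auto simp: dist_real_def)
  moreover have "a S < \<sigma> (\<eta> k)" using \<sigma>_less[OF z(1), of "\<eta> k"] k z t by simp
  moreover have "\<sigma> (\<eta> (k + 1)) \<le> \<sigma> S" "a (\<eta> (k + 1)) \<le> a S"
    using \<sigma>_le a_le \<eta>_pos le by blast+
  ultimately show False using \<eta>_step[of k] by (auto simp: step_def)
qed

lemma \<eta>_near_0:
  assumes L: "0 < L" shows "\<exists>k. \<eta> k < L"
proof (rule ccontr)
  assume "\<not> ?thesis"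
  then have ge: "L \<le> \<eta> k" for k by (auto simp: not_less)
  then have bdd: "bdd_below (range \<eta>)" by (auto simp: bdd_below_def)
  define S where "S = Inf (range \<eta>)"
  have le: "S \<le> \<eta> k" for k unfolding S_def using bdd by (intro cInf_lower) auto
  have "L \<le> S" unfolding S_def using ge by (intro cInf_greatest) auto
  then have S: "0 < S" using L by simp
  have "a S < \<sigma> S" using \<sigma>_between S by simp
  moreover have "isCont a S"
    using a_continuous S by (simp add: continuous_on_eq_continuous_at)
  ultimately have "\<forall>\<^sub>F x in at S. a x < \<sigma> S" by (intro order_tendstoD(2)) (auto simp: isCont_def)
  then obtain \<delta> where \<delta>: "0 < \<delta>" "\<And>x. x \<noteq> S \<Longrightarrow> dist x S < \<delta> \<Longrightarrow> a x < \<sigma> S"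
    by (auto simp: eventually_at)
  obtain t where t: "\<sigma> S < t" "t < b S"
    using dense \<sigma>_between(2)[OF S] by blast
  then obtain z where z: "0 < z" "\<sigma> z = t" using \<sigma>_onto[of t] \<sigma>_pos[OF S] by auto
  have "S < z" using \<sigma>_le[OF z(1), of S] t z by (cases "z \<le> S") auto
  then have "S < min z (S + \<delta>)" using \<delta> by simp
  then obtain k where k: "\<eta> k < min z (S + \<delta>)"
    unfolding S_def using bdd by (subst (asm) cInf_less_iff) auto
  have kS: "S < \<eta> k" using \<eta>_less[of "k - 1" k] le[of "k - 1"] by simp
  have "a (\<eta> k) < \<sigma> S" using k kS by (intro \<delta>) (auto simp: dist_real_def)
  moreover have "\<sigma> (\<eta> k) < b S" using \<sigma>_less[of "\<eta> k" z] \<eta>_pos[of k] k z t by simp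
  moreover have "\<sigma> S \<le> \<sigma> (\<eta> (k - 1))" "b S \<le> b (\<eta> (k - 1))"
    using \<sigma>_le b_le S le by blast+
  ultimately show False using \<eta>_step[of "k - 1"] by (auto simp: step_def)
qed

lemma ex_cell:
  assumes x: "0 < x" shows "\<exists>k. \<eta> k \<le> x \<and> x < \<eta> (k + 1)"
proof -
  obtain k0 where k0: "\<eta> k0 < x" using \<eta>_near_0[OF x] by blast
  obtain k1 where k1: "x < \<eta> k1" using \<eta>_unbounded by blast
  have "k \<le> k1" if "\<eta> k \<le> x" for k
    using \<eta>_le[of k1 k] that k1 by (cases "k \<le> k1") auto
  then have fin: "finite {k. k0 \<le> k \<and> \<eta> k \<le> x}"
    by (auto intro: finite_subset[of _ "{k0..k1}"])
  define k where "k = Max {k. k0 \<le> k \<and> \<eta> k \<le> x}"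
  have "k \<in> {k. k0 \<le> k \<and> \<eta> k \<le> x}" unfolding k_def using fin k0 by (intro Max_in) auto
  moreover have "k + 1 \<notin> {k. k0 \<le> k \<and> \<eta> k \<le> x}"
    using Max_ge[OF fin, of "k + 1"] by (auto simp flip: k_def)
  ultimately show ?thesis by (intro exI[of _ k]) auto
qed

lemma cell_unique: "\<eta> k \<le> x \<Longrightarrow> x < \<eta> (k + 1) \<Longrightarrow> \<eta> l \<le> x \<Longrightarrow> x < \<eta> (l + 1) \<Longrightarrow> k = l"
  using \<eta>_le[of "k + 1" l] \<eta>_le[of "l + 1" k] by linarith

end

section \<open>Lebesgue measure on the half-line\<close>

lemma borel_measurable_half_line:
  fixes f :: "real \<Rightarrow> real"
  assumes "f \<in> borel_measurable (lebesgue_on {0<..})"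
  shows "f \<in> borel_measurable half_line"
proof -
  have positive: "(\<lambda>x. if x \<in> {0<..} then f x else 0) \<in> borel_measurable lebesgue"
    using assms by (subst borel_measurable_if) auto
  have "(\<lambda>x. if x = 0 then f 0 else if x \<in> {0<..} then f x else 0) \<in> borel_measurable lebesgue"
    by (rule measurable_If) (use positive in auto)
  then have "(\<lambda>x. if x = 0 then f 0 else if x \<in> {0<..} then f x else 0) \<in> borel_measurable half_line"
    unfolding half_line_def by (rule measurable_restrict_space1)
  then show ?thesis
    by (rule measurable_cong[THEN iffD1, rotated]) (auto simp: half_line_def)
qed

lemma borel_measurable_half_line_continuous:
  fixes f :: "real \<Rightarrow> real"
  shows "continuous_on {0<..} f \<Longrightarrow> f \<in> borel_measurable half_line"
  by (intro borel_measurable_half_line continuous_imp_measurable_on_sets_lebesgue) auto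

lemma AE_half_line_neq: "AE x in half_line. x \<noteq> c"
  unfolding half_line_def
  by (subst AE_restrict_space_iff) (auto intro!: AE_completion AE_lborel_singleton[THEN eventually_mono])

lemma AE_half_line_pos: "AE x in half_line. 0 < x"
  using AE_half_line_neq[of 0] AE_space[of half_line]
  by eventually_elim (auto simp: half_line_def)

lemma nn_integral_half_line:
  "(\<integral>\<^sup>+x. g x \<partial>half_line) = (\<integral>\<^sup>+x. g x * indicator {0..} x \<partial>lebesgue)"
  unfolding half_line_def by (rule nn_integral_restrict_space) simp

lemma set_nn_integral_half_line:
  "(\<integral>\<^sup>+x\<in>{0<..}. g x \<partial>lebesgue) = (\<integral>\<^sup>+x. g x \<partial>half_line)"
proof -
  have "AE x in lebesgue. (x::real) \<noteq> 0" by (intro AE_completion AE_lborel_singleton)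
  then show ?thesis
    unfolding nn_integral_half_line
    by (intro nn_integral_cong_AE) (auto elim!: eventually_mono split: split_indicator)
qed

lemma weight_integral_half_line:
  assumes u: "\<And>x. 0 \<le> x \<Longrightarrow> 0 \<le> u x" and "0 < c"
  shows "(\<integral>\<^sup>+y. indicator {c..d} y * ennreal (\<bar>u y\<bar> powr q) \<partial>half_line) = weight_integral u q c d"
    and "(\<integral>\<^sup>+y. indicator {c..<d} y * ennreal (\<bar>u y\<bar> powr q) \<partial>half_line) = weight_integral u q c d"
proof -
  show 1: "(\<integral>\<^sup>+y. indicator {c..d} y * ennreal (\<bar>u y\<bar> powr q) \<partial>half_line) = weight_integral u q c d"
    unfolding nn_integral_half_line weight_integral_def
    using assms by (intro nn_integral_cong) (auto split: split_indicator)
  have "(\<integral>\<^sup>+y. indicator {c..<d} y * ennreal (\<bar>u y\<bar> powr q) \<partial>half_line) =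
      (\<integral>\<^sup>+y. indicator {c..d} y * ennreal (\<bar>u y\<bar> powr q) \<partial>half_line)"
    by (intro nn_integral_cong_AE, use AE_half_line_neq[of d] in eventually_elim) (auto split: split_indicator)
  with 1 show "(\<integral>\<^sup>+y. indicator {c..<d} y * ennreal (\<bar>u y\<bar> powr q) \<partial>half_line) = weight_integral u q c d"
    by simp
qed

lemma weight_integral_mono:
  "c' \<le> c \<Longrightarrow> d \<le> d' \<Longrightarrow> weight_integral u q c d \<le> weight_integral u q c' d'"
  unfolding weight_integral_def by (intro nn_integral_mono) (auto split: split_indicator)

lemma Hardy_Steklov_half_line:
  assumes "0 < a x"
  shows "Hardy_Steklov a b v w f x = w x * (\<integral>y. f y * (indicator ({a x..b x} \<inter> {0..}) y * v y) \<partial>half_line)"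
proof -
  have "(\<integral>y. f y * (indicator ({a x..b x} \<inter> {0..}) y * v y) \<partial>half_line) =
      (\<integral>y. indicator {0..} y *\<^sub>R (f y * (indicator ({a x..b x} \<inter> {0..}) y * v y)) \<partial>lebesgue)"
    unfolding half_line_def by (rule integral_restrict_space) simp
  also have "\<dots> = (LINT y:{a x..b x}|lebesgue. f y * v y)"
    unfolding set_lebesgue_integral_def
    using assms by (intro Bochner_Integration.integral_cong) (auto split: split_indicator)
  finally show ?thesis by (simp add: Hardy_Steklov_def)
qed

section \<open>Mass distribution along the partition\<close>

context fairway_data
begin

abbreviation q :: real where "q \<equiv> conj_exp p"

lemma q_pos: "0 < q" using conj_exp_gt_0[OF p] .

text \<open>Antiderivatives of \<open>v powr q\<close> and of \<open>w powr p\<close>. Below, the \<open>v\<close>-mass and the \<open>w\<close>-mass of an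
  interval are the increments of \<open>F\<close> and of \<open>G\<close>.\<close>

definition F :: "real \<Rightarrow> real" where
  "F = (SOME F. continuous_on {0<..} F \<and> (\<forall>c d. 0 < c \<longrightarrow> c \<le> d \<longrightarrow> F c \<le> F d) \<and>
    (\<forall>c d. 0 < c \<longrightarrow> c \<le> d \<longrightarrow> weight_integral v q c d = ennreal (F d - F c)))"

definition G :: "real \<Rightarrow> real" where
  "G = (SOME G. \<forall>c d. 0 < c \<longrightarrow> c \<le> d \<longrightarrow> G c \<le> G d \<and> weight_integral w p c d = ennreal (G d - G c))"

lemma F: "continuous_on {0<..} F" "0 < c \<Longrightarrow> c \<le> d \<Longrightarrow> F c \<le> F d"
  "0 < c \<Longrightarrow> c \<le> d \<Longrightarrow> weight_integral v q c d = ennreal (F d - F c)"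
proof -
  have "\<exists>F. continuous_on {0<..} F \<and> (\<forall>c d. 0 < c \<longrightarrow> c \<le> d \<longrightarrow> F c \<le> F d) \<and>
    (\<forall>c d. 0 < c \<longrightarrow> c \<le> d \<longrightarrow> weight_integral v q c d = ennreal (F d - F c))"
    using ex_weight_antiderivative[OF q_pos v_nonneg v_loc] by metis
  from someI_ex[OF this] show "continuous_on {0<..} F" "0 < c \<Longrightarrow> c \<le> d \<Longrightarrow> F c \<le> F d"
    "0 < c \<Longrightarrow> c \<le> d \<Longrightarrow> weight_integral v q c d = ennreal (F d - F c)"
    unfolding F_def by blast+
qed

lemma G: "0 < c \<Longrightarrow> c \<le> d \<Longrightarrow> G c \<le> G d"
  "0 < c \<Longrightarrow> c \<le> d \<Longrightarrow> weight_integral w p c d = ennreal (G d - G c)"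
proof -
  have "0 < p" using p by simp
  have "\<exists>G. \<forall>c d. 0 < c \<longrightarrow> c \<le> d \<longrightarrow> G c \<le> G d \<and> weight_integral w p c d = ennreal (G d - G c)"
    using ex_weight_antiderivative[OF \<open>0 < p\<close> w_nonneg w_loc] by metis
  from someI_ex[OF this] show "0 < c \<Longrightarrow> c \<le> d \<Longrightarrow> G c \<le> G d"
    "0 < c \<Longrightarrow> c \<le> d \<Longrightarrow> weight_integral w p c d = ennreal (G d - G c)"
    unfolding G_def by blast+
qed

lemma v_measurable: "v \<in> borel_measurable half_line"
  using v_loc by (intro borel_measurable_half_line) (auto simp: Lp_loc_def)

lemma w_measurable: "w \<in> borel_measurable half_line"
  using w_loc by (intro borel_measurable_half_line) (auto simp: Lp_loc_def)

lemma F_measurable: "F \<in> borel_measurable half_line"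
  by (intro borel_measurable_half_line_continuous F)

lemma F_a_measurable: "(\<lambda>x. F (a x)) \<in> borel_measurable half_line"
  by (intro borel_measurable_half_line_continuous continuous_on_compose2[OF F(1) a_continuous])
    (auto intro: a_pos)

lemma F_b_measurable: "(\<lambda>x. F (b x)) \<in> borel_measurable half_line"
  by (intro borel_measurable_half_line_continuous continuous_on_compose2[OF F(1) b_continuous])
    (auto intro: b_pos)

text \<open>The antiderivative pushes the measure with density \<open>v powr q\<close> forward to Lebesgue measure. By
  compactness the level set lies between two of its own points.\<close>

lemma level_mass:
  assumes lo: "0 < lo" and z: "z \<le> z'"
  shows "(\<integral>\<^sup>+y. indicator {y \<in> {lo..hi}. z \<le> F y \<and> F y \<le> z'} y * ennreal (\<bar>v y\<bar> powr q) \<partial>half_line)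
    \<le> ennreal (z' - z)"
proof (cases "{y \<in> {lo..hi}. z \<le> F y \<and> F y \<le> z'} = {}")
  case False
  define S where "S = {y \<in> {lo..hi}. z \<le> F y \<and> F y \<le> z'}"
  have "continuous_on {lo..hi} F" using lo by (intro continuous_on_subset[OF F(1)]) auto
  then have "closed ({lo..hi} \<inter> F -` {z..z'})" by (intro continuous_closed_preimage) auto
  moreover have "{lo..hi} \<inter> F -` {z..z'} = S" by (auto simp: S_def)
  ultimately have "closed S" by simp
  moreover have "bounded S" by (rule bounded_subset[of "{lo..hi}"]) (auto simp: S_def)
  ultimately have "compact S" by (simp add: compact_eq_bounded_closed)
  then obtain y1 y2 where y: "y1 \<in> S" "\<And>y. y \<in> S \<Longrightarrow> y1 \<le> y" "y2 \<in> S" "\<And>y. y \<in> S \<Longrightarrow> y \<le> y2"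
    using compact_attains_inf[of S] compact_attains_sup[of S] False by (metis S_def)
  have y1: "0 < y1" "y1 \<le> y2" using y lo by (auto simp: S_def)
  have "(\<integral>\<^sup>+y. indicator S y * ennreal (\<bar>v y\<bar> powr q) \<partial>half_line) \<le>
      (\<integral>\<^sup>+y. indicator {y1..y2} y * ennreal (\<bar>v y\<bar> powr q) \<partial>half_line)"
    using y by (intro nn_integral_mono) (auto split: split_indicator)
  also have "\<dots> = weight_integral v q y1 y2"
    by (rule weight_integral_half_line(1)[OF v_nonneg y1(1)])
  also have "\<dots> = ennreal (F y2 - F y1)" using F(3) y1 by simp
  also have "\<dots> \<le> ennreal (z' - z)" using y(1,3) by (intro ennreal_leI) (auto simp: S_def)
  finally show ?thesis by (simp add: S_def)
qed (simp add: z)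

text \<open>This makes strict and non-strict inequalities between values of \<open>F\<close> interchangeable
  almost everywhere on the set where \<open>v\<close> does not vanish.\<close>

lemma AE_level_null:
  assumes lo: "0 < lo"
  shows "AE y in half_line. v y \<noteq> 0 \<longrightarrow> y \<in> {lo..hi} \<longrightarrow> F y \<noteq> z"
proof -
  note [measurable] = v_measurable F_measurable
  have [measurable]: "{lo..hi} \<inter> space half_line \<in> sets half_line"
    unfolding half_line_def by (auto simp: sets_restrict_space_iff space_restrict_space)
  define S where "S = {y \<in> {lo..hi}. z \<le> F y \<and> F y \<le> z}"
  have "S = ({lo..hi} \<inter> space half_line) \<inter> {y \<in> space half_line. z \<le> F y \<and> F y \<le> z}"
    using lo by (auto simp: S_def half_line_def)
  also have "\<dots> \<in> sets half_line" by measurable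
  finally have [measurable]: "S \<in> sets half_line" .
  have "(\<integral>\<^sup>+y. indicator S y * ennreal (\<bar>v y\<bar> powr q) \<partial>half_line) = 0"
    using level_mass[OF lo, of z z hi] by (simp add: S_def)
  then have "AE y in half_line. indicator S y * ennreal (\<bar>v y\<bar> powr q) = 0"
    by (subst (asm) nn_integral_0_iff_AE) auto
  then show ?thesis
    by eventually_elim (auto simp: S_def split: split_indicator_asm)
qed

lemma fair:
  assumes x: "0 < x" shows "F (\<sigma> x) - F (a x) = F (b x) - F (\<sigma> x)"
proof -
  have "weight_integral v q (a x) (\<sigma> x) = weight_integral v q (\<sigma> x) (b x)"
    using fairway x unfolding fairway_def by blast
  then show ?thesis
    using F(2,3)[of "a x" "\<sigma> x"] F(2,3)[of "\<sigma> x" "b x"] a_pos[OF x] \<sigma>_pos[OF x] \<sigma>_between[OF x] by simp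
qed

text \<open>By the fairway property, \<open>h k\<close> is half of the \<open>v\<close>-mass of the vertical section at \<open>\<eta> k\<close>, below
  or above the curve. The sides of the \<open>k\<close>th rectangle on the curve have \<open>v\<close>-mass \<open>u k\<close> and
  \<open>w\<close>-mass \<open>n k\<close>.\<close>

definition h :: "int \<Rightarrow> real" where "h k = F (\<sigma> (\<eta> k)) - F (a (\<eta> k))"
definition u :: "int \<Rightarrow> real" where "u k = F (\<sigma> (\<eta> (k + 1))) - F (\<sigma> (\<eta> k))"
definition n :: "int \<Rightarrow> real" where "n k = G (\<eta> (k + 1)) - G (\<eta> k)"

lemma h_eq: "h k = F (b (\<eta> k)) - F (\<sigma> (\<eta> k))"
  using fair[OF \<eta>_pos] by (simp add: h_def)

lemma h_nonneg: "0 \<le> h k"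
  using F(2)[of "a (\<eta> k)" "\<sigma> (\<eta> k)"] a_pos \<eta>_pos \<sigma>_between[of "\<eta> k"] by (auto simp: h_def)

lemma u_nonneg: "0 \<le> u k"
  using F(2)[of "\<sigma> (\<eta> k)" "\<sigma> (\<eta> (k + 1))"] \<sigma>_pos[OF \<eta>_pos, of k] \<sigma>_less[OF \<eta>_pos \<eta>_less, of k "k + 1"]
  by (simp add: u_def)

lemma n_nonneg: "0 \<le> n k"
  using G(1)[OF \<eta>_pos \<eta>_le, of k "k + 1"] by (simp add: n_def)

lemma F_a_mono: "0 < x \<Longrightarrow> x \<le> y \<Longrightarrow> F (a x) \<le> F (a y)"
  using F(2) a_pos a_le by simp

lemma F_b_mono: "0 < x \<Longrightarrow> x \<le> y \<Longrightarrow> F (b x) \<le> F (b y)"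
  using F(2) b_pos b_le by simp

lemma step_cases:
  obtains (up) "\<sigma> (\<eta> (k + 1)) = b (\<eta> k)" | (across) "a (\<eta> (k + 1)) = \<sigma> (\<eta> k)"
  using \<eta>_step[of k] by (auto simp: step_def)

lemma step_le: "\<sigma> (\<eta> (k + 1)) \<le> b (\<eta> k)" "a (\<eta> (k + 1)) \<le> \<sigma> (\<eta> k)"
  using \<eta>_step[of k] by (auto simp: step_def)

text \<open>A step upwards has \<open>u k = h k\<close>, a step across has \<open>u k = h (k + 1)\<close>. The other half mass cannot be
  much larger: it is contained in the full vertical section at the other end of the step.\<close>

lemma h_le_u: "h k \<le> 2 * u k" "h (k + 1) \<le> 2 * u k"
proof -
  have le: "\<eta> k \<le> \<eta> (k + 1)" by (rule \<eta>_le) simp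
  note mono = F_a_mono[OF \<eta>_pos le] F_b_mono[OF \<eta>_pos le]
  have "h k \<le> 2 * u k \<and> h (k + 1) \<le> 2 * u k"
  proof (cases k rule: step_cases)
    case up
    then show ?thesis using h_eq[of k] h_def[of k] h_def[of "k + 1"] h_nonneg[of k] mono by (simp add: u_def)
  next
    case across
    then show ?thesis using h_eq[of k] h_eq[of "k + 1"] h_def[of "k + 1"] h_nonneg[of "k + 1"] mono by (simp add: u_def)
  qed
  then show "h k \<le> 2 * u k" "h (k + 1) \<le> 2 * u k" by auto
qed

text \<open>Within one cell the masses of all vertical sections are comparable. Hence the
  integral functionals may be discretised whatever the sign of their exponent at this mass.\<close>

lemma cell_mass:
  assumes x: "\<eta> k \<le> x" "x < \<eta> (k + 1)"
  shows "u k \<le> F (b x) - F (a x)" "F (b x) - F (a x) \<le> 5 * u k"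
proof -
  have x0: "0 < x" using \<eta>_pos[of k] x by simp
  note mono = F_a_mono[OF \<eta>_pos x(1)] F_a_mono[OF x0 less_imp_le[OF x(2)]]
    F_b_mono[OF \<eta>_pos x(1)] F_b_mono[OF x0 less_imp_le[OF x(2)]]
  have "F (\<sigma> (\<eta> (k + 1))) \<le> F (b (\<eta> k))" "F (a (\<eta> (k + 1))) \<le> F (\<sigma> (\<eta> k))"
    using F(2) step_le[of k] \<sigma>_pos[OF \<eta>_pos] a_pos[OF \<eta>_pos] by auto
  then show "u k \<le> F (b x) - F (a x)" using mono by (simp add: u_def)
  show "F (b x) - F (a x) \<le> 5 * u k"
    using mono h_le_u[of k] h_eq[of "k + 1"] h_def[of k] u_def[of k] by linarith
qed

text \<open>As long as the level \<open>a (\<eta> k)\<close> stays below the curve, all steps up to \<open>\<eta> k\<close> are upward steps, and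
  each of them adds at least the mass accumulated before it: a step from \<open>\<eta> l\<close> adds \<open>h l\<close>, which by
  the fairway property is the mass between \<open>a (\<eta> l)\<close> and the curve. So the mass above the
  level \<open>a (\<eta> k)\<close> at least doubles with every step.\<close>

lemma lower_decay:
  assumes y: "y < \<sigma> (\<eta> m)" "a (\<eta> k) < y" and i: "m \<le> k - int i"
  shows "2 ^ i * (F (\<sigma> (\<eta> (k - int i))) - F (a (\<eta> k))) \<le> h k"
  using i
proof (induction i)
  case 0
  then show ?case by (simp add: h_def)
next
  case (Suc i)
  define l where "l = k - int (Suc i)"
  have l1: "k - int i = l + 1" by (simp add: l_def)
  have ml: "m \<le> l" using Suc.prems by (simp add: l_def)
  have "\<sigma> (\<eta> l) \<ge> \<sigma> (\<eta> m)" using \<sigma>_le[OF \<eta>_pos \<eta>_le[OF ml]] .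
  moreover have "a (\<eta> (l + 1)) \<le> a (\<eta> k)" by (intro a_le \<eta>_pos \<eta>_le) (simp add: l_def)
  ultimately have "a (\<eta> (l + 1)) \<noteq> \<sigma> (\<eta> l)" using y by simp
  then have up: "\<sigma> (\<eta> (l + 1)) = b (\<eta> l)" by (cases l rule: step_cases) auto
  have "F (a (\<eta> l)) \<le> F (a (\<eta> k))" by (intro F_a_mono \<eta>_pos \<eta>_le) (simp add: l_def)
  then have "2 * (F (\<sigma> (\<eta> l)) - F (a (\<eta> k))) \<le> F (\<sigma> (\<eta> (l + 1))) - F (a (\<eta> k))"
    using h_eq[of l] h_def[of l] up by simp
  then have "2 ^ i * (2 * (F (\<sigma> (\<eta> l)) - F (a (\<eta> k)))) \<le> 2 ^ i * (F (\<sigma> (\<eta> (l + 1))) - F (a (\<eta> k)))"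
    by (rule mult_left_mono) simp
  also have "\<dots> \<le> h k" using Suc ml unfolding l1 by simp
  finally show ?case by (simp add: l_def algebra_simps)
qed

text \<open>The mirror image: while the curve stays below the level \<open>b (\<eta> k)\<close>, all steps from \<open>\<eta> k\<close> on
  go across.\<close>

lemma upper_decay:
  assumes y: "\<sigma> (\<eta> m) \<le> y" "y < b (\<eta> k)" and i: "k + int i \<le> m"
  shows "2 ^ i * (F (b (\<eta> k)) - F (\<sigma> (\<eta> (k + int i)))) \<le> h k"
  using i
proof (induction i)
  case 0
  then show ?case by (simp add: h_eq)
next
  case (Suc i)
  define l where "l = k + int i"
  have l1: "k + int (Suc i) = l + 1" by (simp add: l_def)
  have ml: "l + 1 \<le> m" using Suc.prems by (simp add: l_def)
  have "\<sigma> (\<eta> (l + 1)) \<le> \<sigma> (\<eta> m)" using \<sigma>_le[OF \<eta>_pos \<eta>_le[OF ml]] .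
  moreover have "b (\<eta> k) \<le> b (\<eta> l)" by (intro b_le \<eta>_pos \<eta>_le) (simp add: l_def)
  ultimately have "\<sigma> (\<eta> (l + 1)) \<noteq> b (\<eta> l)" using y by simp
  then have across: "a (\<eta> (l + 1)) = \<sigma> (\<eta> l)" by (cases l rule: step_cases) auto
  have "F (b (\<eta> k)) \<le> F (b (\<eta> (l + 1)))" by (intro F_b_mono \<eta>_pos \<eta>_le) (simp add: l_def)
  then have "2 * (F (b (\<eta> k)) - F (\<sigma> (\<eta> (l + 1)))) \<le> F (b (\<eta> k)) - F (\<sigma> (\<eta> l))"
    using h_eq[of "l + 1"] h_def[of "l + 1"] across by simp
  then have "2 ^ i * (2 * (F (b (\<eta> k)) - F (\<sigma> (\<eta> (l + 1))))) \<le> 2 ^ i * (F (b (\<eta> k)) - F (\<sigma> (\<eta> l)))"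
    by (rule mult_left_mono) simp
  also have "\<dots> \<le> h k" using Suc.IH ml unfolding l_def by simp
  finally show ?case unfolding l1 by (simp add: algebra_simps)
qed

section \<open>The region between the boundary functions as a union of triangles\<close>

text \<open>For \<open>x\<close> in the \<open>k\<close>th cell, the part of the section \<open>(a x, b x)\<close> below \<open>\<sigma> (\<eta> (k + 1))\<close> and the part above it form
  two triangles, indexed by \<open>(False, k)\<close> and \<open>(True, k)\<close>. The vertical position is measured by the mass
  between \<open>y\<close> and the far end of the zone, normalised by \<open>scale\<close>; if the scale is 0 then the convention \<open>x / 0 = 0\<close>
  leaves an empty triangle.\<close>

definition cell :: "bool \<times> int \<Rightarrow> real set" where
  "cell = (\<lambda>(upper, k). {\<eta> k..<\<eta> (k + 1)})"

definition zone :: "bool \<times> int \<Rightarrow> real set" where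
  "zone = (\<lambda>(upper, k). if upper then {\<sigma> (\<eta> (k + 1))..<b (\<eta> (k + 1))}
     else {a (\<eta> k)<..<\<sigma> (\<eta> (k + 1))})"

definition scale :: "bool \<times> int \<Rightarrow> real" where
  "scale = (\<lambda>(upper, k). if upper then h (k + 1) else 2 * h k)"

definition depth :: "bool \<times> int \<Rightarrow> real \<Rightarrow> real" where
  "depth = (\<lambda>(upper, k) y. (if upper then F (b (\<eta> (k + 1))) - F y else F y - F (a (\<eta> k))) / scale (upper, k))"

definition cut :: "bool \<times> int \<Rightarrow> real \<Rightarrow> real" where
  "cut = (\<lambda>(upper, k) x. depth (upper, k) (if upper then b x else a x))"

lemma scale_nonneg: "0 \<le> scale \<kappa>"
  using h_nonneg by (cases \<kappa>) (auto simp: scale_def)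

lemma zone_pos: "y \<in> zone \<kappa> \<Longrightarrow> 0 < y"
  using a_pos[OF \<eta>_pos] \<sigma>_pos[OF \<eta>_pos]
  by (cases \<kappa>) (force simp: zone_def split: if_splits intro: less_trans less_le_trans)

lemma sets_half_line: "S \<in> sets lebesgue \<Longrightarrow> S \<subseteq> {0..} \<Longrightarrow> S \<in> sets half_line"
  unfolding half_line_def by (subst sets_restrict_space_iff) auto

lemma cell_sets: "cell \<kappa> \<in> sets half_line"
proof (rule sets_half_line)
  show "cell \<kappa> \<subseteq> {0..}"
  proof
    fix x assume "x \<in> cell \<kappa>"
    then have "\<eta> (snd \<kappa>) \<le> x" by (cases \<kappa>) (simp add: cell_def)
    then show "x \<in> {0..}" using \<eta>_pos[of "snd \<kappa>"] by simp
  qed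
qed (cases \<kappa>; simp add: cell_def)

lemma zone_sets: "zone \<kappa> \<in> sets half_line"
proof (rule sets_half_line)
  show "zone \<kappa> \<subseteq> {0..}" using zone_pos[of _ \<kappa>] by (auto intro: less_imp_le)
qed (cases \<kappa>; simp add: zone_def)

lemma depth_measurable: "depth \<kappa> \<in> borel_measurable half_line"
  and cut_measurable: "cut \<kappa> \<in> borel_measurable half_line"
proof -
  note [measurable] = F_measurable F_a_measurable F_b_measurable
  obtain s k where \<kappa>: "\<kappa> = (s, k)" by (cases \<kappa>)
  show "depth \<kappa> \<in> borel_measurable half_line"
    unfolding \<kappa> depth_def by (cases s) simp_all
  show "cut \<kappa> \<in> borel_measurable half_line"
    unfolding \<kappa> cut_def depth_def by (cases s) simp_all
qed

lemma lower_total: "F (\<sigma> (\<eta> (k + 1))) - F (a (\<eta> k)) \<le> 2 * h k"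
  using F(2)[OF \<sigma>_pos[OF \<eta>_pos] step_le(1)[of k]] h_eq[of k] h_def[of k] by simp

lemma depth_le_1:
  assumes "y \<in> zone \<kappa>" shows "depth \<kappa> y \<le> 1"
proof -
  obtain s k where \<kappa>: "\<kappa> = (s, k)" by (cases \<kappa>)
  have y: "0 < y" using zone_pos[OF assms] .
  have "(if s then F (b (\<eta> (k + 1))) - F y else F y - F (a (\<eta> k))) \<le> scale (s, k)"
  proof (cases s)
    case True
    then have "F (\<sigma> (\<eta> (k + 1))) \<le> F y"
      using assms F(2) \<sigma>_pos[OF \<eta>_pos] by (auto simp: \<kappa> zone_def)
    then show ?thesis using True h_eq[of "k + 1"] by (simp add: scale_def)
  next
    case False
    then have "F y \<le> F (\<sigma> (\<eta> (k + 1)))" using assms F(2)[OF y] by (auto simp: \<kappa> zone_def)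
    then show ?thesis using False lower_total[of k] by (simp add: scale_def)
  qed
  then show ?thesis
    using scale_nonneg[of "(s, k)"] by (auto simp: \<kappa> depth_def divide_le_eq_1)
qed

lemma cut_nonneg:
  assumes "x \<in> cell \<kappa>" shows "0 \<le> cut \<kappa> x"
proof -
  obtain s k where \<kappa>: "\<kappa> = (s, k)" by (cases \<kappa>)
  have x: "\<eta> k \<le> x" "x \<le> \<eta> (k + 1)" using assms by (auto simp: \<kappa> cell_def)
  have "0 < x" using x(1) \<eta>_pos[of k] by simp
  then show ?thesis
    using F_a_mono[OF \<eta>_pos x(1)] F_b_mono[OF \<open>0 < x\<close> x(2)] scale_nonneg[of \<kappa>]
    by (auto simp: \<kappa> cut_def depth_def)
qed

lemma zone_mass:
  assumes "0 < s" "s \<le> t"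
  shows "(\<integral>\<^sup>+y. indicator {y \<in> zone \<kappa>. s \<le> depth \<kappa> y \<and> depth \<kappa> y \<le> t} y * ennreal (\<bar>v y\<bar> powr q) \<partial>half_line)
      \<le> ennreal ((t - s) * scale \<kappa>)"
proof -
  obtain up k where \<kappa>: "\<kappa> = (up, k)" by (cases \<kappa>)
  define S where "S = {y \<in> zone \<kappa>. s \<le> depth \<kappa> y \<and> depth \<kappa> y \<le> t}"
  define H where "H = scale \<kappa>"
  have mono: "(\<integral>\<^sup>+y. indicator S y * ennreal (\<bar>v y\<bar> powr q) \<partial>half_line) \<le>
      (\<integral>\<^sup>+y. indicator S' y * ennreal (\<bar>v y\<bar> powr q) \<partial>half_line)" if "S \<subseteq> S'" for S'
    using that by (intro nn_integral_mono) (auto split: split_indicator)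
  show ?thesis
  proof (cases "H = 0")
    case True
    then have "S = {}" using assms by (auto simp: S_def \<kappa> depth_def H_def)
    then show ?thesis by (simp add: S_def[symmetric])
  next
    case False
    then have H: "0 < H" using scale_nonneg[of \<kappa>] by (simp add: H_def)
    have "(\<integral>\<^sup>+y. indicator S y * ennreal (\<bar>v y\<bar> powr q) \<partial>half_line) \<le> ennreal ((t - s) * H)"
    proof (cases up)
      case True
      let ?z = "F (b (\<eta> (k + 1)))"
      have "S \<subseteq> {y \<in> {\<sigma> (\<eta> (k + 1))..b (\<eta> (k + 1))}. ?z - t * H \<le> F y \<and> F y \<le> ?z - s * H}"
        using True H by (auto simp: S_def \<kappa> zone_def depth_def H_def field_simps)
      note mono[OF this]
      also have "(\<integral>\<^sup>+y. indicator {y \<in> {\<sigma> (\<eta> (k + 1))..b (\<eta> (k + 1))}. ?z - t * H \<le> F y \<and> F y \<le> ?z - s * H} y *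
          ennreal (\<bar>v y\<bar> powr q) \<partial>half_line) \<le> ennreal ((?z - s * H) - (?z - t * H))"
        using assms H by (intro level_mass \<sigma>_pos \<eta>_pos) auto
      finally show ?thesis by (simp add: algebra_simps)
    next
      case False
      let ?z = "F (a (\<eta> k))"
      have "S \<subseteq> {y \<in> {a (\<eta> k)..\<sigma> (\<eta> (k + 1))}. ?z + s * H \<le> F y \<and> F y \<le> ?z + t * H}"
        using False H by (auto simp: S_def \<kappa> zone_def depth_def H_def field_simps)
      note mono[OF this]
      also have "(\<integral>\<^sup>+y. indicator {y \<in> {a (\<eta> k)..\<sigma> (\<eta> (k + 1))}. ?z + s * H \<le> F y \<and> F y \<le> ?z + t * H} y *
          ennreal (\<bar>v y\<bar> powr q) \<partial>half_line) \<le> ennreal ((?z + t * H) - (?z + s * H))"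
        using assms H by (intro level_mass a_pos \<eta>_pos) auto
      finally show ?thesis by (simp add: algebra_simps)
    qed
    then show ?thesis by (simp add: S_def H_def)
  qed
qed

lemma cell_overlap: "finite {\<kappa>. x \<in> cell \<kappa>}" "card {\<kappa>. x \<in> cell \<kappa>} \<le> 2"
proof -
  have "\<exists>k. {\<kappa>. x \<in> cell \<kappa>} \<subseteq> {(False, k), (True, k)}"
  proof (cases "{\<kappa>. x \<in> cell \<kappa>} = {}")
    case False
    then obtain s k where "x \<in> cell (s, k)" by auto
    then have k: "\<eta> k \<le> x" "x < \<eta> (k + 1)" by (auto simp: cell_def)
    have "\<kappa> \<in> {(False, k), (True, k)}" if "x \<in> cell \<kappa>" for \<kappa>
      using that cell_unique[OF k] by (cases \<kappa>) (auto simp: cell_def)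
    then show ?thesis by blast
  qed auto
  then obtain k where sub: "{\<kappa>. x \<in> cell \<kappa>} \<subseteq> {(False, k), (True, k)}" by blast
  show "finite {\<kappa>. x \<in> cell \<kappa>}" using sub by (rule finite_subset) simp
  show "card {\<kappa>. x \<in> cell \<kappa>} \<le> 2" using card_mono[OF _ sub] by simp
qed

text \<open>A point \<open>y\<close> at the level of the \<open>m\<close>th rectangle is close, in mass, to the far end of the zone of a
  distant cell \<open>k\<close>, because masses double along the steps between them. So \<open>y\<close> is met
  only by blocks of depth at least \<open>k - m\<close>.\<close>

lemma depth_decay_lower:
  assumes m: "\<sigma> (\<eta> m) \<le> y" "y < \<sigma> (\<eta> (m + 1))"
    and y: "y \<in> zone (False, k)" "1 / 2 ^ j \<le> depth (False, k) y"
  shows "m \<le> k \<and> k - m \<le> int j"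
proof -
  have z: "a (\<eta> k) < y" "y < \<sigma> (\<eta> (k + 1))" using y by (auto simp: zone_def)
  have mk: "m \<le> k"
  proof (rule ccontr)
    assume "\<not> m \<le> k"
    then have "\<sigma> (\<eta> (k + 1)) \<le> \<sigma> (\<eta> m)" by (intro \<sigma>_le \<eta>_pos \<eta>_le) simp
    then show False using z m by simp
  qed
  have d: "1 / 2 ^ j \<le> (F y - F (a (\<eta> k))) / (2 * h k)" using y by (simp add: depth_def scale_def)
  have hk: "0 < h k"
  proof (rule ccontr)
    assume "\<not> 0 < h k"
    then have "h k = 0" using h_nonneg[of k] by simp
    then have "(1::real) / 2 ^ j \<le> 0" using d by simp
    moreover have "(0::real) < 1 / 2 ^ j" by simp
    ultimately show False by linarith
  qed
  have "k - m \<le> int j" if "m < k"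
  proof -
    define i where "i = nat (k - m - 1)"
    have i: "k - int i = m + 1" using that by (simp add: i_def)
    have "2 ^ i * (F (\<sigma> (\<eta> (m + 1))) - F (a (\<eta> k))) \<le> h k"
      using lower_decay[OF m(2) z(1), of i] i by simp
    moreover have "F y \<le> F (\<sigma> (\<eta> (m + 1)))" using F(2)[OF zone_pos[OF y(1)]] m by simp
    then have "2 ^ i * (F y - F (a (\<eta> k))) \<le> 2 ^ i * (F (\<sigma> (\<eta> (m + 1))) - F (a (\<eta> k)))"
      by (intro mult_left_mono) auto
    ultimately have "2 ^ i * (F y - F (a (\<eta> k))) \<le> h k" by linarith
    moreover have "2 * h k / 2 ^ j \<le> F y - F (a (\<eta> k))"
      using d hk by (simp add: field_simps)
    then have "2 ^ i * (2 * h k / 2 ^ j) \<le> 2 ^ i * (F y - F (a (\<eta> k)))"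
      by (intro mult_left_mono) auto
    ultimately have "2 ^ i * (2 * h k / 2 ^ j) \<le> h k" by linarith
    then have "(2::real) ^ Suc i \<le> 2 ^ j" using hk by (simp add: field_simps)
    then have "Suc i \<le> j" by (subst (asm) power_increasing_iff) auto
    then show ?thesis using i by simp
  qed
  then show ?thesis using mk by (cases "m = k") auto
qed

lemma depth_decay_upper:
  assumes m: "\<sigma> (\<eta> m) \<le> y" "y < \<sigma> (\<eta> (m + 1))"
    and y: "y \<in> zone (True, k)" "1 / 2 ^ j \<le> depth (True, k) y"
  shows "k + 1 \<le> m \<and> m - (k + 1) \<le> int j"
proof -
  have z: "\<sigma> (\<eta> (k + 1)) \<le> y" "y < b (\<eta> (k + 1))" using y by (auto simp: zone_def)
  have mk: "k + 1 \<le> m"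
  proof (rule ccontr)
    assume "\<not> k + 1 \<le> m"
    then have "\<sigma> (\<eta> (m + 1)) \<le> \<sigma> (\<eta> (k + 1))" by (intro \<sigma>_le \<eta>_pos \<eta>_le) simp
    then show False using z m by simp
  qed
  have d: "1 / 2 ^ j \<le> (F (b (\<eta> (k + 1))) - F y) / h (k + 1)" using y by (simp add: depth_def scale_def)
  have hk: "0 < h (k + 1)"
  proof (rule ccontr)
    assume "\<not> 0 < h (k + 1)"
    then have "h (k + 1) = 0" using h_nonneg[of "k + 1"] by simp
    then have "(1::real) / 2 ^ j \<le> 0" using d by simp
    moreover have "(0::real) < 1 / 2 ^ j" by simp
    ultimately show False by linarith
  qed
  define i where "i = nat (m - (k + 1))"
  have i: "k + 1 + int i = m" using mk by (simp add: i_def)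
  have "2 ^ i * (F (b (\<eta> (k + 1))) - F (\<sigma> (\<eta> m))) \<le> h (k + 1)"
    using upper_decay[OF m(1) z(2), of i] i by simp
  moreover have "F (\<sigma> (\<eta> m)) \<le> F y" using F(2)[OF \<sigma>_pos[OF \<eta>_pos]] m by simp
  then have "2 ^ i * (F (b (\<eta> (k + 1))) - F y) \<le> 2 ^ i * (F (b (\<eta> (k + 1))) - F (\<sigma> (\<eta> m)))"
    by (intro mult_left_mono) auto
  moreover have "h (k + 1) / 2 ^ j \<le> F (b (\<eta> (k + 1))) - F y"
    using d hk by (simp add: field_simps)
  then have "2 ^ i * (h (k + 1) / 2 ^ j) \<le> 2 ^ i * (F (b (\<eta> (k + 1))) - F y)"
    by (intro mult_left_mono) auto
  ultimately have "2 ^ i * (h (k + 1) / 2 ^ j) \<le> h (k + 1)" by linarith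
  then have "(2::real) ^ i \<le> 2 ^ j" using hk by (simp add: field_simps)
  then have "i \<le> j" by (subst (asm) power_increasing_iff) auto
  then show ?thesis using i mk by simp
qed

lemma zone_overlap:
  "finite {\<kappa>. y \<in> zone \<kappa> \<and> 1 / 2 ^ j \<le> depth \<kappa> y}" (is "finite ?S")
  "card {\<kappa>. y \<in> zone \<kappa> \<and> 1 / 2 ^ j \<le> depth \<kappa> y} \<le> 2 * Suc j"
proof -
  have "\<exists>m. ?S \<subseteq> {False} \<times> {m..m + int j} \<union> {True} \<times> {m - 1 - int j..m - 1}"
  proof (cases "0 < y")
    case True
    obtain x where x: "0 < x" "\<sigma> x = y" using \<sigma>_onto[OF True] by blast
    obtain m where m: "\<eta> m \<le> x" "x < \<eta> (m + 1)" using ex_cell[OF x(1)] by blast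
    have ym: "\<sigma> (\<eta> m) \<le> y" "y < \<sigma> (\<eta> (m + 1))"
      using \<sigma>_le[OF \<eta>_pos m(1)] \<sigma>_less[OF x(1) m(2)] x by auto
    have "\<kappa> \<in> {False} \<times> {m..m + int j} \<union> {True} \<times> {m - 1 - int j..m - 1}"
      if "y \<in> zone \<kappa>" "1 / 2 ^ j \<le> depth \<kappa> y" for \<kappa>
    proof -
      obtain s k where \<kappa>: "\<kappa> = (s, k)" by (cases \<kappa>)
      show ?thesis
      proof (cases s)
        case True
        then show ?thesis using depth_decay_upper[OF ym, of k j] that by (simp add: \<kappa>)
      next
        case False
        then show ?thesis using depth_decay_lower[OF ym, of k j] that by (simp add: \<kappa>)
      qed
    qed
    then show ?thesis by blast
  next
    case False
    then have "?S = {}" using zone_pos by blast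
    then show ?thesis by (metis empty_subsetI)
  qed
  then obtain m where sub: "?S \<subseteq> {False} \<times> {m..m + int j} \<union> {True} \<times> {m - 1 - int j..m - 1}" by blast
  show "finite ?S" using sub by (rule finite_subset) simp
  have "card ?S \<le> card ({False} \<times> {m..m + int j} \<union> {True} \<times> {m - 1 - int j..m - 1})"
    by (intro card_mono sub) simp
  also have "\<dots> \<le> card ({False} \<times> {m..m + int j}) + card ({True} \<times> {m - 1 - int j..m - 1})"
    by (rule card_Un_le)
  also have "\<dots> = 2 * Suc j" by (simp add: card_cartesian_product)
  finally show "card ?S \<le> 2 * Suc j" .
qed

lemma cell_w_mass:
  "(\<integral>\<^sup>+x. indicator (cell (s, k)) x * ennreal (\<bar>w x\<bar> powr p) \<partial>half_line) = ennreal (n k)"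
  using weight_integral_half_line(2)[where u = w and c = "\<eta> k" and d = "\<eta> (k + 1)" and q = p, OF w_nonneg \<eta>_pos] G(2)[OF \<eta>_pos \<eta>_le, of k "k + 1"]
  by (simp add: cell_def n_def)

sublocale tri: triangle_family half_line p \<alpha> w v cell zone depth cut scale
proof unfold_locales
  show "(\<integral>\<^sup>+x. indicator (cell \<kappa>) x * ennreal (\<bar>w x\<bar> powr p) \<partial>half_line) < top" for \<kappa>
    by (cases \<kappa>) (simp add: cell_w_mass)
qed (fact p \<alpha> w_measurable v_measurable cell_sets zone_sets depth_measurable cut_measurable
    depth_le_1 cut_nonneg scale_nonneg zone_mass cell_overlap zone_overlap)+

lemma cut_less_depth:
  assumes "cut (s, k) x < depth (s, k) y"
  shows "if s then F y < F (b x) else F (a x) < F y"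
proof -
  have "scale (s, k) \<noteq> 0" using assms by (auto simp: cut_def depth_def)
  then have "0 < scale (s, k)" using scale_nonneg[of "(s, k)"] by simp
  then show ?thesis using assms by (cases s) (simp_all add: cut_def depth_def divide_less_cancel)
qed

lemma triangle_subset:
  assumes x: "x \<in> cell \<kappa>" and y: "y \<in> zone \<kappa>" and less: "cut \<kappa> x < depth \<kappa> y"
  shows "y \<in> {a x..b x} \<inter> {0..}"
proof -
  obtain s k where \<kappa>: "\<kappa> = (s, k)" by (cases \<kappa>)
  have xk: "\<eta> k \<le> x" "x \<le> \<eta> (k + 1)" using x by (auto simp: \<kappa> cell_def)
  have x0: "0 < x" using xk \<eta>_pos[of k] by simp
  have y0: "0 < y" using zone_pos[OF y] .
  have "a x \<le> y \<and> y \<le> b x"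
  proof (cases s)
    case True
    then have "\<sigma> (\<eta> (k + 1)) \<le> y" using y by (simp add: \<kappa> zone_def)
    moreover have "a x \<le> \<sigma> (\<eta> (k + 1))"
      using a_le[OF x0 xk(2)] \<sigma>_between(1)[OF \<eta>_pos, of "k + 1"] by simp
    moreover have "F y < F (b x)" using cut_less_depth[of s k x y] less True by (simp add: \<kappa>)
    then have "y \<le> b x" using F(2)[OF b_pos[OF x0], of y] by (cases "b x \<le> y") auto
    ultimately show ?thesis by simp
  next
    case False
    then have "y \<le> b (\<eta> k)" using y step_le(1)[of k] by (simp add: \<kappa> zone_def)
    moreover have "b (\<eta> k) \<le> b x" using b_le[OF \<eta>_pos xk(1)] .
    moreover have "F (a x) < F y" using cut_less_depth[of s k x y] less False by (simp add: \<kappa>)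
    then have "a x \<le> y" using F(2)[OF y0, of "a x"] by (cases "y \<le> a x") auto
    ultimately show ?thesis by simp
  qed
  then show ?thesis using y0 by simp
qed

text \<open>The values of \<open>y\<close> excluded here carry no mass.\<close>

lemma triangle_cover:
  assumes x: "\<eta> k \<le> x" "x < \<eta> (k + 1)" and y: "y \<in> {a x..b x}"
    and generic: "y \<noteq> a (\<eta> k)" "F y \<noteq> F (a x)" "F y \<noteq> F (b x)"
  shows "\<exists>\<kappa>. x \<in> cell \<kappa> \<and> y \<in> zone \<kappa> \<and> cut \<kappa> x < depth \<kappa> y"
proof -
  have x0: "0 < x" using x \<eta>_pos[of k] by simp
  have y0: "0 < y" using y a_pos[OF x0] by simp
  have Fy: "F (a x) < F y" "F y < F (b x)"
    using F(2)[OF a_pos[OF x0], of y] F(2)[OF y0, of "b x"] y generic by auto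
  show ?thesis
  proof (cases "y < \<sigma> (\<eta> (k + 1))")
    case True
    have "a (\<eta> k) < y" using a_le[OF \<eta>_pos x(1)] y generic by simp
    moreover have "F (a (\<eta> k)) \<le> F (a x)" using F_a_mono[OF \<eta>_pos x(1)] .
    then have "0 < 2 * h k"
      using F(2)[OF y0, of "\<sigma> (\<eta> (k + 1))"] True lower_total[of k] Fy by simp
    then have "cut (False, k) x < depth (False, k) y"
      using Fy by (simp add: cut_def depth_def scale_def divide_strict_right_mono)
    ultimately show ?thesis
      using x True by (intro exI[of _ "(False, k)"]) (simp add: cell_def zone_def)
  next
    case False
    have "y < b (\<eta> (k + 1))" using b_less[OF x0 x(2)] y by simp
    moreover have "F (b x) \<le> F (b (\<eta> (k + 1)))" using F_b_mono[OF x0] x by simp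
    then have "0 < h (k + 1)"
      using F(2)[OF \<sigma>_pos[OF \<eta>_pos], of "k + 1" y] False h_eq[of "k + 1"] Fy by simp
    then have "cut (True, k) x < depth (True, k) y"
      using Fy by (simp add: cut_def depth_def scale_def divide_strict_right_mono)
    ultimately show ?thesis
      using x False by (intro exI[of _ "(True, k)"]) (simp add: cell_def zone_def)
  qed
qed

lemma triangles_disjoint:
  assumes "x \<in> cell \<kappa>" "y \<in> zone \<kappa>" "x \<in> cell \<mu>" "y \<in> zone \<mu>"
  shows "\<kappa> = \<mu>"
proof -
  obtain s k where \<kappa>: "\<kappa> = (s, k)" by (cases \<kappa>)
  obtain r l where \<mu>: "\<mu> = (r, l)" by (cases \<mu>)
  have "k = l" using assms cell_unique[of k x l] by (auto simp: \<kappa> \<mu> cell_def)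
  then show ?thesis using assms by (cases s; cases r) (auto simp: \<kappa> \<mu> zone_def)
qed

text \<open>The common discretisation of the powers \<open>V powr \<alpha>\<close> and \<open>W powr \<alpha>\<close> of the two functionals along
  the rectangles on the curve.\<close>

definition discrete_functional :: ennreal where
  "discrete_functional = (\<integral>\<^sup>+k. ennreal (n k powr (\<alpha> / p) * u k powr (\<alpha> / q)) \<partial>count_space UNIV)"

lemma sum_approx_numbers_le_dyadic:
  "(\<Sum>m. epowr (approx_number half_line p (Hardy_Steklov a b v w) (Suc m)) \<alpha>) \<le>
    ennreal (dyadic_const p \<alpha>) *
    (\<integral>\<^sup>+\<kappa>. ennreal (tri.wmass (cell \<kappa>) powr (\<alpha> / p) * scale \<kappa> powr (\<alpha> / q)) \<partial>count_space UNIV)"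
proof (rule tri.sum_approx_numbers_triangles[where \<Omega> = "\<lambda>x. {a x..b x} \<inter> {0..}"])
  show "{a x..b x} \<inter> {0..} \<in> sets half_line" for x
    by (rule sets_half_line) auto
  show "AE x in half_line. (\<integral>\<^sup>+y. indicator ({a x..b x} \<inter> {0..}) y * ennreal (\<bar>v y\<bar> powr q) \<partial>half_line) < top"
    using AE_half_line_pos
  proof eventually_elim
    case (elim x)
    have "a x \<le> b x" using \<sigma>_between[OF elim] by simp
    moreover have "{a x..b x} \<inter> {0..} = {a x..b x}" using a_pos[OF elim] by auto
    ultimately show ?case
      using weight_integral_half_line(1)[where u = v and c = "a x" and d = "b x" and q = q, OF v_nonneg a_pos[OF elim]]
        F(3)[OF a_pos[OF elim]] by simp
  qed
  show "\<kappa> = \<mu>" if "x \<in> cell \<kappa>" "y \<in> zone \<kappa>" "cut \<kappa> x < depth \<kappa> y" "x \<in> cell \<mu>" "y \<in> zone \<mu>" "cut \<mu> x < depth \<mu> y"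
    for \<kappa> \<mu> x y
    using triangles_disjoint that by blast
  show "AE x in half_line. AE y in half_line. v y \<noteq> 0 \<longrightarrow> (y \<in> {a x..b x} \<inter> {0..}) =
      (\<exists>\<kappa>. x \<in> cell \<kappa> \<and> y \<in> zone \<kappa> \<and> cut \<kappa> x < depth \<kappa> y)"
    using AE_half_line_pos
  proof eventually_elim
    case (elim x)
    obtain k where k: "\<eta> k \<le> x" "x < \<eta> (k + 1)" using ex_cell[OF elim] by blast
    show ?case
      using AE_half_line_neq[of "a (\<eta> k)"] AE_level_null[OF a_pos[OF elim], of "b x" "F (a x)"]
        AE_level_null[OF a_pos[OF elim], of "b x" "F (b x)"]
    proof eventually_elim
      case (elim y)
      show ?case
      proof (intro impI iffI)
        assume "v y \<noteq> 0" "y \<in> {a x..b x} \<inter> {0..}"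
        then show "\<exists>\<kappa>. x \<in> cell \<kappa> \<and> y \<in> zone \<kappa> \<and> cut \<kappa> x < depth \<kappa> y"
          using elim by (intro triangle_cover[OF k]) auto
      next
        assume "\<exists>\<kappa>. x \<in> cell \<kappa> \<and> y \<in> zone \<kappa> \<and> cut \<kappa> x < depth \<kappa> y"
        then show "y \<in> {a x..b x} \<inter> {0..}" using triangle_subset by blast
      qed
    qed
  qed
  show "AE x in half_line. Hardy_Steklov a b v w f x =
      w x * (\<integral>y. f y * (indicator ({a x..b x} \<inter> {0..}) y * v y) \<partial>half_line)" for f
    using AE_half_line_pos by eventually_elim (intro Hardy_Steklov_half_line a_pos)
qed

lemma wmass_cell: "tri.wmass (cell \<kappa>) = n (snd \<kappa>)"
  using n_nonneg by (cases \<kappa>) (simp add: tri.wmass_def cell_w_mass)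

lemma scale_le: "scale \<kappa> \<le> 4 * u (snd \<kappa>)"
  using h_le_u[of "snd \<kappa>"] u_nonneg[of "snd \<kappa>"] by (cases \<kappa>) (auto simp: scale_def)

text \<open>Both scales of the cell \<open>k\<close> are at most \<open>4 * u k\<close>; the two triangles over each cell account for
  the factor 2.\<close>

lemma sum_approx_numbers_le_discrete:
  "(\<Sum>m. epowr (approx_number half_line p (Hardy_Steklov a b v w) (Suc m)) \<alpha>) \<le>
    ennreal (dyadic_const p \<alpha> * (2 * 4 powr (\<alpha> / q))) * discrete_functional"
proof -
  have "(\<integral>\<^sup>+\<kappa>. ennreal (tri.wmass (cell \<kappa>) powr (\<alpha> / p) * scale \<kappa> powr (\<alpha> / q)) \<partial>count_space UNIV)
      \<le> (\<integral>\<^sup>+\<kappa>. ennreal (4 powr (\<alpha> / q)) * ennreal (n (snd \<kappa>) powr (\<alpha> / p) * u (snd \<kappa>) powr (\<alpha> / q)) \<partial>count_space (UNIV :: (bool \<times> int) set))"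
  proof (intro nn_integral_mono)
    fix \<kappa> :: "bool \<times> int"
    have "scale \<kappa> powr (\<alpha> / q) \<le> (4 * u (snd \<kappa>)) powr (\<alpha> / q)"
      using scale_nonneg[of \<kappa>] scale_le[of \<kappa>] \<alpha> q_pos by (intro powr_mono2) auto
    then have "n (snd \<kappa>) powr (\<alpha> / p) * scale \<kappa> powr (\<alpha> / q)
        \<le> n (snd \<kappa>) powr (\<alpha> / p) * (4 * u (snd \<kappa>)) powr (\<alpha> / q)"
      by (rule mult_left_mono) simp
    then show "ennreal (tri.wmass (cell \<kappa>) powr (\<alpha> / p) * scale \<kappa> powr (\<alpha> / q))
        \<le> ennreal (4 powr (\<alpha> / q)) * ennreal (n (snd \<kappa>) powr (\<alpha> / p) * u (snd \<kappa>) powr (\<alpha> / q))"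
      using u_nonneg[of "snd \<kappa>"]
      by (simp add: wmass_cell powr_mult ac_simps flip: ennreal_mult)
  qed
  also have "\<dots> = ennreal (4 powr (\<alpha> / q)) * (\<integral>\<^sup>+s. discrete_functional \<partial>count_space (UNIV :: bool set))"
    unfolding discrete_functional_def
    by (subst nn_integral_fst_count_space[symmetric]) (simp add: nn_integral_cmult mult.assoc)
  also have "(\<integral>\<^sup>+s. discrete_functional \<partial>count_space (UNIV :: bool set)) = 2 * discrete_functional"
    by (simp add: nn_integral_count_space_finite UNIV_bool mult.commute flip: mult_2)
  finally have "ennreal (dyadic_const p \<alpha>) *
      (\<integral>\<^sup>+\<kappa>. ennreal (tri.wmass (cell \<kappa>) powr (\<alpha> / p) * scale \<kappa> powr (\<alpha> / q)) \<partial>count_space UNIV)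
      \<le> ennreal (dyadic_const p \<alpha>) * (ennreal (4 powr (\<alpha> / q)) * (2 * discrete_functional))"
    by (rule mult_left_mono) simp
  also have "\<dots> = ennreal (dyadic_const p \<alpha> * (2 * 4 powr (\<alpha> / q))) * discrete_functional"
    using dyadic_const_pos(2)[OF p \<alpha>] by (simp add: ennreal_mult ac_simps)
  finally show ?thesis using sum_approx_numbers_le_dyadic by (rule order_trans[rotated])
qed

section \<open>Comparison with the integral functionals\<close>

lemma sum_cells_le_integral:
  fixes g \<rho> :: "real \<Rightarrow> ennreal" and Y :: "int \<Rightarrow> real set"
  assumes [measurable]: "\<rho> \<in> borel_measurable half_line" "\<And>k. Y k \<in> sets half_line"
    and disjoint: "\<And>k l t. t \<in> Y k \<Longrightarrow> t \<in> Y l \<Longrightarrow> k = l"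
    and le: "\<And>k t. t \<in> Y k \<Longrightarrow> C k * \<rho> t \<le> g t"
  shows "(\<integral>\<^sup>+k. C k * (\<integral>\<^sup>+t. indicator (Y k) t * \<rho> t \<partial>half_line) \<partial>count_space UNIV) \<le> (\<integral>\<^sup>+t. g t \<partial>half_line)"
proof -
  have "(\<integral>\<^sup>+k. C k * (\<integral>\<^sup>+t. indicator (Y k) t * \<rho> t \<partial>half_line) \<partial>count_space UNIV) =
      (\<integral>\<^sup>+k. (\<integral>\<^sup>+t. C k * (indicator (Y k) t * \<rho> t) \<partial>half_line) \<partial>count_space UNIV)"
    by (simp add: nn_integral_cmult)
  also have "\<dots> = (\<integral>\<^sup>+t. (\<integral>\<^sup>+k. C k * (indicator (Y k) t * \<rho> t) \<partial>count_space UNIV) \<partial>half_line)"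
    by (rule nn_integral_count_space_nn_integral[symmetric]) auto
  also have "\<dots> \<le> (\<integral>\<^sup>+t. g t \<partial>half_line)"
  proof (intro nn_integral_mono)
    fix t
    show "(\<integral>\<^sup>+k. C k * (indicator (Y k) t * \<rho> t) \<partial>count_space UNIV) \<le> g t"
    proof (cases "\<exists>k. t \<in> Y k")
      case True
      then obtain k where k: "t \<in> Y k" by blast
      have "(\<integral>\<^sup>+k. C k * (indicator (Y k) t * \<rho> t) \<partial>count_space UNIV) = (\<Sum>k\<in>{k}. C k * (indicator (Y k) t * \<rho> t))"
        using disjoint[OF k] by (intro nn_integral_count_space') (auto split: split_indicator)
      then show ?thesis using le[OF k] k by simp
    next
      case False
      then show ?thesis by simp
    qed
  qed
  finally show ?thesis .
qed

text \<open>The horizontal section at a height inside the \<open>k\<close>th rectangle contains the whole \<open>k\<close>th cell.\<close>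

lemma weight_w_ge:
  assumes x: "\<eta> k \<le> x" "x < \<eta> (k + 1)"
  shows "ennreal (n k) \<le> weight_integral w p (pos_inv b (\<sigma> x)) (pos_inv a (\<sigma> x))"
proof -
  have x0: "0 < x" using x \<eta>_pos[of k] by simp
  note bi = b_pos_inv[OF \<sigma>_pos[OF x0]] and ai = a_pos_inv[OF \<sigma>_pos[OF x0]]
  have "\<sigma> x < \<sigma> (\<eta> (k + 1))" "\<sigma> (\<eta> k) \<le> \<sigma> x" using \<sigma>_less[OF x0 x(2)] \<sigma>_le[OF \<eta>_pos x(1)] by auto
  then have le: "b (pos_inv b (\<sigma> x)) < b (\<eta> k)" "a (\<eta> (k + 1)) \<le> a (pos_inv a (\<sigma> x))"
    using step_le[of k] bi ai by auto
  have "pos_inv b (\<sigma> x) \<le> \<eta> k"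
    using le(1) b_le[OF \<eta>_pos, of k "pos_inv b (\<sigma> x)"] by (cases "\<eta> k \<le> pos_inv b (\<sigma> x)") auto
  moreover have "\<eta> (k + 1) \<le> pos_inv a (\<sigma> x)"
    using le(2) a_less[OF ai(1), of "\<eta> (k + 1)"] by (cases "\<eta> (k + 1) \<le> pos_inv a (\<sigma> x)") auto
  ultimately have "weight_integral w p (\<eta> k) (\<eta> (k + 1)) \<le> weight_integral w p (pos_inv b (\<sigma> x)) (pos_inv a (\<sigma> x))"
    by (rule weight_integral_mono)
  then show ?thesis using G(2)[OF \<eta>_pos \<eta>_le, of k "k + 1"] by (simp add: n_def)
qed

lemma weight_v_eq:
  assumes "0 < x" shows "weight_integral v q (a x) (b x) = ennreal (F (b x) - F (a x))"
  using F(3)[OF a_pos[OF assms], of "b x"] \<sigma>_between[OF assms] by simp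

text \<open>The factor on the left absorbs the variation of the section mass between \<open>u k\<close> and \<open>5 * u k\<close>, which
  matters for negative \<open>e\<close> only. If \<open>u k = 0\<close> then the \<open>k\<close>th cell contributes
  nothing to the left-hand side.\<close>

lemma discrete_le_V:
  assumes e: "e = \<alpha> / q - 1"
  shows "ennreal (min 1 (5 powr e)) * discrete_functional \<le>
     (\<integral>\<^sup>+ t\<in>{0<..}.
          epowr (weight_integral w p (pos_inv b t) (pos_inv a t)) (\<alpha> / p) *
          epowr (weight_integral v q (a (pos_inv \<sigma> t)) (b (pos_inv \<sigma> t))) (\<alpha> / q - 1) *
          ennreal (v t powr q) \<partial>lebesgue)"
proof -
  define K where "K = min 1 (5 powr e)"
  have K: "0 \<le> K" by (simp add: K_def)
  define C where "C k = ennreal (n k powr (\<alpha> / p)) * ennreal (K * u k powr e)" for k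
  define Y where "Y k = {\<sigma> (\<eta> k)..<\<sigma> (\<eta> (k + 1))}" for k
  have Y_cell: "\<exists>x. \<sigma> x = t \<and> \<eta> k \<le> x \<and> x < \<eta> (k + 1)" if "t \<in> Y k" for k t
  proof -
    have t: "\<sigma> (\<eta> k) \<le> t" "t < \<sigma> (\<eta> (k + 1))" using that by (auto simp: Y_def)
    obtain x where x: "0 < x" "\<sigma> x = t" using \<sigma>_onto[of t] t \<sigma>_pos[OF \<eta>_pos, of k] by auto
    have "\<eta> k \<le> x" using t x \<sigma>_less[OF x(1), of "\<eta> k"] by (cases "\<eta> k \<le> x") auto
    moreover have "x < \<eta> (k + 1)" using t x \<sigma>_le[OF \<eta>_pos, of "k + 1" x] by (cases "\<eta> (k + 1) \<le> x") auto
    ultimately show ?thesis using x by blast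
  qed
  have "ennreal K * discrete_functional =
      (\<integral>\<^sup>+k. C k * (\<integral>\<^sup>+t. indicator (Y k) t * ennreal (\<bar>v t\<bar> powr q) \<partial>half_line) \<partial>count_space UNIV)"
    unfolding discrete_functional_def
  proof (subst nn_integral_cmult[symmetric]; (intro nn_integral_cong)?)
    fix k
    have "(\<integral>\<^sup>+t. indicator (Y k) t * ennreal (\<bar>v t\<bar> powr q) \<partial>half_line) = ennreal (u k)"
      unfolding Y_def u_def
      using weight_integral_half_line(2)[where u = v and c = "\<sigma> (\<eta> k)" and d = "\<sigma> (\<eta> (k + 1))" and q = q,
          OF v_nonneg \<sigma>_pos[OF \<eta>_pos]] F(3)[OF \<sigma>_pos[OF \<eta>_pos] \<sigma>_le[OF \<eta>_pos \<eta>_le], of k "k + 1"] by simp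
    moreover have "u k powr (\<alpha> / q) = u k powr e * u k"
      using u_nonneg[of k] by (cases "u k = 0") (simp_all add: e powr_diff)
    ultimately show "ennreal K * ennreal (n k powr (\<alpha> / p) * u k powr (\<alpha> / q)) =
        C k * (\<integral>\<^sup>+t. indicator (Y k) t * ennreal (\<bar>v t\<bar> powr q) \<partial>half_line)"
      using K u_nonneg[of k] by (simp add: C_def ac_simps flip: ennreal_mult)
  qed simp
  also have "\<dots> \<le> (\<integral>\<^sup>+t. epowr (weight_integral w p (pos_inv b t) (pos_inv a t)) (\<alpha> / p) *
          epowr (weight_integral v q (a (pos_inv \<sigma> t)) (b (pos_inv \<sigma> t))) (\<alpha> / q - 1) *
          ennreal (v t powr q) \<partial>half_line)"
  proof (rule sum_cells_le_integral)
    show "(\<lambda>t. ennreal (\<bar>v t\<bar> powr q)) \<in> borel_measurable half_line"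
      using v_measurable by measurable
    show "Y k \<in> sets half_line" for k
      unfolding Y_def using \<sigma>_pos[OF \<eta>_pos, of k] by (intro sets_half_line) auto
    show "k = l" if kl: "t \<in> Y k" "t \<in> Y l" for k l t
    proof -
      obtain x where x: "\<sigma> x = t" "\<eta> k \<le> x" "x < \<eta> (k + 1)" using Y_cell[OF kl(1)] by blast
      obtain z where z: "\<sigma> z = t" "\<eta> l \<le> z" "z < \<eta> (l + 1)" using Y_cell[OF kl(2)] by blast
      have "x = z" using \<sigma>_pos_inv[of x] \<sigma>_pos_inv[of z] x z \<eta>_pos[of k] \<eta>_pos[of l] by simp
      then show ?thesis using cell_unique x z by blast
    qed
    fix k t assume "t \<in> Y k"
    then obtain x where x: "\<sigma> x = t" "\<eta> k \<le> x" "x < \<eta> (k + 1)" using Y_cell by blast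
    have x0: "0 < x" using x \<eta>_pos[of k] by simp
    have inv: "pos_inv \<sigma> t = x" using \<sigma>_pos_inv[OF x0] x by simp
    have t0: "0 < t" using \<sigma>_pos[OF x0] x by simp
    have w: "ennreal (n k powr (\<alpha> / p)) \<le> epowr (weight_integral w p (pos_inv b t) (pos_inv a t)) (\<alpha> / p)"
      using epowr_mono[OF weight_w_ge[OF x(2,3)], of "\<alpha> / p"] p \<alpha> n_nonneg[of k] x(1)
      by (simp add: epowr_ennreal)
    have v: "ennreal (K * u k powr e) \<le> epowr (weight_integral v q (a x) (b x)) (\<alpha> / q - 1)"
    proof (cases "u k = 0")
      case False
      then have u: "0 < u k" using u_nonneg[of k] by simp
      define m where "m = F (b x) - F (a x)"
      have m: "u k \<le> m" "m \<le> 5 * u k" "0 < m" using cell_mass[OF x(2,3)] u by (auto simp: m_def)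
      have "K * u k powr e \<le> m powr e"
      proof (cases "0 \<le> e")
        case True
        have "K * u k powr e \<le> 1 * u k powr e" by (intro mult_right_mono) (auto simp: K_def)
        also have "\<dots> \<le> m powr e" using True m u by (simp add: powr_mono2)
        finally show ?thesis .
      next
        case False
        have "K * u k powr e \<le> 5 powr e * u k powr e" by (intro mult_right_mono) (auto simp: K_def)
        also have "\<dots> = (5 * u k) powr e" using u by (simp add: powr_mult)
        also have "\<dots> \<le> m powr e" using False m by (intro powr_mono2') auto
        finally show ?thesis .
      qed
      then show ?thesis
        using m(3) unfolding weight_v_eq[OF x0] m_def[symmetric] e[symmetric] by (simp add: epowr_ennreal_pos)
    qed simp
    show "C k * ennreal (\<bar>v t\<bar> powr q) \<le> epowr (weight_integral w p (pos_inv b t) (pos_inv a t)) (\<alpha> / p) *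
          epowr (weight_integral v q (a (pos_inv \<sigma> t)) (b (pos_inv \<sigma> t))) (\<alpha> / q - 1) * ennreal (v t powr q)"
      unfolding inv C_def using w v v_nonneg[of t] t0 by (auto intro!: mult_mono)
  qed
  finally show ?thesis unfolding K_def set_nn_integral_half_line .
qed

text \<open>Here \<open>p \<le> \<alpha>\<close> makes the exponent of the \<open>w\<close>-mass of the horizontal section non-negative, so that
  this mass may be replaced by the smaller mass \<open>n k\<close> of the cell.\<close>

lemma discrete_le_W:
  assumes p\<alpha>: "p \<le> \<alpha>"
  shows "discrete_functional \<le>
     (\<integral>\<^sup>+ t\<in>{0<..}.
          epowr (weight_integral w p (pos_inv b (\<sigma> t)) (pos_inv a (\<sigma> t))) (\<alpha> / p - 1) *
          epowr (weight_integral v q (a t) (b t)) (\<alpha> / q) *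
          ennreal (w t powr p) \<partial>lebesgue)"
proof -
  define e where "e = \<alpha> / p - 1"
  have e: "0 \<le> e" using p p\<alpha> by (simp add: e_def)
  define C where "C k = ennreal (n k powr e) * ennreal (u k powr (\<alpha> / q))" for k
  define Y where "Y k = {\<eta> k..<\<eta> (k + 1)}" for k
  have "discrete_functional =
      (\<integral>\<^sup>+k. C k * (\<integral>\<^sup>+t. indicator (Y k) t * ennreal (\<bar>w t\<bar> powr p) \<partial>half_line) \<partial>count_space UNIV)"
    unfolding discrete_functional_def
  proof (intro nn_integral_cong)
    fix k
    have "(\<integral>\<^sup>+t. indicator (Y k) t * ennreal (\<bar>w t\<bar> powr p) \<partial>half_line) = ennreal (n k)"
      using cell_w_mass[of True k] by (simp add: Y_def cell_def)
    moreover have "n k powr (\<alpha> / p) = n k powr e * n k"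
      using n_nonneg[of k] by (cases "n k = 0") (simp_all add: e_def powr_diff)
    ultimately show "ennreal (n k powr (\<alpha> / p) * u k powr (\<alpha> / q)) =
        C k * (\<integral>\<^sup>+t. indicator (Y k) t * ennreal (\<bar>w t\<bar> powr p) \<partial>half_line)"
      using n_nonneg[of k] by (simp add: C_def ac_simps flip: ennreal_mult)
  qed
  also have "\<dots> \<le> (\<integral>\<^sup>+t. epowr (weight_integral w p (pos_inv b (\<sigma> t)) (pos_inv a (\<sigma> t))) (\<alpha> / p - 1) *
          epowr (weight_integral v q (a t) (b t)) (\<alpha> / q) * ennreal (w t powr p) \<partial>half_line)"
  proof (rule sum_cells_le_integral)
    show "(\<lambda>t. ennreal (\<bar>w t\<bar> powr p)) \<in> borel_measurable half_line"
      using w_measurable by measurable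
    show "Y k \<in> sets half_line" for k
      unfolding Y_def using \<eta>_pos[of k] by (intro sets_half_line) auto
    show "k = l" if "t \<in> Y k" "t \<in> Y l" for k l t
      using that cell_unique by (auto simp: Y_def)
    fix k t assume "t \<in> Y k"
    then have t: "\<eta> k \<le> t" "t < \<eta> (k + 1)" by (auto simp: Y_def)
    have t0: "0 < t" using t \<eta>_pos[of k] by simp
    have w: "ennreal (n k powr e) \<le> epowr (weight_integral w p (pos_inv b (\<sigma> t)) (pos_inv a (\<sigma> t))) (\<alpha> / p - 1)"
    proof (cases "n k = 0")
      case False
      then have "0 < n k" using n_nonneg[of k] by simp
      then show ?thesis
        using epowr_mono[OF weight_w_ge[OF t] e] by (simp add: epowr_ennreal_pos e_def)
    qed simp
    have "epowr (ennreal (u k)) (\<alpha> / q) \<le> epowr (weight_integral v q (a t) (b t)) (\<alpha> / q)"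
      unfolding weight_v_eq[OF t0] using cell_mass[OF t] \<alpha> q_pos by (intro epowr_mono ennreal_leI) auto
    then have v: "ennreal (u k powr (\<alpha> / q)) \<le> epowr (weight_integral v q (a t) (b t)) (\<alpha> / q)"
      using u_nonneg[of k] \<alpha> q_pos by (simp add: epowr_ennreal)
    show "C k * ennreal (\<bar>w t\<bar> powr p) \<le> epowr (weight_integral w p (pos_inv b (\<sigma> t)) (pos_inv a (\<sigma> t))) (\<alpha> / p - 1) *
          epowr (weight_integral v q (a t) (b t)) (\<alpha> / q) * ennreal (w t powr p)"
      unfolding C_def using w v w_nonneg[of t] t0 by (auto intro!: mult_mono)
  qed
  finally show ?thesis unfolding set_nn_integral_half_line .
qed

end

section \<open>The Schatten norm estimate\<close>

definition Hardy_Steklov_const :: "real \<Rightarrow> real \<Rightarrow> real" where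
  "Hardy_Steklov_const p \<alpha> = dyadic_const p \<alpha> * (2 * 4 powr (\<alpha> / conj_exp p)) / min 1 (5 powr (\<alpha> / conj_exp p - 1))"

lemma Hardy_Steklov_const_pos: "1 < p \<Longrightarrow> 1 < \<alpha> \<Longrightarrow> 0 < Hardy_Steklov_const p \<alpha>"
  using dyadic_const_pos(2)[of p \<alpha>] by (simp add: Hardy_Steklov_const_def)

context fairway_data
begin

lemma Schatten_norm_le:
  assumes "ennreal (min 1 (5 powr (\<alpha> / q - 1))) * discrete_functional \<le> A"
  shows "Schatten_norm half_line p \<alpha> (Hardy_Steklov a b v w)
    \<le> ennreal (Hardy_Steklov_const p \<alpha> powr (1 / \<alpha>)) * epowr A (1 / \<alpha>)"
proof -
  define K where "K = min 1 (5 powr (\<alpha> / q - 1))"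
  have K: "0 < K" by (simp add: K_def)
  define c where "c = Hardy_Steklov_const p \<alpha>"
  have c: "0 < c" "c * K = dyadic_const p \<alpha> * (2 * 4 powr (\<alpha> / q))"
    using Hardy_Steklov_const_pos[OF p \<alpha>] K by (simp_all add: c_def Hardy_Steklov_const_def flip: K_def)
  have "(\<Sum>m. epowr (approx_number half_line p (Hardy_Steklov a b v w) (Suc m)) \<alpha>)
      \<le> ennreal (c * K) * discrete_functional"
    unfolding c(2) by (rule sum_approx_numbers_le_discrete)
  also have "\<dots> = ennreal c * (ennreal K * discrete_functional)"
    using c(1) K by (simp add: ennreal_mult mult.assoc)
  also have "\<dots> \<le> ennreal c * A"
    using assms by (intro mult_left_mono) (auto simp: K_def)
  finally have "Schatten_norm half_line p \<alpha> (Hardy_Steklov a b v w) \<le> epowr (ennreal c * A) (1 / \<alpha>)"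
    unfolding Schatten_norm_def using \<alpha> by (intro epowr_mono) auto
  also have "\<dots> = ennreal (c powr (1 / \<alpha>)) * epowr A (1 / \<alpha>)"
    using \<alpha> c by (simp add: epowr_mult epowr_ennreal)
  finally show ?thesis by (simp add: c_def)
qed

lemma Schatten_norm_le_V:
  "Schatten_norm half_line p \<alpha> (Hardy_Steklov a b v w)
    \<le> ennreal (Hardy_Steklov_const p \<alpha> powr (1 / \<alpha>)) * V_functional p \<alpha> a b \<sigma> v w"
  unfolding V_functional_def by (rule Schatten_norm_le[OF discrete_le_V[OF refl]])

lemma Schatten_norm_le_W:
  assumes "p \<le> \<alpha>"
  shows "Schatten_norm half_line p \<alpha> (Hardy_Steklov a b v w)
    \<le> ennreal (Hardy_Steklov_const p \<alpha> powr (1 / \<alpha>)) * W_functional p \<alpha> a b \<sigma> v w"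
  unfolding W_functional_def
proof (rule Schatten_norm_le, rule order_trans[OF _ discrete_le_W[OF assms]])
  show "ennreal (min 1 (5 powr (\<alpha> / q - 1))) * discrete_functional \<le> discrete_functional"
    using mult_right_mono[of "ennreal (min 1 (5 powr (\<alpha> / q - 1)))" 1 discrete_functional] by simp
qed

end

theorem theorem3p1:
  fixes p \<alpha> :: real
  assumes "1 < p" and "1 < \<alpha>"
  shows "\<exists>c::real. 0 < c \<and>
    (\<forall>a b v w \<sigma> :: real \<Rightarrow> real.
       boundary_functions a b \<and>
       (\<forall>x\<ge>0. 0 \<le> v x) \<and> (\<forall>x\<ge>0. 0 \<le> w x) \<and>
       v \<in> Lp_loc {0<..} (conj_exp p) \<and> w \<in> Lp_loc {0<..} p \<and>
       fairway p a b v \<sigma> \<and>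
       Lp_compact_operator half_line p (Hardy_Steklov a b v w) \<longrightarrow>
       (\<alpha> \<le> p \<longrightarrow>
          Schatten_norm half_line p \<alpha> (Hardy_Steklov a b v w)
            \<le> ennreal c * V_functional p \<alpha> a b \<sigma> v w) \<and>
       (p \<le> \<alpha> \<longrightarrow>
          Schatten_norm half_line p \<alpha> (Hardy_Steklov a b v w)
            \<le> ennreal c * W_functional p \<alpha> a b \<sigma> v w))"
proof (intro exI[of _ "Hardy_Steklov_const p \<alpha> powr (1 / \<alpha>)"] conjI allI impI)
  show "0 < Hardy_Steklov_const p \<alpha> powr (1 / \<alpha>)"
    using Hardy_Steklov_const_pos[OF assms] by simp
  fix a b v w \<sigma> :: "real \<Rightarrow> real"
  assume hyp: "boundary_functions a b \<and>
       (\<forall>x\<ge>0. 0 \<le> v x) \<and> (\<forall>x\<ge>0. 0 \<le> w x) \<and>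
       v \<in> Lp_loc {0<..} (conj_exp p) \<and> w \<in> Lp_loc {0<..} p \<and>
       fairway p a b v \<sigma> \<and>
       Lp_compact_operator half_line p (Hardy_Steklov a b v w)"
  interpret fairway_data p \<alpha> a b v w \<sigma>
    using hyp assms by unfold_locales auto
  show "Schatten_norm half_line p \<alpha> (Hardy_Steklov a b v w)
      \<le> ennreal (Hardy_Steklov_const p \<alpha> powr (1 / \<alpha>)) * V_functional p \<alpha> a b \<sigma> v w"
    by (rule Schatten_norm_le_V)
  show "Schatten_norm half_line p \<alpha> (Hardy_Steklov a b v w)
      \<le> ennreal (Hardy_Steklov_const p \<alpha> powr (1 / \<alpha>)) * W_functional p \<alpha> a b \<sigma> v w" if "p \<le> \<alpha>"
    by (rule Schatten_norm_le_W[OF that])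
qed

end
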